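(* Let $n\ge 1$, let $D=B(0,r_0)\subset\mathbb{R}^n$ be an open ball centered at $0$, and let $f$ be a convex, real analytic function on a neighborhood of the closed ball $\bar D$, not identically zero, with $f(0)=0$ and $\nabla f(0)=0$. Let $\phi:\mathbb{R}^n\to\mathbb{R}$ be a $C^{n+1}$ function supported in $D$. Then there is a constant $C$, depending only on $\phi$ and $f$, such that for every $v=(v_1,\dots,v_{n+1})\in\mathbb{R}^{n+1}$ with $|v|=1$ and $v_{n+1}\ge 0$ and every real $t\neq 0$, $$|\hat\mu(tv)|\le C\,m\big(\{x\in S' : \pi(x)\in\bar D,\ s(v)\le x\cdot v\le s(v)+|t|^{-1}\}\big).$$
   Context: Here $S'\subset\mathbb{R}^{n+1}$ is the hypersurface which, over the neighborhood of $\bar D$ on which $f$ is defined, is the graph $x_{n+1}=f(x_1,\dots,x_n)$; only the portion of $S'$ above $\bar D$ matters. $\pi:\mathbb{R}^{n+1}\to\mathbb{R}^n$ is the projection onto the first $n$ coordinates, and $m$ is Euclidean surface measure ($n$-dimensional) on $S'$. For $\lambda=(\lambda_1,\dots,\lambda_{n+1})\in\mathbb{R}^{n+1}$, $$\hat\mu(\lambda)=\int_{\mathbb{R}^n}e^{-i\lambda_1x_1-\dots-i\lambda_nx_n-i\lambda_{n+1}f(x_1,\dots,x_n)}\,\phi(x_1,\dots,x_n)\,dx_1\cdots dx_n .$$ For $v\in\mathbb{R}^{n+1}$ with $|v|=1$ and $v_{n+1}\ge0$, $$s(v)=\min\{x\cdot v : x\in S',\ \pi(x)\in\bar D\}.$$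 *)

theory Defs
  imports "HOL-Analysis.Analysis"
begin

(* Throughout, n = CARD('n), and R^(n+1) is the Euclidean space (real^'n) \<times> real with its product
   norm and inner product; the projection \<pi> onto the first n coordinates is fst, and the last
   coordinate is snd. *)

(* Multi-indices are functions 'n \<Rightarrow> nat; has_sum over all of them is unconditional (for reals:
   absolute) convergence of the power series. *)
definition real_analytic_on :: "(real^'n \<Rightarrow> real) \<Rightarrow> (real^'n) set \<Rightarrow> bool"
    (infixl \<open>real'_analytic'_on\<close> 50) where
  "f real_analytic_on U \<longleftrightarrow>
     (\<forall>a\<in>U. \<exists>r>0. \<exists>c :: ('n \<Rightarrow> nat) \<Rightarrow> real. \<forall>x\<in>ball a r.
        ((\<lambda>\<alpha>. c \<alpha> * (\<Prod>i\<in>UNIV. (x $ i - a $ i) ^ \<alpha> i)) has_sum f x) UNIV)"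

definition partial_deriv :: "'n \<Rightarrow> (real^'n \<Rightarrow> real) \<Rightarrow> real^'n \<Rightarrow> real" where
  "partial_deriv i g x = frechet_derivative g (at x) (axis i 1)"

primrec C_k :: "nat \<Rightarrow> (real^'n \<Rightarrow> real) \<Rightarrow> bool" where
  "C_k 0 g \<longleftrightarrow> continuous_on UNIV g"
| "C_k (Suc k) g \<longleftrightarrow> g differentiable_on UNIV \<and> (\<forall>i. C_k k (partial_deriv i g))"

(* Meaningful only at points where f is differentiable. *)
definition gradient :: "(real^'n \<Rightarrow> real) \<Rightarrow> real^'n \<Rightarrow> real^'n" where
  "gradient f x = (THE d. GDERIV f x :> d)"

definition graph_hypersurface :: "(real^'n) set \<Rightarrow> (real^'n \<Rightarrow> real) \<Rightarrow> ((real^'n) \<times> real) set" where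
  "graph_hypersurface U f = (\<lambda>x. (x, f x)) ` U"

(* n-dimensional surface measure on the graph of a C^1 function f over the open set U: the image
   of the area element sqrt (1 + |grad f|^2) dx under the parametrization x \<mapsto> (x, f x). *)
definition graph_surface_measure ::
    "(real^'n) set \<Rightarrow> (real^'n \<Rightarrow> real) \<Rightarrow> ((real^'n) \<times> real) measure" where
  "graph_surface_measure U f =
     distr (density (restrict_space lborel U) (\<lambda>x. ennreal (sqrt (1 + (norm (gradient f x))\<^sup>2))))
       borel (\<lambda>x. (x, f x))"

(* f is only meaningful near the closed ball containing the support of \<phi>; its values elsewhere
   do not matter, since the integrand vanishes where \<phi> does. *)
definition mu_hat :: "(real^'n \<Rightarrow> real) \<Rightarrow> (real^'n \<Rightarrow> real) \<Rightarrow> (real^'n) \<times> real \<Rightarrow> complex" where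
  "mu_hat f \<phi> l =
     (\<integral>x. exp (- \<i> * complex_of_real (fst l \<bullet> x + snd l * f x)) * complex_of_real (\<phi> x) \<partial>lborel)"

(* The part of the hypersurface above the closed ball of radius r0. *)
definition graph_over_cball ::
    "(real^'n) set \<Rightarrow> (real^'n \<Rightarrow> real) \<Rightarrow> real \<Rightarrow> ((real^'n) \<times> real) set" where
  "graph_over_cball U f r0 = {p \<in> graph_hypersurface U f. fst p \<in> cball 0 r0}"

(* The minimum is attained when f is continuous on a neighborhood U of the closed ball and
   r0 \<ge> 0, the set being compact and nonempty. *)
definition s_min ::
    "(real^'n) set \<Rightarrow> (real^'n \<Rightarrow> real) \<Rightarrow> real \<Rightarrow> (real^'n) \<times> real \<Rightarrow> real" where
  "s_min U f r0 v = (LEAST y. \<exists>p\<in>graph_over_cball U f r0. y = p \<bullet> v)"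

end

theory Submission
  imports Defs "HOL-Library.Function_Algebras"
begin

text \<open>
  Let \<open>x0\<close> minimize the convex phase \<open>g x = fst v \<bullet> x + snd v * f x\<close> over the closed ball, and
  use polar coordinates around \<open>x0\<close>. On the ray in direction \<open>\<omega>\<close> the function
  \<open>h \<rho> = \<bar>t\<bar> * (g (x0 + \<rho> \<omega>) - g x0)\<close> is convex and nonnegative with \<open>h 0 = 0\<close>. If \<open>h R = 1\<close>, then
  \<open>h' \<rho> \<ge> h \<rho> / \<rho> \<ge> 1 / R\<close> beyond \<open>R\<close>, and \<open>n + 1\<close> integrations by parts against the weight \<open>\<rho> ^ (n - 1)\<close>
  bound the integral over the ray by a multiple of \<open>R ^ n\<close>, which is the share of the ray in the
  volume of the cap. This needs the bounds \<open>\<bar>h^(j) \<rho>\<bar> \<rho> ^ (j - 1) \<le> C h' \<rho>\<close> uniformly in \<open>v\<close>, \<open>x0\<close> and \<open>\<omega>\<close>; as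
  \<open>h' 0 \<ge> 0\<close>, it suffices that \<open>\<bar>F^(j) \<rho>\<bar> \<rho> ^ (j - 1) \<le> C (F' \<rho> - F' 0)\<close> for \<open>F \<rho> = f (x0 + \<rho> \<omega>)\<close>.

  The Taylor coefficients of \<open>F\<close> are analytic functions of \<open>x0\<close> and \<open>\<omega>\<close> which may vanish simultaneously
  (\<open>f\<close> may be affine along some segments), so compactness alone does not give a uniform constant. It
  comes from Noetherianity with bounds: locally, finitely many of these coefficients dominate all of
  them. Hence \<open>F' \<rho> - F' 0\<close> behaves like a polynomial of bounded degree in \<open>\<rho>\<close>, and being monotone it
  controls its coefficients.
\<close>

text \<open>The minimum point x0 may lie on the boundary sphere, so there is no critical point
  equation; what survives is h' 0 >= 0 on rays that stay in the ball for a while. This is enough: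
  for j >= 2 the derivative h^(j) is |t| v_(n+1) F^(j), while h' = h' 0 + |t| v_(n+1) (F' - F' 0).
  The linear part of the phase, v and t thus cancel from the required inequality, which becomes a
  statement about f alone.

  After only n integrations by parts the amplitude would have size R^n / rho, and its integral would
  grow with the logarithm of the length of the ray; one more step gives R^(n+1) / rho^2, with
  integral at most R^n beyond R. Each step differentiates the amplitude once, whence the class
  C^(n+1).

  On the side of the measure only a lower bound is wanted. The area element is at least 1, so the
  Lebesgue measure of the projected cap suffices. This projection is convex and contains x0, hence
  it meets each ray in an initial segment.\<close>

section \<open>Germs of convergent power series\<close>

text \<open>
  A germ at the origin is represented by its Taylor coefficients, indexed by a monoid of exponents.
  The weight \<open>N\<close> turns exponents into natural numbers (below, \<open>\<alpha>\<close> becomes \<open>\<Prod>v. p v ^ \<alpha> v\<close> for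
  distinct primes \<open>p v\<close>): growth bounded by a power of \<open>N\<close> means convergence near the origin, and the
  characters of order \<open>\<kappa>\<close> are the evaluations at points \<open>z\<close> with \<open>\<bar>z v\<bar> \<le> p v ^ (-\<kappa>)\<close>. Since \<open>N\<close> is
  injective, every nonzero germ has a unique term of least weight, and that term dominates
  all the others after the rescaling \<open>\<alpha> \<mapsto> N \<alpha> ^ (-k)\<close> with \<open>k\<close> large.
\<close>

locale monomials =
  fixes N :: "'i::cancel_comm_monoid_add \<Rightarrow> nat"
  assumes inj_N: "inj N"
    and N_add: "N (\<alpha> + \<beta>) = N \<alpha> * N \<beta>"
    and N_pos: "0 < N \<alpha>"
    and dickson: "\<exists>F\<subseteq>(E :: 'i set). finite F \<and> (\<forall>\<epsilon>\<in>E. \<exists>\<phi>\<in>F. \<exists>\<delta>. \<epsilon> = \<phi> + \<delta>)"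
begin

definition splits :: "'i \<Rightarrow> ('i \<times> 'i) set" where
  "splits \<gamma> = {p. fst p + snd p = \<gamma>}"

definition conv :: "('i \<Rightarrow> real) \<Rightarrow> ('i \<Rightarrow> real) \<Rightarrow> 'i \<Rightarrow> real" where
  "conv a b \<gamma> = (\<Sum>p\<in>splits \<gamma>. a (fst p) * b (snd p))"

definition growth :: "('i \<Rightarrow> real) \<Rightarrow> real \<Rightarrow> nat \<Rightarrow> bool" where
  "growth a C k \<longleftrightarrow> (\<forall>\<alpha>. \<bar>a \<alpha>\<bar> \<le> C * real (N \<alpha>) ^ k)"

definition character :: "('i \<Rightarrow> real) \<Rightarrow> nat \<Rightarrow> bool" where
  "character \<eta> \<kappa> \<longleftrightarrow> (\<forall>\<alpha> \<beta>. \<eta> (\<alpha> + \<beta>) = \<eta> \<alpha> * \<eta> \<beta>) \<and> (\<forall>\<alpha>. \<bar>\<eta> \<alpha>\<bar> * real (N \<alpha>) ^ \<kappa> \<le> 1)"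

definition evalc :: "('i \<Rightarrow> real) \<Rightarrow> ('i \<Rightarrow> real) \<Rightarrow> real" where
  "evalc \<eta> a = (\<Sum>\<^sub>\<infinity>\<alpha>. a \<alpha> * \<eta> \<alpha>)"

text \<open>As \<open>N\<close> is injective with positive values, this is a subseries of the sum of
  n^(-2). It is the cost of one evaluation: a germ with growth constant \<open>C\<close> takes
  values of size at most \<open>C * zeta2\<close> at characters of large enough order.\<close>

definition zeta2 :: real where "zeta2 = (\<Sum>\<^sub>\<infinity>\<alpha>. 1 / real (N \<alpha>) ^ 2)"

text \<open>The ideal generated by \<open>S\<close> in the ring of convergent germs. Growth
  constants are not uniform over it; the inductive form lets every member carry its own.\<close>

inductive_set germ_ideal :: "('i \<Rightarrow> real) set \<Rightarrow> ('i \<Rightarrow> real) set" for S where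
  zero: "(\<lambda>_. 0) \<in> germ_ideal S"
| base: "b \<in> S \<Longrightarrow> b \<in> germ_ideal S"
| step: "a \<in> germ_ideal S \<Longrightarrow> b \<in> germ_ideal S \<Longrightarrow> growth c C k \<Longrightarrow>
    (\<lambda>\<gamma>. a \<gamma> + conv c b \<gamma>) \<in> germ_ideal S"

lemma N_ge1: "1 \<le> real (N \<alpha>)"
  using N_pos[of \<alpha>] by linarith

lemma inj_fst_splits: "inj_on fst (splits \<gamma>)" and inj_snd_splits: "inj_on snd (splits \<gamma>)"
  by (auto simp: splits_def inj_on_def prod_eq_iff)

lemma N_split: "p \<in> splits \<gamma> \<Longrightarrow> N \<gamma> = N (fst p) * N (snd p)"
  by (auto simp: splits_def N_add)

text \<open>As \<open>N\<close> is injective, a split is determined by the weight of its first part,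
  which lies between 1 and \<open>N \<gamma>\<close>.\<close>

lemma finite_splits: "finite (splits \<gamma>)" and card_splits: "card (splits \<gamma>) \<le> N \<gamma>"
proof -
  have inj: "inj_on (N \<circ> fst) (splits \<gamma>)"
    using inj_fst_splits inj_N by (metis comp_inj_on inj_on_subset subset_UNIV)
  have sub: "(N \<circ> fst) ` splits \<gamma> \<subseteq> {1..N \<gamma>}"
    using N_pos by (auto simp: N_split Suc_le_eq)
  show "finite (splits \<gamma>)"
    using inj sub finite_imageD finite_subset by blast
  show "card (splits \<gamma>) \<le> N \<gamma>"
    using card_inj_on_le[OF inj sub] by simp
qed

lemma growthD: "growth a C k \<Longrightarrow> \<bar>a \<alpha>\<bar> \<le> C * real (N \<alpha>) ^ k"
  by (simp add: growth_def)

lemma growth_nonneg: "growth a C k \<Longrightarrow> 0 \<le> C"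
  using growthD[of a C k 0] N_pos[of 0]
  by (smt (verit) mult_nonneg_nonneg of_nat_0_less_iff zero_le_mult_iff zero_less_power)

lemma growth_mono:
  assumes "growth a C k" "C \<le> C'" "k \<le> k'"
  shows "growth a C' k'"
  unfolding growth_def
proof
  fix \<alpha>
  have "\<bar>a \<alpha>\<bar> \<le> C * real (N \<alpha>) ^ k" using assms growthD by blast
  also have "\<dots> \<le> C' * real (N \<alpha>) ^ k'"
    using assms(2,3) N_ge1 growth_nonneg[OF assms(1)] by (intro mult_mono power_increasing) auto
  finally show "\<bar>a \<alpha>\<bar> \<le> C' * real (N \<alpha>) ^ k'" .
qed

text \<open>The extra power of \<open>N\<close> pays for the number of splits of an exponent, which
  is at most its weight.\<close>

lemma growth_conv:
  assumes a: "growth a C k" and b: "growth b D l"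
  shows "growth (conv a b) (C * D) (k + l + 1)"
  unfolding growth_def
proof
  fix \<gamma>
  have C: "0 \<le> C" "0 \<le> D" using a b growth_nonneg by auto
  have "\<bar>conv a b \<gamma>\<bar> \<le> (\<Sum>p\<in>splits \<gamma>. C * D * real (N \<gamma>) ^ (k + l))"
    unfolding conv_def
  proof (rule order_trans[OF sum_abs] sum_mono)+
    fix p assume p: "p \<in> splits \<gamma>"
    have le: "real (N (fst p)) \<le> N \<gamma>" "real (N (snd p)) \<le> N \<gamma>"
      using N_pos[of "fst p"] N_pos[of "snd p"] by (simp_all add: N_split[OF p])
    have "\<bar>a (fst p) * b (snd p)\<bar> \<le> (C * real (N (fst p)) ^ k) * (D * real (N (snd p)) ^ l)"
      unfolding abs_mult using a b C by (intro mult_mono) (auto simp: growthD)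
    also have "\<dots> \<le> (C * real (N \<gamma>) ^ k) * (D * real (N \<gamma>) ^ l)"
      using le C by (intro mult_mono mult_left_mono power_mono) auto
    finally show "\<bar>a (fst p) * b (snd p)\<bar> \<le> C * D * real (N \<gamma>) ^ (k + l)"
      by (simp add: power_add mult_ac)
  qed
  also have "\<dots> \<le> real (N \<gamma>) * (C * D * real (N \<gamma>) ^ (k + l))"
    using card_splits[of \<gamma>] C by (auto intro!: mult_right_mono)
  finally show "\<bar>conv a b \<gamma>\<bar> \<le> C * D * real (N \<gamma>) ^ (k + l + 1)"
    by (simp add: mult_ac)
qed

lemma summable_zeta2: "(\<lambda>\<alpha>. 1 / real (N \<alpha>) ^ 2) summable_on UNIV"
proof -
  have "summable (\<lambda>n. 1 / real n ^ 2)"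
    using inverse_power_summable[of 2, where 'a = real] by (simp add: field_simps)
  then have "(\<lambda>n. 1 / real n ^ 2) summable_on UNIV"
    by (intro norm_summable_imp_summable_on) auto
  then have "(\<lambda>n. 1 / real n ^ 2) summable_on (range N)"
    using summable_on_subset_banach by blast
  then show ?thesis
    using summable_on_reindex[OF inj_N, of "\<lambda>n. 1 / real n ^ 2"] by (simp add: o_def)
qed

lemma zeta2_nonneg: "0 \<le> zeta2"
  unfolding zeta2_def by (intro infsum_nonneg) auto

lemma characterD: "character \<eta> \<kappa> \<Longrightarrow> \<eta> (\<alpha> + \<beta>) = \<eta> \<alpha> * \<eta> \<beta>"
  by (simp add: character_def)

text \<open>Of the order of the character, \<open>k\<close> cancels the growth of the germ; the
  remaining 2 leave a summable majorant.\<close>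

lemma term_bound:
  assumes "growth a C k" "character \<eta> \<kappa>" "k + 2 \<le> \<kappa>"
  shows "\<bar>a \<alpha> * \<eta> \<alpha>\<bar> \<le> C * (1 / real (N \<alpha>) ^ 2)"
proof -
  have C: "0 \<le> C" using growth_nonneg assms by blast
  have "\<bar>\<eta> \<alpha>\<bar> * real (N \<alpha>) ^ (k + 2) \<le> \<bar>\<eta> \<alpha>\<bar> * real (N \<alpha>) ^ \<kappa>"
    using assms N_ge1 by (intro mult_left_mono power_increasing) auto
  also have "\<dots> \<le> 1" using assms(2) by (simp add: character_def)
  finally have *: "\<bar>\<eta> \<alpha>\<bar> * real (N \<alpha>) ^ (k + 2) \<le> 1" .
  have "\<bar>a \<alpha> * \<eta> \<alpha>\<bar> * real (N \<alpha>) ^ 2 \<le> C * real (N \<alpha>) ^ k * \<bar>\<eta> \<alpha>\<bar> * real (N \<alpha>) ^ 2"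
    unfolding abs_mult using growthD[OF assms(1), of \<alpha>] by (intro mult_right_mono) auto
  also have "\<dots> = C * (\<bar>\<eta> \<alpha>\<bar> * real (N \<alpha>) ^ (k + 2))" by (simp add: power_add mult_ac power2_eq_square)
  also have "\<dots> \<le> C" using * C mult_left_mono[of _ 1 C] by simp
  finally show ?thesis using N_pos[of \<alpha>] by (simp add: field_simps)
qed

lemma eval_abs_summable:
  assumes "growth a C k" "character \<eta> \<kappa>" "k + 2 \<le> \<kappa>"
  shows "(\<lambda>\<alpha>. norm (a \<alpha> * \<eta> \<alpha>)) summable_on UNIV"
proof (rule summable_on_comparison_test)
  show "(\<lambda>\<alpha>. C * (1 / real (N \<alpha>) ^ 2)) summable_on UNIV"
    using summable_zeta2 by (intro summable_on_cmult_right)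
qed (use term_bound[OF assms] in auto)

lemma eval_summable:
  assumes "growth a C k" "character \<eta> \<kappa>" "k + 2 \<le> \<kappa>"
  shows "(\<lambda>\<alpha>. a \<alpha> * \<eta> \<alpha>) summable_on UNIV"
  by (rule Infinite_Sum.abs_summable_summable[OF eval_abs_summable[OF assms]])

lemma eval_bound:
  assumes "growth a C k" "character \<eta> \<kappa>" "k + 2 \<le> \<kappa>"
  shows "\<bar>evalc \<eta> a\<bar> \<le> C * zeta2"
proof -
  have "norm (evalc \<eta> a) \<le> C * zeta2"
    unfolding evalc_def zeta2_def
  proof (rule norm_infsum_le)
    show "((\<lambda>\<alpha>. a \<alpha> * \<eta> \<alpha>) has_sum (\<Sum>\<^sub>\<infinity>\<alpha>. a \<alpha> * \<eta> \<alpha>)) UNIV"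
      using eval_summable[OF assms] by (rule has_sum_infsum)
    show "((\<lambda>\<alpha>. C * (1 / real (N \<alpha>) ^ 2)) has_sum C * (\<Sum>\<^sub>\<infinity>\<alpha>. 1 / real (N \<alpha>) ^ 2)) UNIV"
      using has_sum_infsum[OF summable_zeta2] by (rule has_sum_cmult_right)
  qed (use term_bound[OF assms] in auto)
  then show ?thesis by simp
qed

lemma eval_add:
  assumes "(\<lambda>\<alpha>. a \<alpha> * \<eta> \<alpha>) summable_on UNIV" "(\<lambda>\<alpha>. b \<alpha> * \<eta> \<alpha>) summable_on UNIV"
  shows "evalc \<eta> (\<lambda>\<alpha>. a \<alpha> + b \<alpha>) = evalc \<eta> a + evalc \<eta> b"
  unfolding evalc_def using infsum_add[OF assms] by (simp add: distrib_right)

lemma eval_sum: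
  assumes "finite F" "\<And>f. f \<in> F \<Longrightarrow> (\<lambda>\<alpha>. a f \<alpha> * \<eta> \<alpha>) summable_on UNIV"
  shows "evalc \<eta> (\<lambda>\<alpha>. \<Sum>f\<in>F. a f \<alpha>) = (\<Sum>f\<in>F. evalc \<eta> (a f))"
proof -
  have "((\<lambda>\<alpha>. \<Sum>f\<in>F. a f \<alpha> * \<eta> \<alpha>) has_sum (\<Sum>f\<in>F. evalc \<eta> (a f))) UNIV"
    using assms
  proof (induction F)
    case (insert f F)
    have "((\<lambda>\<alpha>. a f \<alpha> * \<eta> \<alpha>) has_sum evalc \<eta> (a f)) UNIV"
      unfolding evalc_def using insert.prems by (intro has_sum_infsum) auto
    moreover have "((\<lambda>\<alpha>. \<Sum>f\<in>F. a f \<alpha> * \<eta> \<alpha>) has_sum (\<Sum>f\<in>F. evalc \<eta> (a f))) UNIV"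
      using insert by auto
    ultimately show ?case
      using insert.hyps by (simp add: has_sum_add)
  qed simp
  then show ?thesis by (simp add: evalc_def infsumI sum_distrib_right)
qed

text \<open>Cauchy product: absolute summability of the double family allows pairs to be regrouped
  by their sum \<open>\<gamma>\<close>, and multiplicativity of \<open>\<eta>\<close> gives all
  members of a group the common factor \<open>\<eta> \<gamma>\<close>.\<close>

lemma eval_conv:
  assumes a: "growth a C k" and b: "growth b D l" and \<eta>: "character \<eta> \<kappa>" "k + 2 \<le> \<kappa>" "l + 2 \<le> \<kappa>"
  shows "evalc \<eta> (conv a b) = evalc \<eta> a * evalc \<eta> b"
proof -
  define G where "G p = (a (fst p) * \<eta> (fst p)) * (b (snd p) * \<eta> (snd p))" for p
  have sa: "(\<lambda>\<alpha>. norm (a \<alpha> * \<eta> \<alpha>)) summable_on UNIV" and sb: "(\<lambda>\<alpha>. norm (b \<alpha> * \<eta> \<alpha>)) summable_on UNIV"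
    using eval_abs_summable a b \<eta> by blast+
  have "(\<lambda>p. norm (G p)) summable_on (UNIV \<times> UNIV)"
    unfolding Infinite_Sum.abs_summable_on_Sigma_iff
  proof (intro conjI ballI)
    fix x
    show "(\<lambda>y. norm (G (x, y))) summable_on UNIV"
      unfolding G_def fst_conv snd_conv norm_mult[of "a x * \<eta> x"]
      using sb by (intro summable_on_cmult_right)
    have "(\<lambda>x. \<Sum>\<^sub>\<infinity>y. norm (G (x, y))) = (\<lambda>x. norm (a x * \<eta> x) * (\<Sum>\<^sub>\<infinity>y. norm (b y * \<eta> y)))"
      unfolding G_def fst_conv snd_conv norm_mult[of "a _ * \<eta> _"]
      by (intro ext infsum_cmult_right impI) (use sb in simp)
    moreover have "(\<lambda>x. norm (a x * \<eta> x) * (\<Sum>\<^sub>\<infinity>y. norm (b y * \<eta> y))) summable_on UNIV"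
      using sa by (intro summable_on_cmult_left)
    ultimately show "(\<lambda>x. norm (\<Sum>\<^sub>\<infinity>y. norm (G (x, y)))) summable_on UNIV"
      using summable_on_iff_abs_summable_on_real by metis
  qed
  then have sG: "G summable_on (UNIV \<times> UNIV)"
    by (rule Infinite_Sum.abs_summable_summable)
  have 1: "infsum G (UNIV \<times> UNIV) = evalc \<eta> a * evalc \<eta> b"
  proof -
    have "infsum G (UNIV \<times> UNIV) = (\<Sum>\<^sub>\<infinity>x. \<Sum>\<^sub>\<infinity>y. G (x, y))"
      using infsum_Sigma_banach[OF sG] by simp
    also have "\<dots> = (\<Sum>\<^sub>\<infinity>x. a x * \<eta> x * evalc \<eta> b)"
      unfolding G_def fst_conv snd_conv evalc_def
      by (intro infsum_cong infsum_cmult_right) (rule Infinite_Sum.abs_summable_summable[OF sb])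
    also have "\<dots> = evalc \<eta> a * evalc \<eta> b"
      unfolding evalc_def
      by (intro infsum_cmult_left) (rule Infinite_Sum.abs_summable_summable[OF sa])
    finally show ?thesis .
  qed
  have eq: "G summable_on (UNIV \<times> UNIV) \<longleftrightarrow> (\<lambda>(\<gamma>, p). G p) summable_on (Sigma UNIV splits)"
    by (rule summable_on_reindex_bij_witness[where i = snd and j = "\<lambda>p. (fst p + snd p, p)"])
       (auto simp: splits_def)
  have eq2: "infsum G (UNIV \<times> UNIV) = infsum (\<lambda>(\<gamma>, p). G p) (Sigma UNIV splits)"
    by (rule infsum_reindex_bij_witness[where i = snd and j = "\<lambda>p. (fst p + snd p, p)"])
       (auto simp: splits_def)
  have "infsum (\<lambda>(\<gamma>, p). G p) (Sigma UNIV splits) = (\<Sum>\<^sub>\<infinity>\<gamma>. \<Sum>\<^sub>\<infinity>p\<in>splits \<gamma>. G p)"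
    using infsum_Sigma'_banach[of "\<lambda>\<gamma> p. G p" UNIV splits] sG eq by simp
  also have "\<dots> = evalc \<eta> (conv a b)"
    unfolding evalc_def
  proof (rule infsum_cong)
    fix \<gamma>
    have "(\<Sum>\<^sub>\<infinity>p\<in>splits \<gamma>. G p) = (\<Sum>p\<in>splits \<gamma>. G p)"
      using finite_splits by simp
    also have "\<dots> = (\<Sum>p\<in>splits \<gamma>. (a (fst p) * b (snd p)) * \<eta> \<gamma>)"
      using characterD[OF \<eta>(1)] by (intro sum.cong) (auto simp: splits_def G_def mult_ac)
    finally show "(\<Sum>\<^sub>\<infinity>p\<in>splits \<gamma>. G p) = conv a b \<gamma> * \<eta> \<gamma>"
      by (simp add: conv_def sum_distrib_right)
  qed
  finally show ?thesis using 1 eq2 by simp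
qed

lemma germ_ideal_growth:
  assumes S: "\<And>b. b \<in> S \<Longrightarrow> growth b B k" and "g \<in> germ_ideal S"
  shows "\<exists>C l. growth g C l"
  using assms(2)
proof induction
  case zero
  have "growth (\<lambda>_. 0) 0 0" by (simp add: growth_def)
  then show ?case by blast
next
  case (step a b c C k)
  then obtain C1 l1 C2 l2 where a: "growth a C1 l1" and b: "growth b C2 l2" by blast
  define l where "l = l1 + (k + l2 + 1)"
  have 1: "growth a C1 l" using a by (rule growth_mono) (auto simp: l_def)
  have 2: "growth (conv c b) (C * C2) l"
    using growth_conv[OF step.hyps(3) b] by (rule growth_mono) (auto simp: l_def)
  have "growth (\<lambda>\<gamma>. a \<gamma> + conv c b \<gamma>) (C1 + C * C2) l"
    unfolding growth_def
  proof
    fix \<alpha> show "\<bar>a \<alpha> + conv c b \<alpha>\<bar> \<le> (C1 + C * C2) * real (N \<alpha>) ^ l"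
      using growthD[OF 1, of \<alpha>] growthD[OF 2, of \<alpha>] by (simp add: distrib_right)
  qed
  then show ?case by blast
qed (use S in blast)

text \<open>A member of the ideal involves finitely many generators, with coefficients whose values
  are controlled by \<open>eval_bound\<close>. The order this takes depends on the growth of the
  coefficients; admitting all orders beyond a threshold lets several members be treated at
  once.\<close>

lemma germ_ideal_eval:
  assumes S: "\<And>b. b \<in> S \<Longrightarrow> growth b B k" and "g \<in> germ_ideal S"
  shows "\<exists>T\<subseteq>S. finite T \<and> (\<exists>C\<ge>0. \<exists>\<kappa>0. \<forall>\<kappa>\<ge>\<kappa>0. \<forall>\<eta>. character \<eta> \<kappa> \<longrightarrow>
           \<bar>evalc \<eta> g\<bar> \<le> C * (\<Sum>b\<in>T. \<bar>evalc \<eta> b\<bar>))"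
  using assms(2)
proof induction
  case zero
  then show ?case by (intro exI[of _ "{}"]) (auto simp: evalc_def)
next
  case (base b)
  then show ?case by (intro exI[of _ "{b}"]) (auto intro!: exI[of _ 1])
next
  case (step a b c D l)
  obtain T1 C1 k1 where 1: "T1 \<subseteq> S" "finite T1" "C1 \<ge> 0"
    "\<And>\<kappa> \<eta>. \<kappa> \<ge> k1 \<Longrightarrow> character \<eta> \<kappa> \<Longrightarrow> \<bar>evalc \<eta> a\<bar> \<le> C1 * (\<Sum>b\<in>T1. \<bar>evalc \<eta> b\<bar>)"
    using step.IH(1) by blast
  obtain T2 C2 k2 where 2: "T2 \<subseteq> S" "finite T2" "C2 \<ge> 0"
    "\<And>\<kappa> \<eta>. \<kappa> \<ge> k2 \<Longrightarrow> character \<eta> \<kappa> \<Longrightarrow> \<bar>evalc \<eta> b\<bar> \<le> C2 * (\<Sum>b\<in>T2. \<bar>evalc \<eta> b\<bar>)"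
    using step.IH(2) by blast
  obtain A1 l1 A2 l2 where g: "growth a A1 l1" "growth b A2 l2"
    using germ_ideal_growth[OF S] step.hyps(1,2) by metis
  note gc = step.hyps(3)
  have D: "D \<ge> 0" using gc growth_nonneg by blast
  define \<kappa>0 where "\<kappa>0 = k1 + k2 + l1 + l2 + l + 3"
  define C where "C = C1 + D * zeta2 * C2"
  have "\<bar>evalc \<eta> (\<lambda>\<gamma>. a \<gamma> + conv c b \<gamma>)\<bar> \<le> C * (\<Sum>b\<in>T1 \<union> T2. \<bar>evalc \<eta> b\<bar>)"
    if \<kappa>: "\<kappa> \<ge> \<kappa>0" and \<eta>: "character \<eta> \<kappa>" for \<kappa> \<eta>
  proof -
    have "evalc \<eta> (\<lambda>\<gamma>. a \<gamma> + conv c b \<gamma>) = evalc \<eta> a + evalc \<eta> (conv c b)"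
      by (intro eval_add eval_summable[OF g(1) \<eta>] eval_summable[OF growth_conv[OF gc g(2)] \<eta>])
         (use \<kappa> \<kappa>0_def in auto)
    also have "evalc \<eta> (conv c b) = evalc \<eta> c * evalc \<eta> b"
      by (intro eval_conv[OF gc g(2) \<eta>]) (use \<kappa> \<kappa>0_def in auto)
    finally have "\<bar>evalc \<eta> (\<lambda>\<gamma>. a \<gamma> + conv c b \<gamma>)\<bar> \<le> \<bar>evalc \<eta> a\<bar> + \<bar>evalc \<eta> c\<bar> * \<bar>evalc \<eta> b\<bar>"
      by (simp add: abs_mult[symmetric])
    also have "\<dots> \<le> C1 * (\<Sum>b\<in>T1. \<bar>evalc \<eta> b\<bar>) + D * zeta2 * (C2 * (\<Sum>b\<in>T2. \<bar>evalc \<eta> b\<bar>))"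
      using \<kappa> D zeta2_nonneg
      by (intro add_mono mult_mono 1(4)[OF _ \<eta>] 2(4)[OF _ \<eta>] eval_bound[OF gc \<eta>]) (auto simp: \<kappa>0_def)
    also have "\<dots> \<le> C1 * (\<Sum>b\<in>T1 \<union> T2. \<bar>evalc \<eta> b\<bar>) + D * zeta2 * (C2 * (\<Sum>b\<in>T1 \<union> T2. \<bar>evalc \<eta> b\<bar>))"
      using 1 2 D zeta2_nonneg
      by (intro add_mono mult_left_mono sum_mono2) auto
    finally show ?thesis by (simp add: C_def algebra_simps)
  qed
  moreover have "C \<ge> 0" using 1 2 D zeta2_nonneg by (simp add: C_def)
  ultimately show ?case using 1 2 by (intro exI[of _ "T1 \<union> T2"]) blast
qed

lemma germ_ideal_sum:
  assumes "finite F" "a \<in> germ_ideal S" "\<And>f. f \<in> F \<Longrightarrow> g f \<in> germ_ideal S"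
    "\<And>f. f \<in> F \<Longrightarrow> \<exists>C k. growth (c f) C k"
  shows "(\<lambda>\<gamma>. a \<gamma> + (\<Sum>f\<in>F. conv (c f) (g f) \<gamma>)) \<in> germ_ideal S"
  using assms
proof (induction F)
  case (insert f F)
  obtain C k where "growth (c f) C k" using insert.prems by blast
  then have "(\<lambda>\<gamma>. (a \<gamma> + (\<Sum>f\<in>F. conv (c f) (g f) \<gamma>)) + conv (c f) (g f) \<gamma>) \<in> germ_ideal S"
    using insert by (intro germ_ideal.step) auto
  then show ?case using insert.hyps by (simp add: add_ac)
qed simp

text \<open>
  Division with remainder by the germs \<open>x^f + e f\<close>, \<open>f \<in> F\<close>. The quotients are cut out of a germ \<open>b\<close>
  with \<open>b + T b = a\<close>, where \<open>T\<close> only involves values of \<open>b\<close> at smaller weights: this gives \<open>b\<close>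
  by recursion on \<open>N\<close>, and \<open>T\<close> having norm at most \<open>1 / 2\<close> in the norm weighted by \<open>N ^ (-k)\<close>
  gives the bound.
\<close>

lemma division:
  assumes F: "finite F"
    and e: "\<And>f \<beta>. f \<in> F \<Longrightarrow> e f \<beta> \<noteq> 0 \<Longrightarrow> N f < N \<beta>"
    and small: "\<And>f B. f \<in> F \<Longrightarrow> finite B \<Longrightarrow> (\<Sum>\<beta>\<in>B. \<bar>e f \<beta>\<bar> * (N f / N \<beta>) ^ k) \<le> c f"
    and c: "(\<Sum>f\<in>F. c f) \<le> 1 / 2"
    and a: "growth a A k"
  shows "\<exists>q R. (\<forall>f\<in>F. growth (q f) (2 * A * real (N f) ^ k) k) \<and> (\<forall>f\<in>F. \<forall>\<delta>. R (f + \<delta>) = 0) \<and>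
     (\<forall>\<gamma>. a \<gamma> = (\<Sum>f\<in>F. conv (q f) (\<lambda>\<beta>. (if \<beta> = f then 1 else 0) + e f \<beta>) \<gamma>) + R \<gamma>)"
proof -
  have A: "A \<ge> 0" using a growth_nonneg by blast
  \<comment> \<open>Several members of \<open>F\<close> may divide the same exponent.
    \<open>\<sigma>\<close> commits each divisible exponent to one of them, so that its coefficient
    in \<open>b\<close> goes into exactly one quotient.\<close>
  define \<sigma> where "\<sigma> \<gamma> = (SOME f. f \<in> F \<and> (\<exists>\<delta>. \<gamma> = f + \<delta>))" for \<gamma>
  have \<sigma>: "\<sigma> (f + \<delta>) \<in> F \<and> (\<exists>\<delta>'. f + \<delta> = \<sigma> (f + \<delta>) + \<delta>')" if "f \<in> F" for f \<delta>
    unfolding \<sigma>_def by (rule someI[of _ f]) (use that in blast)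
  \<comment> \<open>The guard \<open>e f (snd p) \<noteq> 0\<close> restricts the recursive calls to
    exponents of smaller weight; it changes no value, since the term has the factor
    \<open>e f (snd p)\<close> anyway.\<close>
  define H where "H g \<gamma> = a \<gamma> - (\<Sum>f\<in>F. \<Sum>p\<in>splits \<gamma>.
      (if \<sigma> (f + fst p) = f \<and> e f (snd p) \<noteq> 0 then g (f + fst p) else 0) * e f (snd p))" for g \<gamma>
  define b where "b = wfrec (Wellfounded.measure N) H"
  have less: "N (f + fst p) < N \<gamma>" if "f \<in> F" "p \<in> splits \<gamma>" "e f (snd p) \<noteq> 0" for f p \<gamma>
    using e[OF that(1,3)] N_pos[of "fst p"] by (simp add: N_split[OF that(2)] N_add)
  have b_eq: "b \<gamma> = H b \<gamma>" for \<gamma>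
  proof -
    have "b \<gamma> = H (cut b (Wellfounded.measure N) \<gamma>) \<gamma>" unfolding b_def by (rule wfrec) simp
    also have "\<dots> = H b \<gamma>"
      unfolding H_def
      by (intro arg_cong2[where f = "(-)"] sum.cong refl arg_cong2[where f = "(*)"] if_cong)
         (use less in \<open>auto simp: cut_def\<close>)
    finally show ?thesis .
  qed
  \<comment> \<open>The factor 2 reproduces itself in the recursion: A + (1 / 2) (2 A) = 2
    A.\<close>
  have b_bound: "\<bar>b \<gamma>\<bar> \<le> 2 * A * real (N \<gamma>) ^ k" for \<gamma>
  proof (induction \<gamma> rule: measure_induct_rule[where f = N])
    case (less \<gamma>)
    have "\<bar>\<Sum>f\<in>F. \<Sum>p\<in>splits \<gamma>.
      (if \<sigma> (f + fst p) = f \<and> e f (snd p) \<noteq> 0 then b (f + fst p) else 0) * e f (snd p)\<bar>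
      \<le> (\<Sum>f\<in>F. \<Sum>p\<in>splits \<gamma>. 2 * A * real (N \<gamma>) ^ k * (\<bar>e f (snd p)\<bar> * (N f / N (snd p)) ^ k))"
    proof (rule order_trans[OF sum_abs] sum_mono)+
      fix f p assume fp: "f \<in> F" "p \<in> splits \<gamma>"
      show "\<bar>(if \<sigma> (f + fst p) = f \<and> e f (snd p) \<noteq> 0 then b (f + fst p) else 0) * e f (snd p)\<bar>
        \<le> 2 * A * real (N \<gamma>) ^ k * (\<bar>e f (snd p)\<bar> * (N f / N (snd p)) ^ k)"
      proof (cases "\<sigma> (f + fst p) = f \<and> e f (snd p) \<noteq> 0")
        case True
        have "\<bar>b (f + fst p)\<bar> \<le> 2 * A * real (N (f + fst p)) ^ k"
          using less \<open>\<And>p f \<gamma>. f \<in> F \<Longrightarrow> p \<in> splits \<gamma> \<Longrightarrow> e f (snd p) \<noteq> 0 \<Longrightarrow> N (f + fst p) < N \<gamma>\<close> fp True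
          by blast
        also have "real (N (f + fst p)) = real (N \<gamma>) * (N f / N (snd p))"
          using N_pos[of "snd p"] by (simp add: N_split[OF fp(2)] N_add)
        finally have "\<bar>b (f + fst p)\<bar> * \<bar>e f (snd p)\<bar> \<le> 2 * A * (real (N \<gamma>) * (N f / N (snd p))) ^ k * \<bar>e f (snd p)\<bar>"
          by (rule mult_right_mono) simp
        then show ?thesis using True by (simp only: power_mult_distrib abs_mult) (simp add: mult_ac)
      qed (use A in auto)
    qed
    also have "\<dots> \<le> (\<Sum>f\<in>F. 2 * A * real (N \<gamma>) ^ k * c f)"
    proof (rule sum_mono)
      fix f assume f: "f \<in> F"
      have "(\<Sum>p\<in>splits \<gamma>. \<bar>e f (snd p)\<bar> * (N f / N (snd p)) ^ k) \<le> c f"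
        using small[OF f finite_imageI[OF finite_splits], of snd \<gamma>]
        by (simp add: sum.reindex[OF inj_snd_splits])
      then show "(\<Sum>p\<in>splits \<gamma>. 2 * A * real (N \<gamma>) ^ k * (\<bar>e f (snd p)\<bar> * (N f / N (snd p)) ^ k))
         \<le> 2 * A * real (N \<gamma>) ^ k * c f"
        unfolding sum_distrib_left[symmetric] using A by (intro mult_left_mono) auto
    qed
    also have "\<dots> \<le> 2 * A * real (N \<gamma>) ^ k * (1 / 2)"
      unfolding sum_distrib_left[symmetric] using A c by (intro mult_left_mono) auto
    finally show ?case
      using b_eq[of \<gamma>] growthD[OF a, of \<gamma>] unfolding H_def by linarith
  qed
  define q where "q f \<alpha> = (if \<sigma> (f + \<alpha>) = f then b (f + \<alpha>) else 0)" for f \<alpha>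
  define R where "R \<gamma> = (if \<exists>f\<in>F. \<exists>\<delta>. \<gamma> = f + \<delta> then 0 else b \<gamma>)" for \<gamma>
  have 1: "growth (q f) (2 * A * real (N f) ^ k) k" for f
    unfolding growth_def q_def
    using b_bound[of "f + _"] A by (auto simp: N_add power_mult_distrib mult_ac)
  have "a \<gamma> = (\<Sum>f\<in>F. conv (q f) (\<lambda>\<beta>. (if \<beta> = f then 1 else 0) + e f \<beta>) \<gamma>) + R \<gamma>" for \<gamma>
  proof -
    have lead: "conv (q f) (\<lambda>\<beta>. if \<beta> = f then 1 else 0) \<gamma> =
        (if (\<exists>\<delta>. \<gamma> = f + \<delta>) \<and> \<sigma> \<gamma> = f then b \<gamma> else 0)" for f
    proof (cases "\<exists>\<delta>. \<gamma> = f + \<delta>")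
      case True
      then obtain \<delta> where \<delta>: "\<gamma> = f + \<delta>" by blast
      have "conv (q f) (\<lambda>\<beta>. if \<beta> = f then 1 else 0) \<gamma> = (\<Sum>p\<in>splits \<gamma>. if p = (\<delta>, f) then q f \<delta> else 0)"
        unfolding conv_def by (intro sum.cong) (auto simp: splits_def \<delta> add.commute)
      also have "\<dots> = q f \<delta>"
        using finite_splits by (simp add: sum.delta splits_def \<delta> add.commute)
      finally show ?thesis using True by (auto simp: q_def \<delta>)
    next
      case False
      then have "snd p \<noteq> f" if "p \<in> splits \<gamma>" for p
        using that by (auto simp: splits_def add.commute)
      with False show ?thesis by (simp add: conv_def)
    qed
    have main: "(\<Sum>f\<in>F. conv (q f) (\<lambda>\<beta>. if \<beta> = f then 1 else 0) \<gamma>) = b \<gamma> - R \<gamma>"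
    proof (cases "\<exists>f\<in>F. \<exists>\<delta>. \<gamma> = f + \<delta>")
      case True
      then have *: "\<sigma> \<gamma> \<in> F" "\<exists>\<delta>'. \<gamma> = \<sigma> \<gamma> + \<delta>'" using \<sigma> by blast+
      have "(\<Sum>f\<in>F. conv (q f) (\<lambda>\<beta>. if \<beta> = f then 1 else 0) \<gamma>) = (\<Sum>f\<in>F. if f = \<sigma> \<gamma> then b \<gamma> else 0)"
        unfolding lead using * by (intro sum.cong) auto
      also have "\<dots> = b \<gamma>" using * F by simp
      finally show ?thesis using True by (simp add: R_def)
    next
      case False
      then show ?thesis unfolding lead by (simp add: R_def)
    qed
    have rest: "conv (q f) (e f) \<gamma> = (\<Sum>p\<in>splits \<gamma>.
      (if \<sigma> (f + fst p) = f \<and> e f (snd p) \<noteq> 0 then b (f + fst p) else 0) * e f (snd p))" for f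
      unfolding conv_def q_def by (intro sum.cong) auto
    have "(\<Sum>f\<in>F. conv (q f) (\<lambda>\<beta>. (if \<beta> = f then 1 else 0) + e f \<beta>) \<gamma>) =
       (\<Sum>f\<in>F. conv (q f) (\<lambda>\<beta>. if \<beta> = f then 1 else 0) \<gamma> + conv (q f) (e f) \<gamma>)"
      unfolding conv_def by (simp add: distrib_left sum.distrib)
    also have "\<dots> = b \<gamma> - R \<gamma> + (a \<gamma> - b \<gamma>)"
      unfolding sum.distrib main using b_eq[of \<gamma>] by (simp add: rest H_def)
    finally show ?thesis by simp
  qed
  moreover have "\<forall>f\<in>F. \<forall>\<delta>. R (f + \<delta>) = 0" by (auto simp: R_def)
  ultimately show ?thesis using 1 by blast
qed


text \<open>The weights occurring in \<open>e\<close> are integers above \<open>N f\<close>, so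
  every ratio \<open>N f / N \<beta>\<close> is at most \<open>N f / (N f + 1) < 1\<close>. Of the
  \<open>k\<close> powers, \<open>l + 2\<close> absorb the growth and secure summability; the others
  make the sum small.\<close>

lemma tail_small:
  assumes g: "growth e D l" and e: "\<And>\<beta>. e \<beta> \<noteq> 0 \<Longrightarrow> N f < N \<beta>" and \<epsilon>: "0 < \<epsilon>"
  shows "\<exists>k0. \<forall>k\<ge>k0. \<forall>B. finite B \<longrightarrow> (\<Sum>\<beta>\<in>B. \<bar>e \<beta>\<bar> * (N f / N \<beta>) ^ k) \<le> \<epsilon>"
proof -
  have D: "D \<ge> 0" using g growth_nonneg by blast
  define r where "r = real (N f) / (real (N f) + 1)"
  define M where "M = D * real (N f) ^ (l + 2) * zeta2"
  have M: "M \<ge> 0" using D zeta2_nonneg by (simp add: M_def)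
  have r: "0 < r" "r < 1" using N_pos[of f] by (auto simp: r_def)
  obtain j where j: "r ^ j < \<epsilon> / (M + 1)"
    using real_arch_pow_inv[of "\<epsilon> / (M + 1)" r] r M \<epsilon> by auto
  have "(\<Sum>\<beta>\<in>B. \<bar>e \<beta>\<bar> * (N f / N \<beta>) ^ k) \<le> \<epsilon>" if k: "k \<ge> l + 2 + j" and B: "finite B" for k B
  proof -
    have "(\<Sum>\<beta>\<in>B. \<bar>e \<beta>\<bar> * (N f / N \<beta>) ^ k) \<le> (\<Sum>\<beta>\<in>B. D * real (N f) ^ (l + 2) * r ^ j * (1 / real (N \<beta>) ^ 2))"
    proof (rule sum_mono)
      fix \<beta>
      show "\<bar>e \<beta>\<bar> * (N f / N \<beta>) ^ k \<le> D * real (N f) ^ (l + 2) * r ^ j * (1 / real (N \<beta>) ^ 2)"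
      proof (cases "e \<beta> = 0")
        case True
        then show ?thesis using D r by simp
      next
        case False
        then have lt: "N f < N \<beta>" by (rule e)
        have q: "0 \<le> real (N f) / N \<beta>" "real (N f) / N \<beta> \<le> r"
          using lt N_pos[of f] unfolding r_def by (simp, intro divide_left_mono) auto
        have "(N f / N \<beta>) ^ k \<le> (N f / N \<beta>) ^ (l + 2 + j)"
          using k q r by (intro power_decreasing) auto
        also have "\<dots> \<le> (N f / N \<beta>) ^ (l + 2) * r ^ j"
          unfolding power_add[of _ "l + 2" j] using q by (intro mult_left_mono power_mono) auto
        finally have "\<bar>e \<beta>\<bar> * (N f / N \<beta>) ^ k \<le> (D * real (N \<beta>) ^ l) * ((N f / N \<beta>) ^ (l + 2) * r ^ j)"
          using growthD[OF g, of \<beta>] D by (intro mult_mono) auto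
        also have "\<dots> = D * real (N f) ^ (l + 2) * r ^ j * (1 / real (N \<beta>) ^ 2)"
          using N_pos[of \<beta>] by (simp add: field_simps power_add power2_eq_square)
        finally show ?thesis .
      qed
    qed
    also have "\<dots> = D * real (N f) ^ (l + 2) * r ^ j * (\<Sum>\<beta>\<in>B. 1 / real (N \<beta>) ^ 2)"
      by (simp only: sum_distrib_left)
    also have "\<dots> \<le> D * real (N f) ^ (l + 2) * r ^ j * zeta2"
      unfolding zeta2_def using D r B
      by (intro mult_left_mono finite_sum_le_infsum summable_zeta2) auto
    also have "\<dots> = M * r ^ j" by (simp add: M_def)
    also have "\<dots> \<le> (M + 1) * (\<epsilon> / (M + 1))" using j M r by (intro mult_mono) auto
    also have "\<dots> = \<epsilon>" using M by simp
    finally show ?thesis .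
  qed
  then show ?thesis by blast
qed

text \<open>
  By Dickson's lemma finitely many germs \<open>g f\<close> of the ideal carry the minimal initial exponents of
  the ideal. The remainder of \<open>a \<in> S\<close> under division by them lies in the ideal but has no
  initial exponent, so it vanishes.
\<close>

proposition noetherian_bound:
  assumes S: "\<And>b. b \<in> S \<Longrightarrow> growth b B K"
  shows "\<exists>T\<subseteq>S. finite T \<and> (\<exists>C\<ge>0. \<exists>\<kappa>. \<forall>\<eta>. character \<eta> \<kappa> \<longrightarrow>
           (\<forall>a\<in>S. \<bar>evalc \<eta> a\<bar> \<le> C * (\<Sum>b\<in>T. \<bar>evalc \<eta> b\<bar>)))"
proof (cases "S = {}")
  case False
  then have B: "B \<ge> 0" using S growth_nonneg by blast
  define I where "I = germ_ideal S"
  define E where "E = {\<alpha>. \<exists>g\<in>I. g \<alpha> \<noteq> 0 \<and> (\<forall>\<beta>. g \<beta> \<noteq> 0 \<longrightarrow> N \<alpha> \<le> N \<beta>)}"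
  obtain F where F: "F \<subseteq> E" "finite F" "\<And>\<epsilon>. \<epsilon> \<in> E \<Longrightarrow> \<exists>\<phi>\<in>F. \<exists>\<delta>. \<epsilon> = \<phi> + \<delta>"
    using dickson[of E] by blast
  have "\<forall>f\<in>F. \<exists>g. g \<in> I \<and> g f \<noteq> 0 \<and> (\<forall>\<beta>. g \<beta> \<noteq> 0 \<longrightarrow> N f \<le> N \<beta>)"
    using F(1) unfolding E_def by blast
  then obtain g where g: "\<And>f. f \<in> F \<Longrightarrow> g f \<in> I" "\<And>f. f \<in> F \<Longrightarrow> g f f \<noteq> 0"
     "\<And>f \<beta>. f \<in> F \<Longrightarrow> g f \<beta> \<noteq> 0 \<Longrightarrow> N f \<le> N \<beta>"
    by (metis bchoice)
  define e where "e f \<beta> = (if \<beta> = f then 0 else g f \<beta> / g f f)" for f \<beta>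
  have e: "N f < N \<beta>" if "f \<in> F" "e f \<beta> \<noteq> 0" for f \<beta>
  proof -
    have "\<beta> \<noteq> f" "g f \<beta> \<noteq> 0" using that by (auto simp: e_def split: if_splits)
    then show ?thesis using g(3)[OF that(1)] inj_N by (metis injD le_neq_implies_less)
  qed
  have ge: "g f = (\<lambda>\<beta>. g f f * ((if \<beta> = f then 1 else 0) + e f \<beta>))" if "f \<in> F" for f
    using g(2)[OF that] by (auto simp: e_def)
  \<comment> \<open>The sum of these bounds over \<open>F\<close> is at most 1 / 2; the added 1
    covers an empty \<open>F\<close>.\<close>
  define c where "c = 1 / (2 * (real (card F) + 1))"
  have c0: "c > 0" by (simp add: c_def add_pos_nonneg)
  have "\<exists>k0. \<forall>k\<ge>k0. \<forall>B. finite B \<longrightarrow> (\<Sum>\<beta>\<in>B. \<bar>e f \<beta>\<bar> * (N f / N \<beta>) ^ k) \<le> c" if f: "f \<in> F" for f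
  proof -
    obtain D l where gr: "growth (g f) D l"
      using germ_ideal_growth[OF S] g(1)[OF f] unfolding I_def by metis
    have "growth (e f) (D / \<bar>g f f\<bar>) l"
      unfolding growth_def
    proof
      fix \<beta>
      have "\<bar>e f \<beta>\<bar> \<le> \<bar>g f \<beta>\<bar> / \<bar>g f f\<bar>" by (simp add: e_def)
      also have "\<dots> \<le> (D * real (N \<beta>) ^ l) / \<bar>g f f\<bar>"
        using growthD[OF gr] by (intro divide_right_mono) auto
      finally show "\<bar>e f \<beta>\<bar> \<le> D / \<bar>g f f\<bar> * real (N \<beta>) ^ l" by simp
    qed
    then show ?thesis using e[OF f] c0 by (rule tail_small)
  qed
  then obtain k0 where k0: "\<And>f k B. f \<in> F \<Longrightarrow> k \<ge> k0 f \<Longrightarrow> finite B \<Longrightarrow>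
      (\<Sum>\<beta>\<in>B. \<bar>e f \<beta>\<bar> * (N f / N \<beta>) ^ k) \<le> c"
    by metis
  \<comment> \<open>Here, as in \<open>\<kappa>\<close> below, a sum serves as an upper bound for
    finitely many thresholds.\<close>
  define k where "k = K + (\<Sum>f\<in>F. k0 f)"
  have k0k: "k0 f \<le> k" if "f \<in> F" for f
    using member_le_sum[of f F k0] F(2) that by (simp add: k_def)
  have csum: "(\<Sum>f\<in>F. c) \<le> 1 / 2" by (simp add: c_def field_simps)
  \<comment> \<open>The bound on the quotients depends on \<open>a\<close> only through
    \<open>B\<close> and \<open>k\<close>, which all members of \<open>S\<close> share. This is why
    one constant serves the whole, possibly infinite, set \<open>S\<close>.\<close>
  have rep: "\<exists>q. (\<forall>f\<in>F. growth (q f) (2 * B * real (N f) ^ k / \<bar>g f f\<bar>) k) \<and>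
       a = (\<lambda>\<gamma>. \<Sum>f\<in>F. conv (q f) (g f) \<gamma>)" if a: "a \<in> S" for a
  proof -
    have ga: "growth a B k" using S[OF a] by (rule growth_mono) (auto simp: k_def)
    obtain q R where q: "\<And>f. f \<in> F \<Longrightarrow> growth (q f) (2 * B * real (N f) ^ k) k"
        and R: "\<And>f \<delta>. f \<in> F \<Longrightarrow> R (f + \<delta>) = 0"
        and dec: "\<And>\<gamma>. a \<gamma> = (\<Sum>f\<in>F. conv (q f) (\<lambda>\<beta>. (if \<beta> = f then 1 else 0) + e f \<beta>) \<gamma>) + R \<gamma>"
      using division[OF F(2) e k0[OF _ k0k] csum ga] by blast
    define q' where "q' f \<alpha> = q f \<alpha> / g f f" for f \<alpha>
    have q': "growth (q' f) (2 * B * real (N f) ^ k / \<bar>g f f\<bar>) k" if "f \<in> F" for f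
      using q[OF that] divide_right_mono[of "\<bar>q f _\<bar>" _ "\<bar>g f f\<bar>"]
      by (auto simp: growth_def q'_def)
    have conv_eq: "conv (q f) (\<lambda>\<beta>. (if \<beta> = f then 1 else 0) + e f \<beta>) \<gamma> = conv (q' f) (g f) \<gamma>" if "f \<in> F" for f \<gamma>
      unfolding conv_def
    proof (rule sum.cong[OF refl])
      fix p
      show "q f (fst p) * ((if snd p = f then 1 else 0) + e f (snd p)) = q' f (fst p) * g f (snd p)"
        using g(2)[OF that] by (simp add: fun_cong[OF ge[OF that], of "snd p"] q'_def)
    qed
    have R_eq: "R = (\<lambda>\<gamma>. a \<gamma> + (\<Sum>f\<in>F. conv (\<lambda>\<alpha>. - q' f \<alpha>) (g f) \<gamma>))"
    proof
      fix \<gamma>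
      have "(\<Sum>f\<in>F. conv (\<lambda>\<alpha>. - q' f \<alpha>) (g f) \<gamma>) = - (\<Sum>f\<in>F. conv (q' f) (g f) \<gamma>)"
        by (simp add: conv_def sum_negf)
      then show "R \<gamma> = a \<gamma> + (\<Sum>f\<in>F. conv (\<lambda>\<alpha>. - q' f \<alpha>) (g f) \<gamma>)"
        using dec[of \<gamma>] conv_eq by simp
    qed
    have "R \<in> germ_ideal S"
      unfolding R_eq
    proof (rule germ_ideal_sum[OF F(2)])
      show "a \<in> germ_ideal S" using a by (rule germ_ideal.base)
      show "g f \<in> germ_ideal S" if "f \<in> F" for f using g(1)[OF that] by (simp add: I_def)
      show "\<exists>C k. growth (\<lambda>\<alpha>. - q' f \<alpha>) C k" if "f \<in> F" for f
        using q'[OF that] unfolding growth_def by (metis abs_minus)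
    qed
    have "R \<gamma> = 0" for \<gamma>
    proof (rule ccontr)
      assume "R \<gamma> \<noteq> 0"
      then obtain \<alpha> where \<alpha>: "R \<alpha> \<noteq> 0" "\<And>\<beta>. R \<beta> \<noteq> 0 \<Longrightarrow> N \<alpha> \<le> N \<beta>"
        using ex_has_least_nat[of "\<lambda>\<beta>. R \<beta> \<noteq> 0" \<gamma> N] by blast
      then have "\<alpha> \<in> E" using \<open>R \<in> germ_ideal S\<close> unfolding E_def I_def by blast
      then show False using F(3) R \<alpha>(1) by blast
    qed
    then have "a = (\<lambda>\<gamma>. \<Sum>f\<in>F. conv (q' f) (g f) \<gamma>)"
      using dec conv_eq by auto
    then show ?thesis using q' by blast
  qed
  have "\<forall>f\<in>F. \<exists>T C \<kappa>0. T \<subseteq> S \<and> finite T \<and> C \<ge> 0 \<and> (\<forall>\<kappa>\<ge>\<kappa>0. \<forall>\<eta>. character \<eta> \<kappa> \<longrightarrow>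
           \<bar>evalc \<eta> (g f)\<bar> \<le> C * (\<Sum>b\<in>T. \<bar>evalc \<eta> b\<bar>))"
    using germ_ideal_eval[OF S] g(1) unfolding I_def by metis
  then obtain T C \<kappa>0 where T: "\<And>f. f \<in> F \<Longrightarrow> T f \<subseteq> S" "\<And>f. f \<in> F \<Longrightarrow> finite (T f)" "\<And>f. f \<in> F \<Longrightarrow> C f \<ge> 0"
    "\<And>f \<kappa> \<eta>. f \<in> F \<Longrightarrow> \<kappa> \<ge> \<kappa>0 f \<Longrightarrow> character \<eta> \<kappa> \<Longrightarrow> \<bar>evalc \<eta> (g f)\<bar> \<le> C f * (\<Sum>b\<in>T f. \<bar>evalc \<eta> b\<bar>)"
    by metis
  have "\<forall>f\<in>F. \<exists>D l. growth (g f) D l"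
    using germ_ideal_growth[OF S] g(1) unfolding I_def by metis
  then obtain D l where gr: "\<And>f. f \<in> F \<Longrightarrow> growth (g f) (D f) (l f)" by metis
  define \<kappa> where "\<kappa> = k + 3 + (\<Sum>f\<in>F. \<kappa>0 f) + (\<Sum>f\<in>F. l f)"
  have \<kappa>: "\<kappa>0 f \<le> \<kappa>" "l f + 2 \<le> \<kappa>" "k + l f + 1 + 2 \<le> \<kappa>" if "f \<in> F" for f
    using member_le_sum[of f F \<kappa>0] member_le_sum[of f F l] F(2) that by (simp_all add: \<kappa>_def)
  define TT where "TT = (\<Union>f\<in>F. T f)"
  define A where "A f = 2 * B * real (N f) ^ k / \<bar>g f f\<bar> * zeta2" for f
  have A: "A f \<ge> 0" for f using B zeta2_nonneg by (simp add: A_def)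
  have "\<bar>evalc \<eta> a\<bar> \<le> (\<Sum>f\<in>F. A f * C f) * (\<Sum>b\<in>TT. \<bar>evalc \<eta> b\<bar>)"
    if \<eta>: "character \<eta> \<kappa>" and a: "a \<in> S" for \<eta> a
  proof -
    obtain q where q: "\<And>f. f \<in> F \<Longrightarrow> growth (q f) (2 * B * real (N f) ^ k / \<bar>g f f\<bar>) k"
      and aq: "a = (\<lambda>\<gamma>. \<Sum>f\<in>F. conv (q f) (g f) \<gamma>)"
      using rep[OF a] by blast
    have "evalc \<eta> a = (\<Sum>f\<in>F. evalc \<eta> (conv (q f) (g f)))"
        unfolding aq by (rule eval_sum[OF F(2)]) (rule eval_summable[OF growth_conv[OF q gr] \<eta> \<kappa>(3)])
    also have "\<dots> = (\<Sum>f\<in>F. evalc \<eta> (q f) * evalc \<eta> (g f))"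
      using \<kappa> by (intro sum.cong refl eval_conv[OF q gr \<eta>]) (auto simp: \<kappa>_def)
    finally have "\<bar>evalc \<eta> a\<bar> \<le> (\<Sum>f\<in>F. \<bar>evalc \<eta> (q f)\<bar> * \<bar>evalc \<eta> (g f)\<bar>)"
      using sum_abs[of "\<lambda>f. evalc \<eta> (q f) * evalc \<eta> (g f)" F] by (simp add: abs_mult)
    also have "\<dots> \<le> (\<Sum>f\<in>F. A f * (C f * (\<Sum>b\<in>TT. \<bar>evalc \<eta> b\<bar>)))"
    proof (intro sum_mono mult_mono)
      fix f assume f: "f \<in> F"
      show "\<bar>evalc \<eta> (q f)\<bar> \<le> A f"
        unfolding A_def by (rule eval_bound[OF q[OF f] \<eta>]) (simp add: \<kappa>_def)
      have "\<bar>evalc \<eta> (g f)\<bar> \<le> C f * (\<Sum>b\<in>T f. \<bar>evalc \<eta> b\<bar>)"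
        using T(4)[OF f \<kappa>(1)[OF f] \<eta>] .
      also have "\<dots> \<le> C f * (\<Sum>b\<in>TT. \<bar>evalc \<eta> b\<bar>)"
        using T(2,3) f F(2) by (intro mult_left_mono sum_mono2) (auto simp: TT_def)
      finally show "\<bar>evalc \<eta> (g f)\<bar> \<le> C f * (\<Sum>b\<in>TT. \<bar>evalc \<eta> b\<bar>)" .
    qed (use A in auto)
    finally show ?thesis by (simp only: sum_distrib_right mult.assoc)
  qed
  moreover have "TT \<subseteq> S" "finite TT" using T F(2) by (auto simp: TT_def)
  moreover have "(\<Sum>f\<in>F. A f * C f) \<ge> 0" using A T(3) by (intro sum_nonneg) auto
  ultimately show ?thesis by blast
qed auto

end

text \<open>Induction on the set of coordinates that are compared. When \<open>v\<close> is added, a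
  finite set \<open>F\<close> for the old coordinates still serves every element whose entry at
  \<open>v\<close> is at least \<open>J\<close>, a bound for the entries of \<open>F\<close> at
  \<open>v\<close>; each of the finitely many slices \<open>\<epsilon> v = j\<close> with
  \<open>j < J\<close> gets a finite set of its own.\<close>

lemma dickson_functions:
  fixes E :: "('v::finite \<Rightarrow> nat) set"
  shows "\<exists>F\<subseteq>E. finite F \<and> (\<forall>\<epsilon>\<in>E. \<exists>\<phi>\<in>F. \<exists>\<delta>. \<epsilon> = \<phi> + \<delta>)"
proof -
  have "\<exists>F\<subseteq>E. finite F \<and> (\<forall>\<epsilon>\<in>E. \<exists>\<phi>\<in>F. \<forall>v\<in>V. \<phi> v \<le> \<epsilon> v)" if "finite V" for V :: "'v set" and E :: "('v \<Rightarrow> nat) set"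
    using that
  proof (induction V arbitrary: E)
    case empty
    show ?case
    proof (cases "E = {}")
      case False
      then obtain \<epsilon> where "\<epsilon> \<in> E" by blast
      then show ?thesis by (intro exI[of _ "{\<epsilon>}"]) auto
    qed auto
  next
    case (insert v V)
    obtain F where F: "F \<subseteq> E" "finite F" "\<And>\<epsilon>. \<epsilon> \<in> E \<Longrightarrow> \<exists>\<phi>\<in>F. \<forall>v\<in>V. \<phi> v \<le> \<epsilon> v"
      using insert.IH[of E] by blast
    define J where "J = (\<Sum>\<phi>\<in>F. \<phi> v)"
    have J: "\<phi> v \<le> J" if "\<phi> \<in> F" for \<phi>
      using member_le_sum[of \<phi> F "\<lambda>\<phi>. \<phi> v"] F(2) that by (simp add: J_def)
    have "\<forall>j. \<exists>G. G \<subseteq> {\<epsilon>\<in>E. \<epsilon> v = j} \<and> finite G \<and> (\<forall>\<epsilon>\<in>{\<epsilon>\<in>E. \<epsilon> v = j}. \<exists>\<phi>\<in>G. \<forall>v\<in>V. \<phi> v \<le> \<epsilon> v)"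
      using insert.IH by meson
    then obtain G where G0: "\<forall>j. G j \<subseteq> {\<epsilon>\<in>E. \<epsilon> v = j} \<and> finite (G j) \<and>
        (\<forall>\<epsilon>\<in>{\<epsilon>\<in>E. \<epsilon> v = j}. \<exists>\<phi>\<in>G j. \<forall>v\<in>V. \<phi> v \<le> \<epsilon> v)"
      by (rule choice[THEN exE])
    have G: "G j \<subseteq> {\<epsilon>\<in>E. \<epsilon> v = j}" "finite (G j)" for j
      using G0 by (rule allE[of _ j], blast)+
    have G3: "\<exists>\<phi>\<in>G j. \<forall>v\<in>V. \<phi> v \<le> \<epsilon> v" if "\<epsilon> \<in> E" "\<epsilon> v = j" for j \<epsilon>
      using G0 that by (elim allE[of _ j]) blast
    let ?F = "F \<union> (\<Union>j<J. G j)"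
    have "\<exists>\<phi>\<in>?F. \<forall>v\<in>insert v V. \<phi> v \<le> \<epsilon> v" if \<epsilon>: "\<epsilon> \<in> E" for \<epsilon>
    proof (cases "\<epsilon> v < J")
      case True
      then obtain \<phi> where "\<phi> \<in> G (\<epsilon> v)" "\<forall>v\<in>V. \<phi> v \<le> \<epsilon> v" using G3[OF \<epsilon> refl] by blast
      then show ?thesis using G(1)[of "\<epsilon> v"] True by (intro bexI[of _ \<phi>]) auto
    next
      case False
      obtain \<phi> where "\<phi> \<in> F" "\<forall>v\<in>V. \<phi> v \<le> \<epsilon> v" using F(3)[OF \<epsilon>] by blast
      then show ?thesis using J[of \<phi>] False by (intro bexI[of _ \<phi>]) auto
    qed
    moreover have "?F \<subseteq> E" "finite ?F" using F(1,2) G by blast+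
    ultimately show ?case by meson
  qed
  from this[of UNIV E] obtain F where F: "F \<subseteq> E" "finite F" "\<And>\<epsilon>. \<epsilon> \<in> E \<Longrightarrow> \<exists>\<phi>\<in>F. \<forall>v. \<phi> v \<le> \<epsilon> v"
    by auto
  have "\<exists>\<phi>\<in>F. \<exists>\<delta>. \<epsilon> = \<phi> + \<delta>" if e: "\<epsilon> \<in> E" for \<epsilon>
  proof -
    obtain \<phi> where "\<phi> \<in> F" "\<forall>v. \<phi> v \<le> \<epsilon> v" using F(3)[OF e] by blast
    then show ?thesis by (intro bexI[of _ \<phi>] exI[of _ "\<lambda>v. \<epsilon> v - \<phi> v"]) (auto simp: plus_fun_def)
  qed
  then show ?thesis using F by meson
qed

lemma ex_prime_assignment: "\<exists>p :: 'v::finite \<Rightarrow> nat. inj p \<and> (\<forall>v. prime (p v))"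
proof -
  obtain B where B: "finite B" "card B = CARD('v)" "B \<subseteq> {p::nat. prime p}"
    using infinite_arbitrarily_large[OF primes_infinite] by blast
  then obtain p :: "'v \<Rightarrow> nat" where "p ` UNIV \<subseteq> B" "inj p"
    using card_le_inj[of "UNIV :: 'v set" B] by auto
  then show ?thesis using B(3) by blast
qed

definition prime_monomial :: "('v::finite \<Rightarrow> nat) \<Rightarrow> ('v \<Rightarrow> nat) \<Rightarrow> nat" where
  "prime_monomial p \<alpha> = (\<Prod>v\<in>UNIV. p v ^ \<alpha> v)"

text \<open>Injectivity is unique factorization: the exponent at \<open>v\<close> is the
  multiplicity of the prime \<open>p v\<close>.\<close>

lemma monomials_prime_monomial:
  assumes p: "inj p" "\<And>v. prime (p v)"
  shows "monomials (prime_monomial p)"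
proof
  have mult: "multiplicity (p v) (prime_monomial p \<alpha>) = \<alpha> v" for v \<alpha>
  proof -
    have pos: "p w > 0" for w by (rule prime_gt_0_nat[OF p(2)])
    have "multiplicity (p v) (prime_monomial p \<alpha>) = (\<Sum>w\<in>UNIV. multiplicity (p v) (p w ^ \<alpha> w))"
      unfolding prime_monomial_def
      using p(2) pos by (intro prime_elem_multiplicity_prod_distrib) (auto simp: less_not_refl2)
    also have "\<dots> = (\<Sum>w\<in>UNIV. if w = v then \<alpha> v else 0)"
      using p by (intro sum.cong) (auto simp: multiplicity_distinct_prime_power inj_eq multiplicity_prime_power)
    finally show ?thesis by simp
  qed
  show "inj (prime_monomial p)"
    by (rule injI) (metis mult ext)
  show "prime_monomial p (\<alpha> + \<beta>) = prime_monomial p \<alpha> * prime_monomial p \<beta>" for \<alpha> \<beta>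
    by (simp add: prime_monomial_def plus_fun_def power_add prod.distrib)
  show "0 < prime_monomial p \<alpha>" for \<alpha>
    unfolding prime_monomial_def by (intro prod_pos ballI zero_less_power prime_gt_0_nat p(2))
qed (rule dickson_functions)

section \<open>Expansion of a real analytic function at nearby points\<close>

lemma (in monomials) character_mono:
  assumes "character \<eta> \<kappa>" "l \<le> \<kappa>"
  shows "character \<eta> l"
proof -
  have "\<bar>\<eta> \<alpha>\<bar> * real (N \<alpha>) ^ l \<le> 1" for \<alpha>
  proof -
    have "\<bar>\<eta> \<alpha>\<bar> * real (N \<alpha>) ^ l \<le> \<bar>\<eta> \<alpha>\<bar> * real (N \<alpha>) ^ \<kappa>"
      using assms N_ge1 by (intro mult_left_mono power_increasing) auto
    also have "\<dots> \<le> 1" using assms(1) by (simp add: character_def)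
    finally show ?thesis .
  qed
  then show ?thesis using assms(1) by (simp add: character_def)
qed

definition point_char :: "('v::finite \<Rightarrow> real) \<Rightarrow> ('v \<Rightarrow> nat) \<Rightarrow> real" where
  "point_char z \<alpha> = (\<Prod>v\<in>UNIV. z v ^ \<alpha> v)"

lemma character_point_char:
  assumes p: "inj p" "\<And>v. prime (p v)" and z: "\<And>v. \<bar>z v\<bar> * real (p v) ^ \<kappa> \<le> 1"
  shows "monomials.character (prime_monomial p) (point_char z) \<kappa>"
proof -
  interpret monomials "prime_monomial p" using p by (rule monomials_prime_monomial)
  have "\<bar>point_char z \<alpha>\<bar> * real (prime_monomial p \<alpha>) ^ \<kappa> \<le> 1" for \<alpha>
  proof -
    have "\<bar>point_char z \<alpha>\<bar> * real (prime_monomial p \<alpha>) ^ \<kappa> = (\<Prod>v\<in>UNIV. (\<bar>z v\<bar> * real (p v) ^ \<kappa>) ^ \<alpha> v)"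
    proof -
      have "real (prime_monomial p \<alpha>) ^ \<kappa> = (\<Prod>v\<in>UNIV. (real (p v) ^ \<kappa>) ^ \<alpha> v)"
        by (simp add: prime_monomial_def prod_power_distrib power_mult[symmetric] mult.commute)
      then show ?thesis
        by (simp add: point_char_def abs_prod power_abs prod.distrib power_mult_distrib)
    qed
    also have "\<dots> \<le> 1"
      using z by (intro prod_le_1) (auto intro!: power_le_one)
    finally show ?thesis .
  qed
  then show ?thesis
    by (simp add: character_def point_char_def plus_fun_def power_add prod.distrib)
qed

text \<open>Two groups of variables: \<open>Inl\<close> carries the displacement u of the base point
  from the centre, \<open>Inr\<close> the direction w. A monomial in (u, w) arises from the monomial
  of u + w whose exponent is its \<open>total\<close>.\<close>

definition total :: "('n::finite + 'n \<Rightarrow> nat) \<Rightarrow> 'n \<Rightarrow> nat" where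
  "total \<alpha> i = \<alpha> (Inl i) + \<alpha> (Inr i)"

definition right_degree :: "('n::finite + 'n \<Rightarrow> nat) \<Rightarrow> nat" where
  "right_degree \<alpha> = (\<Sum>i\<in>UNIV. \<alpha> (Inr i))"

text \<open>If \<open>c\<close> holds the Taylor coefficients of f at a, these are the coefficients
  of f (a + u + w) as a series in (u, w), by the binomial theorem.\<close>

definition shift_coeff :: "(('n::finite \<Rightarrow> nat) \<Rightarrow> real) \<Rightarrow> ('n + 'n \<Rightarrow> nat) \<Rightarrow> real" where
  "shift_coeff c \<alpha> = c (total \<alpha>) * (\<Prod>i\<in>UNIV. real (total \<alpha> i choose \<alpha> (Inr i)))"

text \<open>The part of degree \<open>k\<close> in w: the Taylor coefficient of order
  \<open>k\<close> along the line from a + u in direction w, viewed as a germ in (u, w). The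
  Noetherian bound will be applied to these germs.\<close>

definition shift_coeff_deg :: "(('n::finite \<Rightarrow> nat) \<Rightarrow> real) \<Rightarrow> nat \<Rightarrow> ('n + 'n \<Rightarrow> nat) \<Rightarrow> real" where
  "shift_coeff_deg c k \<alpha> = (if right_degree \<alpha> = k then shift_coeff c \<alpha> else 0)"

definition pair_point :: "real^'n \<Rightarrow> real^'n \<Rightarrow> 'n + 'n \<Rightarrow> real" where
  "pair_point u w v = (case v of Inl i \<Rightarrow> u $ i | Inr i \<Rightarrow> w $ i)"

lemma prod_sum_type:
  fixes g :: "'n::finite + 'n \<Rightarrow> 'b::comm_monoid_mult"
  shows "(\<Prod>v\<in>UNIV. g v) = (\<Prod>i\<in>UNIV. g (Inl i)) * (\<Prod>i\<in>UNIV. g (Inr i))"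
  by (subst UNIV_Plus_UNIV[symmetric], subst prod.Plus) auto

lemma point_char_pair:
  "point_char (pair_point u w) \<alpha> = (\<Prod>i\<in>UNIV. u $ i ^ \<alpha> (Inl i)) * (\<Prod>i\<in>UNIV. w $ i ^ \<alpha> (Inr i))"
  by (simp add: point_char_def prod_sum_type pair_point_def)

lemma point_char_scale:
  "point_char (pair_point u (s *\<^sub>R w)) \<alpha> = s ^ right_degree \<alpha> * point_char (pair_point u w) \<alpha>"
  by (simp add: point_char_pair power_mult_distrib prod.distrib right_degree_def power_sum)

text \<open>An exponent with given total is determined by its direction half, which may be any
  \<open>g \<le> \<tau>\<close>. The product form of this set lets the binomial theorem act
  coordinate by coordinate.\<close>

lemma total_fibre:
  fixes \<tau> :: "'n::finite \<Rightarrow> nat"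
  shows "bij_betw (\<lambda>g. case_sum (\<lambda>i. \<tau> i - g i) g) (PiE UNIV (\<lambda>i. {..\<tau> i})) {\<alpha>. total \<alpha> = \<tau>}"
proof (rule bij_betwI[where g = "\<lambda>\<alpha> i. \<alpha> (Inr i)"])
  fix \<alpha> assume "\<alpha> \<in> {\<alpha>. total \<alpha> = \<tau>}"
  then have \<tau>: "\<tau> i = \<alpha> (Inl i) + \<alpha> (Inr i)" for i by (auto simp: total_def fun_eq_iff)
  show "case_sum (\<lambda>i. \<tau> i - \<alpha> (Inr i)) (\<lambda>i. \<alpha> (Inr i)) = \<alpha>"
    by (rule ext) (simp add: \<tau> split: sum.split)
next
  show "(\<lambda>g. case_sum (\<lambda>i. \<tau> i - g i) g) \<in> PiE UNIV (\<lambda>i. {..\<tau> i}) \<rightarrow> {\<alpha>. total \<alpha> = \<tau>}"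
  proof
    fix g assume g: "g \<in> PiE UNIV (\<lambda>i. {..\<tau> i})"
    have "g i \<le> \<tau> i" for i using PiE_mem[OF g, of i] by simp
    then show "case_sum (\<lambda>i. \<tau> i - g i) g \<in> {\<alpha>. total \<alpha> = \<tau>}"
      by (simp add: total_def fun_eq_iff)
  qed
  show "(\<lambda>\<alpha> i. \<alpha> (Inr i)) \<in> {\<alpha>. total \<alpha> = \<tau>} \<rightarrow> PiE UNIV (\<lambda>i. {..\<tau> i})"
    by (auto simp: total_def)
qed simp

lemma shift_coeff_fibre_sum:
  "(\<Sum>\<alpha>\<in>{\<alpha>. total \<alpha> = \<tau>}. shift_coeff c \<alpha> * point_char (pair_point u w) \<alpha>) =
     c \<tau> * (\<Prod>i\<in>UNIV. (u $ i + w $ i) ^ \<tau> i)"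
proof -
  have "(\<Sum>\<alpha>\<in>{\<alpha>. total \<alpha> = \<tau>}. shift_coeff c \<alpha> * point_char (pair_point u w) \<alpha>) =
    (\<Sum>g\<in>PiE UNIV (\<lambda>i. {..\<tau> i}). shift_coeff c (case_sum (\<lambda>i. \<tau> i - g i) g) * point_char (pair_point u w) (case_sum (\<lambda>i. \<tau> i - g i) g))"
    by (rule sum.reindex_bij_betw[OF total_fibre, symmetric])
  also have "\<dots> = (\<Sum>g\<in>PiE UNIV (\<lambda>i. {..\<tau> i}). c \<tau> * (\<Prod>i\<in>UNIV. real (\<tau> i choose g i) * (w $ i) ^ g i * (u $ i) ^ (\<tau> i - g i)))"
  proof (rule sum.cong[OF refl])
    fix g assume g: "g \<in> PiE UNIV (\<lambda>i. {..\<tau> i})"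
    have "total (case_sum (\<lambda>i. \<tau> i - g i) g) = \<tau>"
      using bij_betwE[OF total_fibre] g by blast
    then show "shift_coeff c (case_sum (\<lambda>i. \<tau> i - g i) g) * point_char (pair_point u w) (case_sum (\<lambda>i. \<tau> i - g i) g)
      = c \<tau> * (\<Prod>i\<in>UNIV. real (\<tau> i choose g i) * (w $ i) ^ g i * (u $ i) ^ (\<tau> i - g i))"
      by (simp add: shift_coeff_def point_char_pair prod.distrib mult_ac)
  qed
  also have "\<dots> = c \<tau> * (\<Prod>i\<in>UNIV. \<Sum>j\<le>\<tau> i. real (\<tau> i choose j) * (w $ i) ^ j * (u $ i) ^ (\<tau> i - j))"
    by (subst prod_sum_PiE) (auto simp: sum_distrib_left)
  also have "\<dots> = c \<tau> * (\<Prod>i\<in>UNIV. (u $ i + w $ i) ^ \<tau> i)"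
    by (simp add: binomial_ring[symmetric] add.commute)
  finally show ?thesis .
qed

lemma finite_total_fibre: "finite {\<alpha>. total \<alpha> = \<tau>}"
  using bij_betw_finite[OF total_fibre[of \<tau>]] by (simp add: finite_PiE)

text \<open>The hypothesis on \<open>c\<close> is a Cauchy estimate. The binomial coefficients cost
  at most 2^m, with m the total degree, and as all primes are at least 2, 2^m is at most the weight;
  \<open>K\<close> turns (2 / \<delta>)^m into a power of the weight.\<close>

lemma growth_shift_coeff:
  fixes p :: "'n::finite + 'n \<Rightarrow> nat"
  assumes p: "inj p" "\<And>v. prime (p v)" and \<delta>: "0 < \<delta>" and K: "2 / \<delta> \<le> 2 ^ K" and B: "0 \<le> B"
    and c: "\<And>\<tau>. \<bar>c \<tau>\<bar> * \<delta> ^ (\<Sum>i\<in>UNIV. \<tau> i) \<le> B"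
  shows "monomials.growth (prime_monomial p) (shift_coeff c) B K"
proof -
  interpret monomials "prime_monomial p" using p by (rule monomials_prime_monomial)
  show ?thesis
    unfolding growth_def
  proof
    fix \<alpha> :: "'n + 'n \<Rightarrow> nat"
    define m where "m = (\<Sum>i\<in>UNIV. total \<alpha> i)"
    have msum: "m = (\<Sum>v\<in>UNIV. \<alpha> v)"
      by (subst UNIV_Plus_UNIV[symmetric], subst sum.Plus) (auto simp: m_def total_def sum.distrib)
    have "(\<Prod>i\<in>UNIV. real (total \<alpha> i choose \<alpha> (Inr i))) \<le> (\<Prod>i\<in>UNIV. 2 ^ total \<alpha> i)"
    proof (rule prod_mono)
      fix i
      have "(total \<alpha> i choose \<alpha> (Inr i)) \<le> 2 ^ total \<alpha> i" by (rule binomial_le_pow2)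
      then have "real (total \<alpha> i choose \<alpha> (Inr i)) \<le> real (2 ^ total \<alpha> i)" by (simp only: of_nat_le_iff)
      then show "0 \<le> real (total \<alpha> i choose \<alpha> (Inr i)) \<and> real (total \<alpha> i choose \<alpha> (Inr i)) \<le> 2 ^ total \<alpha> i" by simp
    qed
    also have "\<dots> = 2 ^ m" by (simp add: m_def power_sum)
    finally have bin: "(\<Prod>i\<in>UNIV. real (total \<alpha> i choose \<alpha> (Inr i))) \<le> 2 ^ m" .
    have ge: "(2::real) ^ m \<le> real (prime_monomial p \<alpha>)"
    proof -
      have "(2::nat) ^ m = (\<Prod>v\<in>UNIV. 2 ^ \<alpha> v)" by (simp add: msum power_sum)
      also have "\<dots> \<le> prime_monomial p \<alpha>"
        unfolding prime_monomial_def using prime_ge_2_nat[OF p(2)] by (intro prod_mono) (auto intro!: power_mono)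
      finally show ?thesis by (metis of_nat_le_iff of_nat_numeral of_nat_power)
    qed
    have "\<bar>c (total \<alpha>)\<bar> \<le> B / \<delta> ^ m"
      using c[of "total \<alpha>"] \<delta> by (simp add: m_def pos_le_divide_eq)
    then have "\<bar>shift_coeff c \<alpha>\<bar> \<le> B / \<delta> ^ m * 2 ^ m"
      unfolding shift_coeff_def abs_mult using bin B \<delta> by (intro mult_mono) (auto simp: abs_prod intro!: prod_nonneg)
    also have "\<dots> = B * (2 / \<delta>) ^ m" by (simp add: power_divide)
    also have "\<dots> \<le> B * (2 ^ K) ^ m" using K \<delta> B by (intro mult_left_mono power_mono) auto
    also have "\<dots> = B * (2 ^ m) ^ K" by (simp flip: power_mult add: mult.commute)
    also have "\<dots> \<le> B * real (prime_monomial p \<alpha>) ^ K" using ge B by (intro mult_left_mono power_mono) auto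
    finally show "\<bar>shift_coeff c \<alpha>\<bar> \<le> B * real (prime_monomial p \<alpha>) ^ K" .
  qed
qed

text \<open>The last clause is the uniform domination that Noetherianity provides. It starts at
  order 2 because the constant and linear terms drop out of the increment of the derivative.\<close>

definition expands_along :: "(real^'n \<Rightarrow> real) \<Rightarrow> (nat \<Rightarrow> real) \<Rightarrow> real \<Rightarrow> nat \<Rightarrow> real^'n \<Rightarrow> real^'n \<Rightarrow> bool" where
  "expands_along f b C N x w \<longleftrightarrow> (\<forall>s. \<bar>s\<bar> \<le> 1 \<longrightarrow> (\<lambda>k. b k * s ^ k) sums f (x + s *\<^sub>R w)) \<and>
     (\<forall>k. \<bar>b k\<bar> \<le> C) \<and> (\<forall>k\<ge>2. \<bar>b k\<bar> \<le> C * (\<Sum>l=2..N. \<bar>b l\<bar>))"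

text \<open>The Taylor coefficients along \<open>x + s *\<^sub>R w\<close> are the values at (x - a,
  w) of the germs \<open>shift_coeff_deg c k\<close>. All of these share one growth bound, so
  \<open>noetherian_bound\<close> applies to those with \<open>k \<ge> 2\<close>, and the points (x
  - a, w) near the origin are characters of high order.\<close>

proposition local_expansion:
  fixes f :: "real^'n \<Rightarrow> real"
  assumes "f real_analytic_on U" "a \<in> U"
  shows "\<exists>r>0. \<exists>C\<ge>0. \<exists>N b. \<forall>x\<in>ball a r. \<forall>w. norm w \<le> r \<longrightarrow> expands_along f (b x w) C N x w"
proof -
  obtain R c where R: "R > 0" and c: "\<And>x. x \<in> ball a R \<Longrightarrow> ((\<lambda>\<tau>. c \<tau> * (\<Prod>i\<in>UNIV. (x $ i - a $ i) ^ \<tau> i)) has_sum f x) UNIV"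
    using assms unfolding real_analytic_on_def by blast
  \<comment> \<open>The point whose coordinates all exceed those of \<open>a\<close> by
    \<open>\<delta>\<close> still lies in the ball; absolute convergence there yields the Cauchy
    estimate \<open>cB\<close>.\<close>
  define \<delta> where "\<delta> = R / (2 * CARD('n))"
  have \<delta>: "\<delta> > 0" using R by (simp add: \<delta>_def)
  define y :: "real^'n" where "y = (\<chi> i. \<delta>)"
  have "norm y \<le> (\<Sum>i\<in>UNIV. \<bar>y $ i\<bar>)" by (rule norm_le_l1_cart)
  also have "\<dots> = R / 2" using R by (simp add: y_def \<delta>_def)
  also have "\<dots> < R" using R by simp
  finally have "a + y \<in> ball a R" by (simp add: dist_norm)
  from c[OF this] have "(\<lambda>\<tau>. c \<tau> * \<delta> ^ (\<Sum>i\<in>UNIV. \<tau> i)) summable_on UNIV"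
    by (simp add: y_def power_sum has_sum_imp_summable)
  then have sm: "(\<lambda>\<tau>. \<bar>c \<tau> * \<delta> ^ (\<Sum>i\<in>UNIV. \<tau> i)\<bar>) summable_on UNIV"
    using summable_on_iff_abs_summable_on_real by fastforce
  define B where "B = (\<Sum>\<^sub>\<infinity>\<tau>. \<bar>c \<tau> * \<delta> ^ (\<Sum>i\<in>UNIV. \<tau> i)\<bar>)"
  have B: "0 \<le> B" unfolding B_def by (intro infsum_nonneg) auto
  have cB: "\<bar>c \<tau>\<bar> * \<delta> ^ (\<Sum>i\<in>UNIV. \<tau> i) \<le> B" for \<tau>
    using finite_sum_le_infsum[OF sm, of "{\<tau>}"] \<delta> by (simp add: B_def abs_mult)
  obtain K where K: "2 / \<delta> \<le> 2 ^ K"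
    using real_arch_pow[of 2 "2 / \<delta>"] by (auto intro: less_imp_le)
  obtain p :: "'n + 'n \<Rightarrow> nat" where p: "inj p" "\<And>v. prime (p v)"
    using ex_prime_assignment by blast
  interpret M: monomials "prime_monomial p" using p by (rule monomials_prime_monomial)
  let ?A = "shift_coeff c"
  let ?Ak = "shift_coeff_deg c"
  have gA: "M.growth ?A B K" using p \<delta> K B cB by (rule growth_shift_coeff)
  have gAk: "M.growth (?Ak k) B K" for k
    unfolding M.growth_def
  proof
    fix \<alpha>
    have "0 \<le> B * real (prime_monomial p \<alpha>) ^ K" using B by simp
    then show "\<bar>?Ak k \<alpha>\<bar> \<le> B * real (prime_monomial p \<alpha>) ^ K"
      using M.growthD[OF gA, of \<alpha>] by (auto simp: shift_coeff_deg_def)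
  qed
  have gS: "M.growth b B K" if "b \<in> ?Ak ` {2..}" for b using that gAk by auto
  have "\<exists>T\<subseteq>?Ak ` {2..}. finite T \<and> (\<exists>C\<ge>0. \<exists>\<kappa>. \<forall>\<eta>. M.character \<eta> \<kappa> \<longrightarrow>
      (\<forall>a\<in>?Ak ` {2..}. \<bar>M.evalc \<eta> a\<bar> \<le> C * (\<Sum>b\<in>T. \<bar>M.evalc \<eta> b\<bar>)))"
    by (rule M.noetherian_bound) (rule gS)
  then obtain T C0 \<kappa>0 where T: "T \<subseteq> ?Ak ` {2..}" "finite T" "0 \<le> C0"
     "\<forall>\<eta>. M.character \<eta> \<kappa>0 \<longrightarrow> (\<forall>a\<in>?Ak ` {2..}. \<bar>M.evalc \<eta> a\<bar> \<le> C0 * (\<Sum>b\<in>T. \<bar>M.evalc \<eta> b\<bar>))"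
    by (elim exE conjE)
  obtain L where L: "L \<subseteq> {2..}" "finite L" "T = ?Ak ` L"
    using finite_subset_image[OF T(2,1)] by blast
  define N where "N = (\<Sum>l\<in>L. l)"
  have LN: "L \<subseteq> {2..N}"
    using L member_le_sum[of _ L "\<lambda>l. l"] by (force simp: N_def)
  define \<kappa> where "\<kappa> = \<kappa>0 + K + 2"
  define P where "P = (\<Sum>v\<in>UNIV. real (p v))"
  have pP: "real (p v) \<le> P" for v
    unfolding P_def by (rule member_le_sum) auto
  have p1: "1 \<le> real (p v)" for v using prime_ge_2_nat[OF p(2), of v] by linarith
  have P: "1 \<le> P" by (rule order_trans[OF p1 pP])
  \<comment> \<open>\<open>r * P ^ \<kappa> \<le> 1\<close> makes points with coordinates of size at
    most \<open>r\<close> characters of order \<open>\<kappa>\<close>; \<open>R / 2\<close> keeps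
    \<open>x + s *\<^sub>R w\<close> in the ball of convergence.\<close>
  define r where "r = min (R / 2) (1 / P ^ \<kappa>)"
  have r: "0 < r" "r \<le> R / 2" "r * P ^ \<kappa> \<le> 1" using R P by (auto simp: r_def min_def field_simps)
  define b where "b x w k = M.evalc (point_char (pair_point (x - a) w)) (?Ak k)" for x w k
  have main: "expands_along f (b x w) (B * M.zeta2 + C0) N x w"
    if x: "x \<in> ball a r" and w: "norm w \<le> r" for x w
  proof -
    let ?\<eta> = "\<lambda>s. point_char (pair_point (x - a) (s *\<^sub>R w))"
    have ch: "M.character (?\<eta> s) \<kappa>" if s: "\<bar>s\<bar> \<le> 1" for s
    proof (rule character_point_char[OF p])
      fix v
      have "\<bar>pair_point (x - a) (s *\<^sub>R w) v\<bar> \<le> r"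
      proof (cases v)
        case (Inl i)
        have "\<bar>(x - a) $ i\<bar> \<le> norm (x - a)" by (rule component_le_norm_cart)
        then show ?thesis using x Inl by (simp add: pair_point_def dist_norm norm_minus_commute)
      next
        case (Inr i)
        have "\<bar>s * w $ i\<bar> \<le> 1 * norm w"
          unfolding abs_mult using s component_le_norm_cart[of w i] by (intro mult_mono) auto
        then show ?thesis using w Inr by (simp add: pair_point_def)
      qed
      then have "\<bar>pair_point (x - a) (s *\<^sub>R w) v\<bar> * real (p v) ^ \<kappa> \<le> r * P ^ \<kappa>"
        using pP[of v] r(1) by (intro mult_mono power_mono) auto
      then show "\<bar>pair_point (x - a) (s *\<^sub>R w) v\<bar> * real (p v) ^ \<kappa> \<le> 1" using r(3) by linarith
    qed
    have ch1: "M.character (point_char (pair_point (x - a) w)) \<kappa>" using ch[of 1] by simp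
    have K\<kappa>: "K + 2 \<le> \<kappa>" by (simp add: \<kappa>_def)
    have val: "M.evalc (?\<eta> s) ?A = f (x + s *\<^sub>R w)" if s: "\<bar>s\<bar> \<le> 1" for s
    proof -
      let ?G = "\<lambda>\<alpha>. ?A \<alpha> * ?\<eta> s \<alpha>"
      have sG: "?G summable_on UNIV" by (rule M.eval_summable[OF gA ch[OF s] K\<kappa>])
      \<comment> \<open>Grouping by \<open>total\<close> undoes the binomial expansion and gives
        back the series of \<open>f\<close> at \<open>x + s *\<^sub>R w\<close>.\<close>
      have re: "?G summable_on UNIV \<longleftrightarrow> (\<lambda>(\<tau>, \<alpha>). ?G \<alpha>) summable_on (SIGMA \<tau>:UNIV. {\<alpha>. total \<alpha> = \<tau>})"
        by (rule summable_on_reindex_bij_witness[where i = snd and j = "\<lambda>\<alpha>. (total \<alpha>, \<alpha>)"]) auto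
      have "infsum ?G UNIV = infsum (\<lambda>(\<tau>, \<alpha>). ?G \<alpha>) (SIGMA \<tau>:UNIV. {\<alpha>. total \<alpha> = \<tau>})"
        by (rule infsum_reindex_bij_witness[where i = snd and j = "\<lambda>\<alpha>. (total \<alpha>, \<alpha>)"]) auto
      also have "\<dots> = (\<Sum>\<^sub>\<infinity>\<tau>. \<Sum>\<^sub>\<infinity>\<alpha>\<in>{\<alpha>. total \<alpha> = \<tau>}. ?G \<alpha>)"
        using infsum_Sigma'_banach[of "\<lambda>\<tau>. ?G" UNIV "\<lambda>\<tau>. {\<alpha>. total \<alpha> = \<tau>}"] sG re by simp
      also have "\<dots> = (\<Sum>\<^sub>\<infinity>\<tau>. c \<tau> * (\<Prod>i\<in>UNIV. ((x + s *\<^sub>R w) $ i - a $ i) ^ \<tau> i))"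
        by (simp add: finite_total_fibre shift_coeff_fibre_sum algebra_simps)
      also have "\<dots> = f (x + s *\<^sub>R w)"
      proof (rule infsumI, rule c)
        have "norm (x + s *\<^sub>R w - a) \<le> norm (x - a) + norm (s *\<^sub>R w)"
          using norm_triangle_ineq[of "x - a" "s *\<^sub>R w"] by (simp add: algebra_simps)
        also have "norm (s *\<^sub>R w) \<le> 1 * r" unfolding norm_scaleR using s w r by (intro mult_mono) auto
        also have "norm (x - a) < r" using x by (simp add: dist_norm norm_minus_commute)
        finally show "x + s *\<^sub>R w \<in> ball a R" using r by (simp add: dist_norm norm_minus_commute)
      qed
      finally show ?thesis by (simp add: M.evalc_def)
    qed
    have "(\<lambda>k. b x w k * s ^ k) sums f (x + s *\<^sub>R w)" if s: "\<bar>s\<bar> \<le> 1" for s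
    proof -
      let ?G = "\<lambda>\<alpha>. ?A \<alpha> * ?\<eta> s \<alpha>"
      have sG: "?G summable_on UNIV" by (rule M.eval_summable[OF gA ch[OF s] K\<kappa>])
      \<comment> \<open>The same sum grouped by the degree in the direction becomes a power series
        in \<open>s\<close>.\<close>
      have re: "?G summable_on UNIV \<longleftrightarrow> (\<lambda>(k, \<alpha>). ?G \<alpha>) summable_on (SIGMA k:UNIV. {\<alpha>. right_degree \<alpha> = k})"
        by (rule summable_on_reindex_bij_witness[where i = snd and j = "\<lambda>\<alpha>. (right_degree \<alpha>, \<alpha>)"]) auto
      then have sS: "(\<lambda>(k, \<alpha>). ?G \<alpha>) summable_on (SIGMA k:UNIV. {\<alpha>. right_degree \<alpha> = k})" using sG by blast
      have "f (x + s *\<^sub>R w) = infsum ?G UNIV" using val[OF s] by (simp add: M.evalc_def)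
      also have "\<dots> = infsum (\<lambda>(k, \<alpha>). ?G \<alpha>) (SIGMA k:UNIV. {\<alpha>. right_degree \<alpha> = k})"
        by (rule infsum_reindex_bij_witness[where i = snd and j = "\<lambda>\<alpha>. (right_degree \<alpha>, \<alpha>)"]) auto
      also have "\<dots> = (\<Sum>\<^sub>\<infinity>k. \<Sum>\<^sub>\<infinity>\<alpha>\<in>{\<alpha>. right_degree \<alpha> = k}. ?G \<alpha>)"
        using infsum_Sigma'_banach[OF sS] by simp
      finally have 1: "f (x + s *\<^sub>R w) = (\<Sum>\<^sub>\<infinity>k. \<Sum>\<^sub>\<infinity>\<alpha>\<in>{\<alpha>. right_degree \<alpha> = k}. ?G \<alpha>)" .
      have 2: "(\<Sum>\<^sub>\<infinity>\<alpha>\<in>{\<alpha>. right_degree \<alpha> = k}. ?G \<alpha>) = b x w k * s ^ k" for k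
      proof -
        have "(\<Sum>\<^sub>\<infinity>\<alpha>\<in>{\<alpha>. right_degree \<alpha> = k}. ?G \<alpha>) = (\<Sum>\<^sub>\<infinity>\<alpha>. ?Ak k \<alpha> * point_char (pair_point (x - a) w) \<alpha> * s ^ k)"
          by (rule infsum_cong_neutral) (auto simp: shift_coeff_deg_def point_char_scale)
        also have "\<dots> = b x w k * s ^ k"
          unfolding b_def M.evalc_def
          by (rule infsum_cmult_left) (rule M.eval_summable[OF gAk ch1 K\<kappa>])
        finally show ?thesis .
      qed
      have "(\<lambda>k. \<Sum>\<^sub>\<infinity>\<alpha>\<in>{\<alpha>. right_degree \<alpha> = k}. ?G \<alpha>) summable_on UNIV"
        using summable_on_Sigma_banach[OF sS] by simp
      then have "((\<lambda>k. b x w k * s ^ k) has_sum f (x + s *\<^sub>R w)) UNIV"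
        unfolding 2 1 by (rule has_sum_infsum)
      then show ?thesis by (rule has_sum_imp_sums)
    qed
    moreover have "\<bar>b x w k\<bar> \<le> B * M.zeta2 + C0" for k
      using M.eval_bound[OF gAk ch1 K\<kappa>, of k] T(3) by (simp add: b_def)
    moreover have "\<bar>b x w k\<bar> \<le> (B * M.zeta2 + C0) * (\<Sum>l=2..N. \<bar>b x w l\<bar>)" if k: "k \<ge> 2" for k
    proof -
      have "M.character (point_char (pair_point (x - a) w)) \<kappa>0"
        using ch1 by (rule M.character_mono) (simp add: \<kappa>_def)
      then have "\<bar>b x w k\<bar> \<le> C0 * (\<Sum>g\<in>T. \<bar>M.evalc (point_char (pair_point (x - a) w)) g\<bar>)"
        using T(4) k by (simp add: b_def)
      also have "\<dots> \<le> C0 * (\<Sum>l\<in>L. \<bar>b x w l\<bar>)"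
        unfolding L(3) b_def using T(3) sum_image_le[OF L(2), of "\<lambda>g. \<bar>M.evalc (point_char (pair_point (x - a) w)) g\<bar>" ?Ak]
        by (intro mult_left_mono) (auto simp: o_def)
      also have "\<dots> \<le> (B * M.zeta2 + C0) * (\<Sum>l=2..N. \<bar>b x w l\<bar>)"
        using T(3) B M.zeta2_nonneg LN by (intro mult_mono sum_mono2 sum_nonneg) auto
      finally show ?thesis .
    qed
    ultimately show ?thesis by (simp add: expands_along_def)
  qed
  have "0 \<le> B * M.zeta2 + C0" using B M.zeta2_nonneg T(3) by simp
  then show ?thesis
    using r(1) main by (intro exI[of _ r] exI[of _ "B * M.zeta2 + C0"] exI[of _ N] exI[of _ b] conjI ballI allI impI) simp_all
qed

section \<open>Power series in one variable\<close>

text \<open>Induction on the degree: \<open>2 ^ Suc n * P (x / 2) - P x\<close> has no term of degree \<open>Suc n\<close>.\<close>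

lemma polynomial_coefficient_bound:
  "\<exists>K\<ge>0. \<forall>a :: nat \<Rightarrow> real. \<forall>M. (\<forall>x. 0 \<le> x \<longrightarrow> x \<le> 1 \<longrightarrow> \<bar>\<Sum>k\<le>n. a k * x ^ k\<bar> \<le> M) \<longrightarrow>
      (\<forall>k\<le>n. \<bar>a k\<bar> \<le> K * M)"
proof (induction n)
  case 0
  show ?case by (intro exI[of _ 1]) (auto dest: spec[of _ 0])
next
  case (Suc n)
  then obtain K where K: "0 \<le> K" "\<forall>a :: nat \<Rightarrow> real. \<forall>M. (\<forall>x. 0 \<le> x \<longrightarrow> x \<le> 1 \<longrightarrow> \<bar>\<Sum>k\<le>n. a k * x ^ k\<bar> \<le> M) \<longrightarrow>
      (\<forall>k\<le>n. \<bar>a k\<bar> \<le> K * M)"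
    by (elim exE conjE)
  define Q :: real where "Q = 2 ^ Suc n + 1"
  have Q: "0 \<le> Q" by (simp add: Q_def)
  \<comment> \<open>The last summand covers the coefficients up to degree \<open>n\<close>; the
    first two cover the top coefficient, read off from the value at 1 after the others are
    subtracted.\<close>
  define K' where "K' = 1 + (real n + 1) * K * Q + K * Q"
  have "\<bar>a k\<bar> \<le> K' * M" if M: "\<forall>x. 0 \<le> x \<longrightarrow> x \<le> 1 \<longrightarrow> \<bar>\<Sum>k\<le>Suc n. a k * x ^ k\<bar> \<le> M" and k: "k \<le> Suc n"
    for a :: "nat \<Rightarrow> real" and M k
  proof -
    have M0: "0 \<le> M" using M[rule_format, of 0] by linarith
    define q where "q k = (2 ^ (Suc n - k) - 1) * a k" for k
    have qb: "\<bar>\<Sum>k\<le>n. q k * x ^ k\<bar> \<le> Q * M" if x: "0 \<le> x" "x \<le> 1" for x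
    proof -
      have "(\<Sum>k\<le>n. q k * x ^ k) = (\<Sum>k\<le>Suc n. q k * x ^ k)" by (simp add: q_def)
      also have "\<dots> = (\<Sum>k\<le>Suc n. 2 ^ Suc n * (a k * (x / 2) ^ k) - a k * x ^ k)"
      proof (rule sum.cong[OF refl])
        fix k assume "k \<in> {..Suc n}"
        then have "(2::real) ^ (Suc n - k) = 2 ^ Suc n / 2 ^ k" by (simp add: power_diff)
        then show "q k * x ^ k = 2 ^ Suc n * (a k * (x / 2) ^ k) - a k * x ^ k"
          by (simp add: q_def power_divide algebra_simps)
      qed
      also have "\<dots> = 2 ^ Suc n * (\<Sum>k\<le>Suc n. a k * (x / 2) ^ k) - (\<Sum>k\<le>Suc n. a k * x ^ k)"
        by (simp only: sum_subtractf sum_distrib_left)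
      also have "\<bar>\<dots>\<bar> \<le> 2 ^ Suc n * \<bar>\<Sum>k\<le>Suc n. a k * (x / 2) ^ k\<bar> + \<bar>\<Sum>k\<le>Suc n. a k * x ^ k\<bar>"
        by (rule order_trans[OF abs_triangle_ineq4]) (simp add: abs_mult)
      also have "\<dots> \<le> 2 ^ Suc n * M + M"
        using M[rule_format, of x] M[rule_format, of "x / 2"] x by (intro add_mono mult_left_mono) auto
      finally show ?thesis by (simp add: Q_def algebra_simps)
    qed
    have "\<forall>k\<le>n. \<bar>q k\<bar> \<le> K * (Q * M)" using K(2) qb by blast
    moreover have "\<bar>a k\<bar> \<le> \<bar>q k\<bar>" if "k \<le> n" for k
    proof -
      have "(2::real) ^ 1 \<le> 2 ^ (Suc n - k)" using that by (intro power_increasing) auto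
      then have "1 * \<bar>a k\<bar> \<le> \<bar>2 ^ (Suc n - k) - 1\<bar> * \<bar>a k\<bar>" by (intro mult_right_mono) auto
      then show ?thesis by (simp add: q_def abs_mult)
    qed
    ultimately have low: "\<bar>a k\<bar> \<le> K * Q * M" if "k \<le> n" for k using that by fastforce
    show ?thesis
    proof (cases "k \<le> n")
      case True
      have "K * Q * M \<le> K' * M" using K(1) Q M0 by (intro mult_right_mono) (auto simp: K'_def)
      then show ?thesis using low[OF True] by linarith
    next
      case False
      then have ks: "k = Suc n" using k by simp
      have "a (Suc n) = (\<Sum>k\<le>Suc n. a k * 1 ^ k) - (\<Sum>k\<le>n. a k)" by simp
      then have "\<bar>a (Suc n)\<bar> \<le> \<bar>\<Sum>k\<le>Suc n. a k * 1 ^ k\<bar> + \<bar>\<Sum>k\<le>n. a k\<bar>" by linarith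
      also have "\<dots> \<le> M + (\<Sum>k\<le>n. K * Q * M)"
      proof (rule add_mono)
        show "\<bar>\<Sum>k\<le>n. a k\<bar> \<le> (\<Sum>k\<le>n. K * Q * M)"
          by (rule order_trans[OF sum_abs sum_mono]) (use low in simp)
      qed (use M[rule_format, of 1] in simp)
      also have "\<dots> \<le> K' * M" using K(1) Q M0 by (simp add: K'_def algebra_simps)
      finally show ?thesis by (simp add: ks)
    qed
  qed
  moreover have "0 \<le> K'" using K(1) Q by (simp add: K'_def)
  ultimately show ?case by (intro exI[of _ K'] conjI allI impI)
qed

lemma power_series_deriv:
  fixes G :: "real \<Rightarrow> real"
  assumes "\<And>s. \<bar>s\<bar> < \<rho> \<Longrightarrow> (\<lambda>k. b k * s ^ k) sums G s" and s: "\<bar>s\<bar> < \<rho>"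
  shows "(G has_real_derivative deriv G s) (at s)" and "(\<lambda>k. diffs b k * s ^ k) sums deriv G s"
proof -
  have "((\<lambda>z. \<Sum>k. b k * z ^ k) has_field_derivative (\<Sum>k. diffs b k * s ^ k)) (at s)"
    using assms by (intro termdiffs_strong'[where K = \<rho>]) (auto intro: sums_summable)
  moreover have "eventually (\<lambda>z. (\<Sum>k. b k * z ^ k) = G z) (nhds s)"
  proof -
    have "open {z. \<bar>z\<bar> < \<rho>}" by (intro open_Collect_less continuous_intros)
    then show ?thesis
      unfolding eventually_nhds using assms by (intro exI[of _ "{z. \<bar>z\<bar> < \<rho>}"]) (auto simp: sums_iff)
  qed
  ultimately have D: "(G has_real_derivative (\<Sum>k. diffs b k * s ^ k)) (at s)"
    using DERIV_cong_ev[OF refl, of "\<lambda>z. \<Sum>k. b k * z ^ k" G s] by simp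
  then show D': "(G has_real_derivative deriv G s) (at s)"
    using DERIV_imp_deriv[OF D] by simp
  show "(\<lambda>k. diffs b k * s ^ k) sums deriv G s"
    by (rule termdiffs_sums_strong[where K = \<rho>, OF _ D']) (use assms in auto)
qed

lemma power_series_derivs:
  fixes F :: "real \<Rightarrow> real"
  assumes F: "\<And>s. \<bar>s\<bar> < \<rho> \<Longrightarrow> (\<lambda>k. b k * s ^ k) sums F s"
  shows "\<bar>s\<bar> < \<rho> \<Longrightarrow> (\<lambda>k. (diffs ^^ j) b k * s ^ k) sums (deriv ^^ j) F s"
proof (induction j arbitrary: s)
  case (Suc j)
  from power_series_deriv(2)[OF Suc.IH Suc.prems] show ?case by simp
qed (use F in simp)

lemma power_series_derivs_has_derivative:
  fixes F :: "real \<Rightarrow> real"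
  assumes F: "\<And>s. \<bar>s\<bar> < \<rho> \<Longrightarrow> (\<lambda>k. b k * s ^ k) sums F s" and s: "\<bar>s\<bar> < \<rho>"
  shows "((deriv ^^ j) F has_real_derivative (deriv ^^ Suc j) F s) (at s)"
  using power_series_deriv(1)[OF power_series_derivs[OF F] s] by simp

text \<open>The entry at k is (k + j)! / k!, the factor that \<open>j\<close> differentiations put
  on the coefficient of order k + j. As an iterated \<open>diffs\<close>, its generating series is a
  derivative of the geometric series, which gives summability.\<close>

definition diffs_one :: "nat \<Rightarrow> nat \<Rightarrow> real" where
  "diffs_one j = (diffs ^^ j) (\<lambda>_. 1)"

lemma diffs_funpow: "(diffs ^^ j) b k = diffs_one j k * b (k + j)"
  by (induction j arbitrary: k) (simp_all add: diffs_def diffs_one_def)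

lemma diffs_one_nonneg: "0 \<le> diffs_one j k"
  by (induction j arbitrary: k) (simp_all add: diffs_def diffs_one_def)

lemma diffs_one_summable: "\<bar>s\<bar> < 1 \<Longrightarrow> summable (\<lambda>k. diffs_one j k * s ^ k)"
  using power_series_derivs[of 1 "\<lambda>_. 1" "\<lambda>s. 1 / (1 - s)" s j] geometric_sums[where 'a = real]
  by (auto simp: diffs_one_def intro: sums_summable)

text \<open>
  \<open>P\<close> is the derivative of a convex function. On a short interval it is a polynomial of degree \<open>N\<close> up to
  an error that is small compared with the coefficients, so its increment controls them.
\<close>

lemma series_core:
  assumes C: "0 \<le> C"
  shows "\<exists>s1 D. 0 < s1 \<and> s1 \<le> 1 / 2 \<and> 0 \<le> D \<and> (\<forall>(b :: nat \<Rightarrow> real) P.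
      (\<forall>k\<ge>2. \<bar>b k\<bar> \<le> C * (\<Sum>l=2..N. \<bar>b l\<bar>)) \<longrightarrow> (\<forall>s. \<bar>s\<bar> < 1 \<longrightarrow> (\<lambda>k. diffs b k * s ^ k) sums P s) \<longrightarrow>
      (\<forall>s. 0 \<le> s \<longrightarrow> s \<le> s1 \<longrightarrow> P 0 \<le> P s \<and> P s \<le> P s1) \<longrightarrow> (\<Sum>l=2..N. \<bar>b l\<bar>) \<le> D * (P s1 - P 0))"
proof -
  obtain K where K: "0 \<le> K" "\<forall>a :: nat \<Rightarrow> real. \<forall>M. (\<forall>x. 0 \<le> x \<longrightarrow> x \<le> 1 \<longrightarrow> \<bar>\<Sum>k\<le>N. a k * x ^ k\<bar> \<le> M) \<longrightarrow>
      (\<forall>k\<le>N. \<bar>a k\<bar> \<le> K * M)"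
    using polynomial_coefficient_bound by blast
  \<comment> \<open>Majorant of the tail beyond degree \<open>N\<close>: the coefficient of index
    \<open>j + Suc N\<close> of the derived series carries the factor \<open>j + N + 2\<close>, and
    \<open>s \<le> 1 / 2\<close> supplies the geometric decay.\<close>
  define g where "g j = (real j + real N + 2) * (1 / 2) ^ j" for j
  have "summable (\<lambda>j. diffs_one 1 j * (1 / 2) ^ j + (real N + 1) * (diffs_one 0 j * (1 / 2) ^ j))"
    by (intro summable_add summable_mult diffs_one_summable) auto
  moreover have "diffs_one 1 j * (1 / 2) ^ j + (real N + 1) * (diffs_one 0 j * (1 / 2) ^ j) = g j" for j
    by (simp add: diffs_one_def diffs_def g_def algebra_simps)
  ultimately have g: "summable g" by simp
  define T where "T = suminf g"
  have T: "0 \<le> T" unfolding T_def by (rule suminf_nonneg[OF g]) (simp add: g_def)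
  \<comment> \<open>Small enough that the contribution of the tail is at most half of
    \<open>M * s1 ^ N\<close> and can be absorbed on the left-hand side.\<close>
  define s1 where "s1 = 1 / (2 * (real N * K * C * T + 1))"
  have NK: "0 \<le> real N * K * C * T" using K(1) C T by simp
  have s1: "0 < s1" "s1 \<le> 1 / 2" using NK by (auto simp: s1_def field_simps)
  have s1': "real N * K * C * T * s1 \<le> 1 / 2" using NK by (simp add: s1_def field_simps)
  define D where "D = 2 * real N * K / s1 ^ N"
  have D: "0 \<le> D" using K(1) s1 by (simp add: D_def)
  have "(\<Sum>l=2..N. \<bar>b l\<bar>) \<le> D * (P s1 - P 0)"
    if b: "\<forall>k\<ge>2. \<bar>b k\<bar> \<le> C * (\<Sum>l=2..N. \<bar>b l\<bar>)" and P: "\<forall>s. \<bar>s\<bar> < 1 \<longrightarrow> (\<lambda>k. diffs b k * s ^ k) sums P s"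
      and mono: "\<forall>s. 0 \<le> s \<longrightarrow> s \<le> s1 \<longrightarrow> P 0 \<le> P s \<and> P s \<le> P s1" for b :: "nat \<Rightarrow> real" and P
  proof -
    define M where "M = (\<Sum>l=2..N. \<bar>b l\<bar>)"
    have M: "0 \<le> M" unfolding M_def by (rule sum_nonneg) simp
    define E where "E = P s1 - P 0"
    define a where "a k = (if k = 0 then 0 else diffs b k)" for k
    have asum: "(\<lambda>k. a k * s ^ k) sums (P s - P 0)" if "\<bar>s\<bar> < 1" for s
    proof -
      have P0: "P 0 = diffs b 0"
        by (rule sums_unique2[OF P[rule_format] powser_sums_zero]) simp
      have "(\<lambda>k. if k = 0 then diffs b 0 else 0) sums diffs b 0"
        using sums_If_finite[of "\<lambda>k. k = 0" "\<lambda>k. diffs b 0"] by simp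
      from sums_diff[OF P[rule_format, OF that] this]
      have "(\<lambda>k. diffs b k * s ^ k - (if k = 0 then diffs b 0 else 0)) sums (P s - P 0)" by (simp add: P0)
      moreover have "(\<lambda>k. diffs b k * s ^ k - (if k = 0 then diffs b 0 else 0)) = (\<lambda>k. a k * s ^ k)"
        by (auto simp: a_def)
      ultimately show ?thesis by simp
    qed
    have abound: "\<bar>a k\<bar> \<le> (real k + 1) * (C * M)" for k
    proof (cases "k = 0")
      case False
      have "\<bar>b (Suc k)\<bar> \<le> C * M" using b False by (simp add: M_def)
      then have "(real k + 1) * \<bar>b (Suc k)\<bar> \<le> (real k + 1) * (C * M)" by (intro mult_left_mono) auto
      then show ?thesis using False by (simp add: a_def diffs_def abs_mult add.commute)
    qed (use C M in \<open>simp add: a_def\<close>)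
    have tail: "\<bar>P s - P 0 - (\<Sum>k\<le>N. a k * s ^ k)\<bar> \<le> C * M * T * s1 ^ Suc N" if s: "0 \<le> s" "s \<le> s1" for s
    proof -
      have s12: "\<bar>s\<bar> < 1" "s \<le> 1 / 2" using s s1 by auto
      have "(\<lambda>j. a (j + Suc N) * s ^ (j + Suc N)) sums (P s - P 0 - (\<Sum>k<Suc N. a k * s ^ k))"
        using asum[OF s12(1)] by (subst sums_iff_shift) simp
      then have sj: "(\<lambda>j. a (j + Suc N) * s ^ (j + Suc N)) sums (P s - P 0 - (\<Sum>k\<le>N. a k * s ^ k))"
        by (simp only: lessThan_Suc_atMost)
      have le: "norm (a (j + Suc N) * s ^ (j + Suc N)) \<le> C * M * s1 ^ Suc N * g j" for j
      proof -
        have "s ^ (j + Suc N) \<le> (1 / 2) ^ j * s1 ^ Suc N"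
          unfolding power_add using s s12 s1 by (intro mult_mono power_mono) auto
        then have "\<bar>a (j + Suc N)\<bar> * s ^ (j + Suc N) \<le> ((real (j + Suc N) + 1) * (C * M)) * ((1 / 2) ^ j * s1 ^ Suc N)"
          using abound[of "j + Suc N"] C M s by (intro mult_mono) auto
        then show ?thesis using s by (simp add: abs_mult g_def algebra_simps)
      qed
      have "norm (P s - P 0 - (\<Sum>k\<le>N. a k * s ^ k)) \<le> C * M * s1 ^ Suc N * T"
        using norm_suminf_le[OF le summable_mult[OF g]] sj suminf_mult[OF g]
        by (simp add: sums_iff T_def)
      then show ?thesis by (simp add: mult_ac)
    qed
    \<comment> \<open>Rescaling by \<open>s1\<close> leads to the unit interval, where the
      coefficient bound for polynomials applies; by the assumed bounds on \<open>P\<close>, its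
      increment stays between 0 and \<open>E\<close>.\<close>
    have "\<bar>\<Sum>k\<le>N. (a k * s1 ^ k) * x ^ k\<bar> \<le> E + C * M * T * s1 ^ Suc N" if x: "0 \<le> x" "x \<le> 1" for x
    proof -
      have "0 \<le> s1 * x" "s1 * x \<le> s1" using x s1 by (auto simp: mult_left_le)
      then have "\<bar>\<Sum>k\<le>N. a k * (s1 * x) ^ k\<bar> \<le> E + C * M * T * s1 ^ Suc N"
        using tail[of "s1 * x"] mono[rule_format, of "s1 * x"] by (auto simp: E_def)
      then show ?thesis by (simp add: power_mult_distrib mult_ac)
    qed
    then have coef: "\<bar>a k * s1 ^ k\<bar> \<le> K * (E + C * M * T * s1 ^ Suc N)" if "k \<le> N" for k
      using K(2)[rule_format, of "\<lambda>k. a k * s1 ^ k"] that by simp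
    have "M * s1 ^ N = (\<Sum>l=2..N. \<bar>b l\<bar> * s1 ^ N)" by (simp add: M_def sum_distrib_right)
    also have "\<dots> \<le> (\<Sum>l=2..N. K * (E + C * M * T * s1 ^ Suc N))"
    proof (rule sum_mono)
      fix l assume l: "l \<in> {2..N}"
      then obtain k where k: "l = Suc k" "k \<noteq> 0" "k \<le> N" by (cases l) auto
      have "1 * \<bar>b l\<bar> \<le> (real k + 1) * \<bar>b l\<bar>" by (intro mult_right_mono) auto
      also have "\<dots> = \<bar>a k\<bar>" using k by (simp add: a_def diffs_def abs_mult)
      finally have "\<bar>b l\<bar> * s1 ^ N \<le> \<bar>a k\<bar> * s1 ^ k"
        using s1 k by (intro mult_mono power_decreasing) auto
      also have "\<dots> \<le> K * (E + C * M * T * s1 ^ Suc N)" using coef[OF k(3)] s1 by (simp add: abs_mult)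
      finally show "\<bar>b l\<bar> * s1 ^ N \<le> K * (E + C * M * T * s1 ^ Suc N)" .
    qed
    also have "\<dots> \<le> real N * (K * (E + C * M * T * s1 ^ Suc N))"
    proof -
      have "0 \<le> K * (E + C * M * T * s1 ^ Suc N)" using order_trans[OF abs_ge_zero coef[of 0]] by simp
      then show ?thesis by (simp add: mult_right_mono)
    qed
    also have "\<dots> = real N * K * E + (real N * K * C * T * s1) * (M * s1 ^ N)" by (simp add: algebra_simps)
    also have "\<dots> \<le> real N * K * E + 1 / 2 * (M * s1 ^ N)"
      using s1' M s1 by (intro add_left_mono mult_right_mono) auto
    finally have "M * s1 ^ N \<le> 2 * real N * K * E" by simp
    then have "M \<le> 2 * real N * K * E / s1 ^ N" using s1 by (simp add: pos_le_divide_eq)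
    then show ?thesis by (simp add: D_def M_def E_def)
  qed
  then show ?thesis using s1 D by (intro exI[of _ s1] exI[of _ D] conjI allI impI)
qed

section \<open>Directional derivatives of a convex analytic function\<close>

text \<open>Being taken along a line, this is homogeneous of degree \<open>j\<close> in
  \<open>w\<close> where \<open>f\<close> is analytic (\<open>dd_scale\<close>); that is how the
  length of a segment turns into powers of \<rho>.\<close>

definition dd :: "('a::real_normed_vector \<Rightarrow> real) \<Rightarrow> nat \<Rightarrow> 'a \<Rightarrow> 'a \<Rightarrow> real" where
  "dd f j y w = (deriv ^^ j) (\<lambda>s. f (y + s *\<^sub>R w)) 0"

lemma deriv_funpow_shift:
  fixes F :: "real \<Rightarrow> real"
  shows "(deriv ^^ j) (\<lambda>s. F (s + t)) = (\<lambda>s. (deriv ^^ j) F (s + t))"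
proof (induction j)
  case (Suc j)
  have "deriv (\<lambda>s. G (s + t)) s = deriv G (s + t)" for G :: "real \<Rightarrow> real" and s
    unfolding deriv_def by (simp add: DERIV_shift)
  then show ?case by (simp add: Suc fun_eq_iff)
qed simp

lemma dd_shift: "(deriv ^^ j) (\<lambda>s. f (x + s *\<^sub>R w)) s = dd f j (x + s *\<^sub>R w) w"
  using fun_cong[OF deriv_funpow_shift[of j "\<lambda>\<sigma>. f (x + \<sigma> *\<^sub>R w)" s], of 0]
  by (simp add: dd_def scaleR_add_left add_ac)

lemma dd_0 [simp]: "dd f 0 y w = f y"
  by (simp add: dd_def)

lemma dd_eq_coeff:
  assumes "0 < \<rho>" "\<And>s. \<bar>s\<bar> < \<rho> \<Longrightarrow> (\<lambda>k. b k * s ^ k) sums f (y + s *\<^sub>R w)"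
  shows "dd f j y w = diffs_one j 0 * b j"
proof -
  have "(\<lambda>k. (diffs ^^ j) b k * 0 ^ k) sums dd f j y w"
    unfolding dd_def by (rule power_series_derivs[OF assms(2)]) (use assms(1) in simp_all)
  then have "dd f j y w = (diffs ^^ j) b 0"
    by (rule sums_unique2[OF _ powser_sums_zero])
  then show ?thesis by (simp add: diffs_funpow)
qed

locale convex_analytic =
  fixes f :: "real^'n \<Rightarrow> real" and U :: "(real^'n) set"
  assumes open_U: "open U" and cvx: "convex_on U f" and ana: "f real_analytic_on U"
begin

lemma convex_U: "convex U"
  using cvx by (rule convex_on_imp_convex)

lemma line_series:
  assumes "y \<in> U"
  shows "\<exists>\<rho>>0. \<exists>b. \<forall>s. \<bar>s\<bar> < \<rho> \<longrightarrow> (\<lambda>k. b k * s ^ k) sums f (y + s *\<^sub>R w)"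
proof -
  obtain r C N b where r: "0 < r" and b0: "\<forall>x\<in>ball y r. \<forall>w. norm w \<le> r \<longrightarrow> expands_along f (b x w) C N x w"
    using local_expansion[OF ana assms] by (elim exE conjE)
  note b = b0[unfolded expands_along_def]
  \<comment> \<open>Division by \<open>c\<close> brings \<open>w\<close> to length at most
    \<open>r\<close>; the added 1 covers \<open>w = 0\<close>.\<close>
  define c where "c = (norm w + 1) / r"
  have c: "0 < c" using r by (simp add: c_def add_nonneg_pos)
  have nw: "norm ((1 / c) *\<^sub>R w) \<le> r"
    using r c by (simp add: c_def field_simps)
  have yb: "y \<in> ball y r" using r by simp
  have *: "(\<lambda>k. b y ((1 / c) *\<^sub>R w) k * s ^ k) sums f (y + s *\<^sub>R (1 / c) *\<^sub>R w)" if "\<bar>s\<bar> \<le> 1" for s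
    using b[THEN bspec, OF yb, THEN spec, THEN mp, OF nw, THEN conjunct1, THEN spec, THEN mp, OF that] .
  have ser: "(\<lambda>k. (b y ((1 / c) *\<^sub>R w) k * c ^ k) * s ^ k) sums f (y + s *\<^sub>R w)" if "\<bar>s\<bar> < 1 / c" for s
  proof -
    have "\<bar>s * c\<bar> \<le> 1" using that c by (simp add: abs_mult field_simps)
    from *[OF this] show ?thesis using c by (simp add: power_mult_distrib mult_ac)
  qed
  show ?thesis
    by (intro exI[of _ "1 / c"] exI[of _ "\<lambda>k. b y ((1 / c) *\<^sub>R w) k * c ^ k"] conjI allI impI ser) (use c in simp_all)
qed

lemma dd_scale:
  assumes "y \<in> U"
  shows "dd f j y (c *\<^sub>R w) = c ^ j * dd f j y w"
proof -
  obtain \<rho> b where \<rho>: "\<rho> > 0" and b: "\<And>s. \<bar>s\<bar> < \<rho> \<Longrightarrow> (\<lambda>k. b k * s ^ k) sums f (y + s *\<^sub>R w)"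
    using line_series[OF assms] by blast
  define \<rho>' where "\<rho>' = \<rho> / (\<bar>c\<bar> + 1)"
  have \<rho>': "\<rho>' > 0" using \<rho> by (simp add: \<rho>'_def add_nonneg_pos)
  have "(\<lambda>k. (b k * c ^ k) * s ^ k) sums f (y + s *\<^sub>R (c *\<^sub>R w))" if s: "\<bar>s\<bar> < \<rho>'" for s
  proof -
    have "\<bar>s * c\<bar> \<le> \<bar>s\<bar> * (\<bar>c\<bar> + 1)" by (simp add: abs_mult mult_left_mono)
    also have "\<dots> < \<rho>" using s by (simp add: \<rho>'_def pos_less_divide_eq add_nonneg_pos)
    finally show ?thesis using b[of "s * c"] by (simp add: power_mult_distrib mult_ac)
  qed
  from dd_eq_coeff[OF \<rho>' this, of j] dd_eq_coeff[OF \<rho> b, of j] show ?thesis by simp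
qed

lemma line_has_derivative:
  assumes "x + s *\<^sub>R w \<in> U"
  shows "((\<lambda>s. dd f j (x + s *\<^sub>R w) w) has_real_derivative dd f (Suc j) (x + s *\<^sub>R w) w) (at s)"
proof -
  obtain \<rho> b where \<rho>: "\<rho> > 0" and b: "\<And>\<sigma>. \<bar>\<sigma>\<bar> < \<rho> \<Longrightarrow> (\<lambda>k. b k * \<sigma> ^ k) sums f ((x + s *\<^sub>R w) + \<sigma> *\<^sub>R w)"
    using line_series[OF assms] by blast
  have "((deriv ^^ j) (\<lambda>\<sigma>. f ((x + s *\<^sub>R w) + \<sigma> *\<^sub>R w)) has_real_derivative
       (deriv ^^ Suc j) (\<lambda>\<sigma>. f ((x + s *\<^sub>R w) + \<sigma> *\<^sub>R w)) 0) (at 0)"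
    by (rule power_series_derivs_has_derivative[OF b]) (use \<rho> in simp_all)
  moreover have "(deriv ^^ j) (\<lambda>\<sigma>. f ((x + s *\<^sub>R w) + \<sigma> *\<^sub>R w)) = (\<lambda>\<sigma>. dd f j (x + (\<sigma> + s) *\<^sub>R w) w)" for j
    by (rule ext, subst dd_shift) (simp add: scaleR_add_left add_ac)
  ultimately have "((\<lambda>\<sigma>. dd f j (x + (\<sigma> + s) *\<^sub>R w) w) has_real_derivative dd f (Suc j) (x + s *\<^sub>R w) w) (at 0)"
    by (simp only: add_0_left)
  then show ?thesis
    using DERIV_shift[of "\<lambda>s. dd f j (x + s *\<^sub>R w) w" _ 0 s] by simp
qed

lemma line_has_derivative1:
  assumes "x + s *\<^sub>R w \<in> U"
  shows "((\<lambda>s. f (x + s *\<^sub>R w)) has_real_derivative dd f 1 (x + s *\<^sub>R w) w) (at s)"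
  using line_has_derivative[OF assms, of 0] by simp

lemma line_has_derivative0:
  assumes "y \<in> U"
  shows "((\<lambda>s. f (y + s *\<^sub>R w)) has_real_derivative dd f 1 y w) (at 0)"
proof -
  have "y + 0 *\<^sub>R w = y" by simp
  then show ?thesis using line_has_derivative1[of y 0 w] assms by (simp only:)
qed

lemma open_line: "open {s. x + s *\<^sub>R w \<in> U}"
proof -
  have "continuous_on UNIV (\<lambda>s. x + s *\<^sub>R w)" by (intro continuous_intros)
  from open_vimage[OF open_U this] show ?thesis by (simp add: vimage_def)
qed

lemma convex_on_line: "convex_on {s. x + s *\<^sub>R w \<in> U} (\<lambda>s. f (x + s *\<^sub>R w))"
proof -
  have eq: "x + ((1 - t) *\<^sub>R a + t *\<^sub>R b) *\<^sub>R w = (1 - t) *\<^sub>R (x + a *\<^sub>R w) + t *\<^sub>R (x + b *\<^sub>R w)" for t a b :: real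
    by (simp add: algebra_simps)
  have cv: "convex {s. x + s *\<^sub>R w \<in> U}"
    unfolding convex_alt using convex_U by (simp add: eq[simplified] convex_alt)
  show ?thesis
  proof (rule convex_onI[OF _ cv])
    fix t a b :: real assume "0 < t" "t < 1" "a \<in> {s. x + s *\<^sub>R w \<in> U}" "b \<in> {s. x + s *\<^sub>R w \<in> U}"
    then show "f (x + ((1 - t) *\<^sub>R a + t *\<^sub>R b) *\<^sub>R w) \<le> (1 - t) * f (x + a *\<^sub>R w) + t * f (x + b *\<^sub>R w)"
      unfolding eq using cvx by (intro convex_onD) auto
  qed
qed

lemma dd_tangent:
  assumes "y \<in> U" "y + w \<in> U"
  shows "dd f 1 y w \<le> f (y + w) - f y"
proof -
  let ?A = "{s. y + s *\<^sub>R w \<in> U}"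
  have conn: "connected ?A" using convex_on_imp_convex[OF convex_on_line] by (rule convex_connected)
  have "0 \<in> interior ?A" using assms open_line by (simp add: interior_open)
  have "((\<lambda>s. f (y + s *\<^sub>R w)) has_real_derivative dd f 1 y w) (at 0 within ?A)"
    by (rule has_field_derivative_at_within[OF line_has_derivative0[OF assms(1)]])
  from convex_on_imp_above_tangent[OF convex_on_line conn \<open>0 \<in> interior ?A\<close> _ this, of 1]
  show ?thesis using assms by simp
qed

text \<open>The sum of the tangent inequalities at the two end points.\<close>

lemma dd_mono:
  assumes "y \<in> U" "y + w \<in> U"
  shows "dd f 1 y w \<le> dd f 1 (y + w) w"
  using dd_tangent[OF assms] dd_tangent[of "y + w" "- w"] dd_scale[of "y + w" 1 "-1" w] assms by simp

lemma dd_mono_line: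
  assumes "x + s *\<^sub>R w \<in> U" "x + t *\<^sub>R w \<in> U" "s \<le> t"
  shows "dd f 1 (x + s *\<^sub>R w) w \<le> dd f 1 (x + t *\<^sub>R w) w"
proof (cases "s = t")
  case False
  have eq: "x + s *\<^sub>R w + (t - s) *\<^sub>R w = x + t *\<^sub>R w" by (simp add: algebra_simps)
  have "(t - s) * dd f 1 (x + s *\<^sub>R w) w \<le> (t - s) * dd f 1 (x + t *\<^sub>R w) w"
    using dd_mono[of "x + s *\<^sub>R w" "(t - s) *\<^sub>R w"] assms by (simp add: eq dd_scale)
  then show ?thesis using False assms(3) by simp
qed simp

text \<open>For j >= 2 the derivative of order j involves only coefficients of order at least 2.
  These are dominated by finitely many of them, and the latter by the increment of the first
  derivative (\<open>series_core\<close>). Enlarging the direction to \<open>w' = w / s1\<close>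
  puts the end point at parameter \<open>s1 \<le> 1 / 2\<close>, well inside the interval of
  convergence.\<close>

lemma local_derivative_bound:
  assumes "a \<in> U"
  shows "\<exists>\<delta>>0. \<exists>D\<ge>0. \<forall>x\<in>ball a \<delta>. \<forall>w. norm w \<le> \<delta> \<longrightarrow>
           (\<forall>j\<in>{2..J}. \<bar>dd f j (x + w) w\<bar> \<le> D * (dd f 1 (x + w) w - dd f 1 x w))"
proof -
  obtain r C N b where r0: "0 < r" and C: "0 \<le> C" and b0: "\<forall>x\<in>ball a r. \<forall>w. norm w \<le> r \<longrightarrow> expands_along f (b x w) C N x w"
    using local_expansion[OF ana assms] by (elim exE conjE)
  note b = b0[unfolded expands_along_def]
  obtain R where R: "0 < R" "ball a R \<subseteq> U" using open_U assms by (meson open_contains_ball)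
  define q where "q = min r (R / 2)"
  have q: "0 < q" "q \<le> r" "q \<le> R / 2" using r0 R by (auto simp: q_def)
  obtain s1 D where s1: "0 < s1" "s1 \<le> 1 / 2" and D: "0 \<le> D" and core: "\<forall>(b :: nat \<Rightarrow> real) P.
      (\<forall>k\<ge>2. \<bar>b k\<bar> \<le> C * (\<Sum>l=2..N. \<bar>b l\<bar>)) \<longrightarrow> (\<forall>s. \<bar>s\<bar> < 1 \<longrightarrow> (\<lambda>k. diffs b k * s ^ k) sums P s) \<longrightarrow>
      (\<forall>s. 0 \<le> s \<longrightarrow> s \<le> s1 \<longrightarrow> P 0 \<le> P s \<and> P s \<le> P s1) \<longrightarrow> (\<Sum>l=2..N. \<bar>b l\<bar>) \<le> D * (P s1 - P 0)"
    using series_core[OF C, of N] by (elim exE conjE)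
  define Z where "Z j = (\<Sum>k. diffs_one j k * (1 / 2) ^ k)" for j
  have Zs: "summable (\<lambda>k. diffs_one j k * (1 / 2) ^ k)" for j by (rule diffs_one_summable) simp
  have Z: "0 \<le> Z j" for j unfolding Z_def by (rule suminf_nonneg[OF Zs]) (simp add: diffs_one_nonneg)
  define ZZ where "ZZ = (\<Sum>j\<le>J. Z j)"
  have ZZ: "Z j \<le> ZZ" if "j \<le> J" for j
    unfolding ZZ_def using Z that by (intro member_le_sum) auto
  have ZZ0: "0 \<le> ZZ" unfolding ZZ_def using Z by (intro sum_nonneg) auto
  have main: "\<bar>dd f j (x + w) w\<bar> \<le> C * ZZ * D / s1 * (dd f 1 (x + w) w - dd f 1 x w)"
    if x: "x \<in> ball a (s1 * q)" and w: "norm w \<le> s1 * q" and j: "2 \<le> j" "j \<le> J" for x w j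
  proof -
    define w' where "w' = (1 / s1) *\<^sub>R w"
    have w_eq: "w = s1 *\<^sub>R w'" using s1 by (simp add: w'_def)
    have w': "norm w' \<le> q" using w s1 by (simp add: w'_def field_simps)
    have sq: "s1 * q \<le> q" using s1 q by simp
    have xq: "x \<in> ball a q" using x sq by auto
    then have xr: "x \<in> ball a r" "norm w' \<le> r" using q w' by auto
    have inU: "x + s *\<^sub>R w' \<in> U" if "\<bar>s\<bar> \<le> 1" for s
    proof -
      have "norm (x + s *\<^sub>R w' - a) \<le> norm (x - a) + norm (s *\<^sub>R w')"
        using norm_triangle_ineq[of "x - a" "s *\<^sub>R w'"] by (simp add: algebra_simps)
      also have "norm (s *\<^sub>R w') \<le> 1 * q" unfolding norm_scaleR using that w' q by (intro mult_mono) auto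
      also have "norm (x - a) < q" using xq by (simp add: dist_norm norm_minus_commute)
      finally have "x + s *\<^sub>R w' \<in> ball a R" using q by (simp add: dist_norm norm_minus_commute)
      then show ?thesis using R by blast
    qed
    let ?b = "b x w'"
    have ser: "(\<lambda>k. ?b k * s ^ k) sums f (x + s *\<^sub>R w')" if "\<bar>s\<bar> < 1" for s
      using b xr that by auto
    have bb: "\<forall>k\<ge>2. \<bar>?b k\<bar> \<le> C * (\<Sum>l=2..N. \<bar>?b l\<bar>)" using b xr by blast
    define M where "M = (\<Sum>l=2..N. \<bar>?b l\<bar>)"
    have M: "0 \<le> M" unfolding M_def by (rule sum_nonneg) simp
    have dser: "(\<lambda>k. (diffs ^^ j) ?b k * s ^ k) sums dd f j (x + s *\<^sub>R w') w'" if "\<bar>s\<bar> < 1" for s j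
      using power_series_derivs[OF ser that, of j] by (simp add: dd_shift)
    have "M \<le> D * (dd f 1 (x + s1 *\<^sub>R w') w' - dd f 1 (x + 0 *\<^sub>R w') w')"
      unfolding M_def
    proof (rule core[rule_format, of ?b "\<lambda>s. dd f 1 (x + s *\<^sub>R w') w'"])
      show "\<bar>?b k\<bar> \<le> C * (\<Sum>l=2..N. \<bar>?b l\<bar>)" if "k \<ge> 2" for k using bb that by blast
      show "(\<lambda>k. diffs ?b k * s ^ k) sums dd f 1 (x + s *\<^sub>R w') w'" if "\<bar>s\<bar> < 1" for s
        using dser[OF that, of 1] by simp
      show "dd f 1 (x + 0 *\<^sub>R w') w' \<le> dd f 1 (x + s *\<^sub>R w') w' \<and> dd f 1 (x + s *\<^sub>R w') w' \<le> dd f 1 (x + s1 *\<^sub>R w') w'"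
        if "0 \<le> s" "s \<le> s1" for s
        using that s1 by (intro conjI dd_mono_line inU) auto
    qed
    then have MD: "M \<le> D * (dd f 1 (x + w) w' - dd f 1 x w')" by (simp add: w_eq)
    have "\<bar>dd f j (x + s1 *\<^sub>R w') w'\<bar> \<le> C * M * Z j"
    proof -
      have le: "norm ((diffs ^^ j) ?b k * s1 ^ k) \<le> C * M * (diffs_one j k * (1 / 2) ^ k)" for k
      proof -
        have "\<bar>?b (k + j)\<bar> \<le> C * M" using bb j by (simp add: M_def)
        then have "diffs_one j k * \<bar>?b (k + j)\<bar> * s1 ^ k \<le> diffs_one j k * (C * M) * (1 / 2) ^ k"
          using s1 diffs_one_nonneg C M by (intro mult_mono power_mono mult_nonneg_nonneg) auto
        then show ?thesis using s1 by (simp add: diffs_funpow abs_mult diffs_one_nonneg mult_ac)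
      qed
      have "\<bar>s1\<bar> < 1" using s1 by simp
      from dser[OF this, of j] norm_suminf_le[OF le summable_mult[OF Zs]] suminf_mult[OF Zs]
      show ?thesis by (simp add: sums_iff Z_def)
    qed
    also have "\<dots> \<le> C * (D * (dd f 1 (x + w) w' - dd f 1 x w')) * ZZ"
      using MD ZZ[OF j(2)] C M Z[of j] order_trans[OF M MD] by (intro mult_mono) auto
    finally have fin: "\<bar>dd f j (x + w) w'\<bar> \<le> C * ZZ * D * (dd f 1 (x + w) w' - dd f 1 x w')"
      by (simp add: w_eq mult_ac)
    have xU: "x \<in> U" "x + w \<in> U" using inU[of 0] inU[of s1] s1 by (auto simp: w_eq)
    have s1j: "s1 ^ j \<le> 1" using s1 by (intro power_le_one) auto
    have "\<bar>dd f j (x + w) w\<bar> = s1 ^ j * \<bar>dd f j (x + w) w'\<bar>"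
      using dd_scale[OF xU(2), of j s1 w'] s1 by (simp add: w_eq abs_mult)
    also have "\<dots> \<le> 1 * \<bar>dd f j (x + w) w'\<bar>" using s1j by (rule mult_right_mono) simp
    also have "\<dots> \<le> C * ZZ * D * (dd f 1 (x + w) w' - dd f 1 x w')" using fin by simp
    also have "\<dots> = C * ZZ * D / s1 * (dd f 1 (x + w) w - dd f 1 x w)"
      using dd_scale[OF xU(2), of 1 "1 / s1" w] dd_scale[OF xU(1), of 1 "1 / s1" w]
      by (simp add: w'_def[symmetric] algebra_simps diff_divide_distrib)
    finally show ?thesis .
  qed
  have "0 \<le> C * ZZ * D / s1" using C ZZ0 D s1 by simp
  moreover have "0 < s1 * q" using s1 q by simp
  ultimately show ?thesis
    using main by (intro exI[of _ "s1 * q"] exI[of _ "C * ZZ * D / s1"] conjI ballI allI impI) auto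
qed

text \<open>A finite cover by the local balls settles segments of length at most
  \<open>\<delta>0\<close>. For longer ones, shrinking the direction by a factor
  \<open>\<theta>\<close> costs powers of \<open>\<theta>\<close> by homogeneity, and
  \<open>\<theta>\<close> is bounded below because \<open>K\<close> is bounded.\<close>

proposition derivative_bound:
  assumes K: "compact K" "convex K" "K \<subseteq> U"
  shows "\<exists>D\<ge>0. \<forall>x w. x \<in> K \<longrightarrow> x + w \<in> K \<longrightarrow>
           (\<forall>j\<in>{2..J}. \<bar>dd f j (x + w) w\<bar> \<le> D * (dd f 1 (x + w) w - dd f 1 x w))"
proof (cases "K = {}")
  case False
  have "\<forall>a\<in>K. \<exists>\<delta> D. 0 < \<delta> \<and> 0 \<le> D \<and> (\<forall>x\<in>ball a \<delta>. \<forall>w. norm w \<le> \<delta> \<longrightarrow>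
           (\<forall>j\<in>{2..J}. \<bar>dd f j (x + w) w\<bar> \<le> D * (dd f 1 (x + w) w - dd f 1 x w)))"
    using local_derivative_bound K(3) by (meson subsetD)
  then obtain \<delta> D where \<delta>: "\<And>a. a \<in> K \<Longrightarrow> 0 < \<delta> a" and D: "\<And>a. a \<in> K \<Longrightarrow> 0 \<le> D a"
    and loc: "\<And>a x w j. a \<in> K \<Longrightarrow> x \<in> ball a (\<delta> a) \<Longrightarrow> norm w \<le> \<delta> a \<Longrightarrow> j \<in> {2..J} \<Longrightarrow>
        \<bar>dd f j (x + w) w\<bar> \<le> D a * (dd f 1 (x + w) w - dd f 1 x w)"
    by (metis (no_types, lifting))
  have "K \<subseteq> (\<Union>a\<in>K. ball a (\<delta> a))" using \<delta> by auto
  then obtain A where A: "A \<subseteq> K" "finite A" "K \<subseteq> (\<Union>a\<in>A. ball a (\<delta> a))"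
    using compactE_image[OF K(1), of K "\<lambda>a. ball a (\<delta> a)"] by auto
  have Ane: "A \<noteq> {}" using A(3) False by auto
  define \<delta>0 where "\<delta>0 = Min (\<delta> ` A)"
  have \<delta>0: "0 < \<delta>0" "\<And>a. a \<in> A \<Longrightarrow> \<delta>0 \<le> \<delta> a"
    using A \<delta> Ane by (auto simp: \<delta>0_def)
  define D0 where "D0 = (\<Sum>a\<in>A. D a)"
  have D0: "0 \<le> D0" "\<And>a. a \<in> A \<Longrightarrow> D a \<le> D0"
    unfolding D0_def using A D by (auto intro!: sum_nonneg member_le_sum)
  have near: "\<bar>dd f j (x + w) w\<bar> \<le> D0 * (dd f 1 (x + w) w - dd f 1 x w)"
    if xw: "x \<in> K" "x + w \<in> U" "norm w \<le> \<delta>0" "j \<in> {2..J}" for x w j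
  proof -
    obtain a where a: "a \<in> A" "x \<in> ball a (\<delta> a)" using A(3) xw(1) by blast
    have "\<bar>dd f j (x + w) w\<bar> \<le> D a * (dd f 1 (x + w) w - dd f 1 x w)"
      using a A(1) xw \<delta>0(2)[OF a(1)] by (intro loc) auto
    also have "\<dots> \<le> D0 * (dd f 1 (x + w) w - dd f 1 x w)"
      using D0(2)[OF a(1)] dd_mono[of x w] xw K(3) by (intro mult_right_mono) auto
    finally show ?thesis .
  qed
  obtain B where B: "\<And>x. x \<in> K \<Longrightarrow> norm x \<le> B" using compact_imp_bounded[OF K(1)] by (auto simp: bounded_iff)
  \<comment> \<open>Differences of points of \<open>K\<close> have norm at most
    \<open>2 * B\<close>, hence \<open>1 \<le> \<Lambda> * \<theta>\<close> below; the added 1 makes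
    \<open>\<Lambda> \<ge> 1\<close>, so that its powers increase.\<close>
  define \<Lambda> where "\<Lambda> = 2 * B / \<delta>0 + 1"
  have B0: "0 \<le> B" using B False norm_ge_zero order_trans by (metis all_not_in_conv)
  have \<Lambda>: "1 \<le> \<Lambda>" using B0 \<delta>0(1) by (simp add: \<Lambda>_def)
  \<comment> \<open>only the last piece of length \<open>\<delta>0\<close> of a long segment is used; the increment of the derivative
    over it is at most the increment over the whole segment\<close>
  have far: "\<bar>dd f j (x + w) w\<bar> \<le> D0 * \<Lambda> ^ J * (dd f 1 (x + w) w - dd f 1 x w)"
    if xw: "x \<in> K" "x + w \<in> K" and j: "j \<in> {2..J}" for x w j
  proof -
    have U: "x \<in> U" "x + w \<in> U" using xw K(3) by auto
    define E where "E = dd f 1 (x + w) w - dd f 1 x w"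
    have E: "0 \<le> E" using dd_mono[OF U] by (simp add: E_def)
    have \<Lambda>J: "1 \<le> \<Lambda> ^ J" using \<Lambda> by (rule one_le_power)
    show ?thesis
    proof (cases "norm w \<le> \<delta>0")
      case True
      have "\<bar>dd f j (x + w) w\<bar> \<le> D0 * 1 * E" using near[OF xw(1) U(2) True j] by (simp add: E_def)
      also have "\<dots> \<le> D0 * \<Lambda> ^ J * E" using D0(1) E \<Lambda>J by (intro mult_right_mono mult_left_mono)
      finally show ?thesis by (simp add: E_def)
    next
      case False
      define \<theta> where "\<theta> = \<delta>0 / norm w"
      have nw: "0 < norm w" using False \<delta>0(1) by linarith
      have \<theta>: "0 < \<theta>" "\<theta> < 1" using False \<delta>0(1) nw by (auto simp: \<theta>_def)
      define z where "z = x + (1 - \<theta>) *\<^sub>R w"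
      have zeq: "z = \<theta> *\<^sub>R x + (1 - \<theta>) *\<^sub>R (x + w)" by (simp add: z_def algebra_simps)
      have z: "z \<in> K" unfolding zeq using K(2) xw \<theta> by (intro convexD) auto
      then have zU: "z \<in> U" using K(3) by blast
      have zw: "z + \<theta> *\<^sub>R w = x + w" by (simp add: z_def algebra_simps)
      have "norm (\<theta> *\<^sub>R w) \<le> \<delta>0" using nw \<delta>0(1) by (simp add: \<theta>_def)
      from near[OF z _ this j] U zw
      have "\<bar>dd f j (x + w) (\<theta> *\<^sub>R w)\<bar> \<le> D0 * (dd f 1 (x + w) (\<theta> *\<^sub>R w) - dd f 1 z (\<theta> *\<^sub>R w))" by simp
      then have "\<bar>\<theta> ^ j * dd f j (x + w) w\<bar> \<le> D0 * (\<theta> ^ 1 * dd f 1 (x + w) w - \<theta> ^ 1 * dd f 1 z w)"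
        unfolding dd_scale[OF U(2)] dd_scale[OF zU] .
      then have "\<theta> ^ j * \<bar>dd f j (x + w) w\<bar> \<le> \<theta> * (D0 * (dd f 1 (x + w) w - dd f 1 z w))"
        using \<theta> by (simp add: abs_mult algebra_simps)
      also have "\<dots> \<le> \<theta> * (D0 * E)"
        using dd_mono_line[of x 0 w "1 - \<theta>"] U zU \<theta> D0(1)
        by (intro mult_left_mono) (auto simp: E_def z_def)
      also have "\<dots> \<le> 1 * (D0 * E)" using \<theta> D0(1) E by (intro mult_right_mono) auto
      finally have 1: "\<theta> ^ j * \<bar>dd f j (x + w) w\<bar> \<le> D0 * E" by simp
      have "norm w \<le> norm (x + w) + norm x" using norm_triangle_ineq4[of "x + w" x] by simp
      also have "\<dots> \<le> 2 * B" using B[OF xw(1)] B[OF xw(2)] by simp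
      finally have "1 \<le> (2 * B + \<delta>0) / norm w" using nw \<delta>0(1) by (simp add: pos_le_divide_eq)
      also have "\<dots> = \<Lambda> * \<theta>" using nw \<delta>0(1) by (simp add: \<theta>_def \<Lambda>_def field_simps)
      finally have "1 \<le> \<Lambda> * \<theta>" .
      then have "1 \<le> (\<Lambda> * \<theta>) ^ j" by (rule one_le_power)
      then have "\<bar>dd f j (x + w) w\<bar> \<le> (\<Lambda> * \<theta>) ^ j * \<bar>dd f j (x + w) w\<bar>"
        using mult_right_mono[of 1 "(\<Lambda> * \<theta>) ^ j" "\<bar>dd f j (x + w) w\<bar>"] by simp
      also have "\<dots> = \<Lambda> ^ j * (\<theta> ^ j * \<bar>dd f j (x + w) w\<bar>)" by (simp add: power_mult_distrib)
      also have "\<dots> \<le> \<Lambda> ^ J * (D0 * E)"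
        by (rule mult_mono[OF power_increasing 1]) (use \<Lambda> j \<theta> in auto)
      finally show ?thesis by (simp add: E_def mult_ac)
    qed
  qed
  have "0 \<le> D0 * \<Lambda> ^ J" using D0(1) \<Lambda> by simp
  then show ?thesis using far by (intro exI[of _ "D0 * \<Lambda> ^ J"] conjI ballI allI impI) auto
qed auto

text \<open>By midpoint convexity the function \<open>\<phi>\<close> of the proof is minimal at \<open>0\<close>, so its derivative vanishes there.\<close>

lemma dd_add:
  assumes "y \<in> U"
  shows "dd f 1 y (v + w) = dd f 1 y v + dd f 1 y w"
proof -
  obtain R where R: "0 < R" "ball y R \<subseteq> U" using open_U assms by (meson open_contains_ball)
  define S where "S = norm v + norm w + 1"
  define \<epsilon> where "\<epsilon> = R / (2 * S)"
  have S: "0 < S" by (simp add: S_def add_nonneg_pos)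
  have \<epsilon>: "0 < \<epsilon>" using R S by (simp add: \<epsilon>_def)
  define \<phi> where "\<phi> s = (f (y + s *\<^sub>R (2 *\<^sub>R v)) + f (y + s *\<^sub>R (2 *\<^sub>R w))) / 2 - f (y + s *\<^sub>R (v + w))" for s
  have mem: "y + s *\<^sub>R (2 *\<^sub>R u) \<in> U" if "\<bar>s\<bar> < \<epsilon>" "norm u \<le> S" for s u
  proof -
    have "norm (s *\<^sub>R (2 *\<^sub>R u)) = 2 * \<bar>s\<bar> * norm u" by (simp add: abs_mult)
    also have "\<dots> \<le> 2 * \<bar>s\<bar> * S" using that by (intro mult_left_mono) auto
    also have "\<dots> < 2 * \<epsilon> * S" using that S by simp
    also have "\<dots> = R" using S by (simp add: \<epsilon>_def)
    finally show ?thesis using R(2) by (auto simp: dist_norm)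
  qed
  have "\<phi> 0 \<le> \<phi> s" if s: "\<bar>0 - s\<bar> < \<epsilon>" for s
  proof -
    have 1: "y + s *\<^sub>R (2 *\<^sub>R v) \<in> U" "y + s *\<^sub>R (2 *\<^sub>R w) \<in> U"
      by (rule mem; use s in \<open>simp add: S_def\<close>)+
    have "f ((1 - 1 / 2) *\<^sub>R (y + s *\<^sub>R (2 *\<^sub>R v)) + (1 / 2) *\<^sub>R (y + s *\<^sub>R (2 *\<^sub>R w))) \<le>
       (1 - 1 / 2) * f (y + s *\<^sub>R (2 *\<^sub>R v)) + 1 / 2 * f (y + s *\<^sub>R (2 *\<^sub>R w))"
      by (rule convex_onD[OF cvx]) (use 1 in auto)
    moreover have "(1 - 1 / 2) *\<^sub>R (y + s *\<^sub>R (2 *\<^sub>R v)) + (1 / 2) *\<^sub>R (y + s *\<^sub>R (2 *\<^sub>R w)) = y + s *\<^sub>R (v + w)"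
    proof -
      have "(1 / 2) *\<^sub>R y + (1 / 2) *\<^sub>R y = y" by (simp flip: scaleR_add_left)
      then show ?thesis by (simp add: algebra_simps)
    qed
    ultimately show ?thesis by (simp add: \<phi>_def)
  qed
  moreover have "(\<phi> has_real_derivative (dd f 1 y (2 *\<^sub>R v) + dd f 1 y (2 *\<^sub>R w)) / 2 - dd f 1 y (v + w)) (at 0)"
    unfolding \<phi>_def[abs_def] by (intro DERIV_diff DERIV_cdivide DERIV_add line_has_derivative0 assms)
  ultimately have "(dd f 1 y (2 *\<^sub>R v) + dd f 1 y (2 *\<^sub>R w)) / 2 - dd f 1 y (v + w) = 0"
    using \<epsilon> by (intro DERIV_local_min[of \<phi> _ 0 \<epsilon>]) auto
  then show ?thesis by (simp add: dd_scale[OF assms])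
qed

end

section \<open>Non-stationary phase in one variable\<close>

text \<open>Symbol estimates: \<open>symb I k C W u\<close> bounds the derivatives of order \<open>i \<le> k\<close> by \<open>C * W \<rho> / \<rho> ^ i\<close>.\<close>

primrec symb :: "real set \<Rightarrow> nat \<Rightarrow> real \<Rightarrow> (real \<Rightarrow> real) \<Rightarrow> (real \<Rightarrow> real) \<Rightarrow> bool" where
  "symb I 0 C W u \<longleftrightarrow> (\<forall>\<rho>\<in>I. \<bar>u \<rho>\<bar> \<le> C * W \<rho>)"
| "symb I (Suc k) C W u \<longleftrightarrow> (\<forall>\<rho>\<in>I. \<bar>u \<rho>\<bar> \<le> C * W \<rho> \<and> u differentiable (at \<rho>)) \<and>
     symb I k C (\<lambda>\<rho>. W \<rho> / \<rho>) (deriv u)"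

lemma symb_bound: "symb I k C W u \<Longrightarrow> \<rho> \<in> I \<Longrightarrow> \<bar>u \<rho>\<bar> \<le> C * W \<rho>"
  by (cases k) auto

lemma symb_Suc_D: "symb I (Suc k) C W u \<Longrightarrow> symb I k C W u"
proof (induction k arbitrary: W u)
  case (Suc k)
  then show ?case using Suc.IH[of "\<lambda>\<rho>. W \<rho> / \<rho>" "deriv u"] by auto
qed simp

lemma symb_le: "symb I k C W u \<Longrightarrow> l \<le> k \<Longrightarrow> symb I l C W u"
proof (induction k)
  case (Suc k)
  then show ?case using symb_Suc_D[OF Suc.prems(1)] by (cases "l = Suc k") auto
qed simp

lemma symb_mono:
  assumes "symb I k C W u" "C \<le> C'" "\<And>\<rho>. \<rho> \<in> I \<Longrightarrow> 0 \<le> W \<rho>" "I \<subseteq> {0<..}"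
  shows "symb I k C' W u"
  using assms
proof (induction k arbitrary: W u)
  case 0
  then show ?case using mult_right_mono[OF 0(2)] by (fastforce intro: order_trans)
next
  case (Suc k)
  have "\<bar>u \<rho>\<bar> \<le> C' * W \<rho>" if "\<rho> \<in> I" for \<rho>
    using mult_right_mono[OF Suc.prems(2) Suc.prems(3)[OF that]] symb_bound[OF Suc.prems(1) that] by linarith
  moreover have "symb I k C' (\<lambda>\<rho>. W \<rho> / \<rho>) (deriv u)"
    using Suc.prems by (intro Suc.IH) (auto intro!: divide_nonneg_pos)
  ultimately show ?case using Suc.prems(1) by auto
qed

lemma deriv_cong_on:
  fixes u v :: "real \<Rightarrow> real"
  assumes "open I" "\<rho> \<in> I" "\<And>\<rho>. \<rho> \<in> I \<Longrightarrow> u \<rho> = v \<rho>"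
  shows "deriv u \<rho> = deriv v \<rho>" and "u differentiable (at \<rho>) \<longleftrightarrow> v differentiable (at \<rho>)"
proof -
  have ev: "eventually (\<lambda>x. u x = v x) (nhds \<rho>)"
    using assms by (auto simp: eventually_nhds)
  then show "deriv u \<rho> = deriv v \<rho>" by (rule deriv_cong_ev) simp
  have "(u has_real_derivative D) (at \<rho>) \<longleftrightarrow> (v has_real_derivative D) (at \<rho>)" for D
    using ev by (intro DERIV_cong_ev) auto
  then show "u differentiable (at \<rho>) \<longleftrightarrow> v differentiable (at \<rho>)"
    unfolding real_differentiable_def by simp
qed

lemma symb_cong:
  assumes "open I" "\<And>\<rho>. \<rho> \<in> I \<Longrightarrow> u \<rho> = v \<rho>" "\<And>\<rho>. \<rho> \<in> I \<Longrightarrow> W \<rho> = V \<rho>"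
  shows "symb I k C W u \<longleftrightarrow> symb I k C V v"
  using assms(2,3)
proof (induction k arbitrary: W V u v)
  case (Suc k)
  have "symb I k C (\<lambda>\<rho>. W \<rho> / \<rho>) (deriv u) \<longleftrightarrow> symb I k C (\<lambda>\<rho>. V \<rho> / \<rho>) (deriv v)"
    by (rule Suc.IH) (use Suc.prems(2) in \<open>auto intro: deriv_cong_on(1)[OF assms(1)] Suc.prems(1)\<close>)
  moreover have "(\<bar>u \<rho>\<bar> \<le> C * W \<rho> \<and> u differentiable (at \<rho>)) \<longleftrightarrow> (\<bar>v \<rho>\<bar> \<le> C * V \<rho> \<and> v differentiable (at \<rho>))"
    if "\<rho> \<in> I" for \<rho>
  proof -
    have "u differentiable (at \<rho>) \<longleftrightarrow> v differentiable (at \<rho>)"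
      by (rule deriv_cong_on(2)[OF assms(1) that]) (rule Suc.prems(1))
    then show ?thesis unfolding Suc.prems(1)[OF that] Suc.prems(2)[OF that] by blast
  qed
  ultimately show ?case by auto
qed simp

lemma symb_add:
  assumes "open I" "symb I k C W u" "symb I k D W v"
  shows "symb I k (C + D) W (\<lambda>\<rho>. u \<rho> + v \<rho>)"
  using assms(2,3)
proof (induction k arbitrary: W u v)
  case 0
  then show ?case by (fastforce simp: distrib_right)
next
  case (Suc k)
  have "symb I k (C + D) (\<lambda>\<rho>. W \<rho> / \<rho>) (\<lambda>\<rho>. deriv u \<rho> + deriv v \<rho>)"
    using Suc by auto
  also have "?this \<longleftrightarrow> symb I k (C + D) (\<lambda>\<rho>. W \<rho> / \<rho>) (deriv (\<lambda>\<rho>. u \<rho> + v \<rho>))"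
    using Suc.prems by (intro symb_cong[OF assms(1)]) (auto simp: real_differentiable_def DERIV_imp_deriv
      intro!: DERIV_imp_deriv[symmetric] derivative_eq_intros)
  finally show ?case using Suc.prems by (fastforce simp: distrib_right)
qed

text \<open>Leibniz rule: every differentiation doubles the number of terms, whence
  \<open>2 ^ k\<close>.\<close>

lemma symb_mult:
  assumes "open I" "I \<subseteq> {0<..}" "symb I k C W u" "symb I k D V v"
     "\<And>\<rho>. \<rho> \<in> I \<Longrightarrow> 0 \<le> W \<rho>" "\<And>\<rho>. \<rho> \<in> I \<Longrightarrow> 0 \<le> V \<rho>" "0 \<le> C" "0 \<le> D"
  shows "symb I k (2 ^ k * C * D) (\<lambda>\<rho>. W \<rho> * V \<rho>) (\<lambda>\<rho>. u \<rho> * v \<rho>)"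
  using assms(3-6)
proof (induction k arbitrary: W V u v)
  case 0
  have "\<bar>u \<rho> * v \<rho>\<bar> \<le> C * D * (W \<rho> * V \<rho>)" if "\<rho> \<in> I" for \<rho>
  proof -
    have "\<bar>u \<rho>\<bar> * \<bar>v \<rho>\<bar> \<le> (C * W \<rho>) * (D * V \<rho>)"
      using 0 that assms(7,8) by (intro mult_mono) auto
    then show ?thesis by (simp add: abs_mult mult_ac)
  qed
  then show ?case by simp
next
  case (Suc k)
  have pos: "\<rho> > 0" if "\<rho> \<in> I" for \<rho> using assms(2) that by auto
  have du: "(u has_real_derivative deriv u \<rho>) (at \<rho>)" "(v has_real_derivative deriv v \<rho>) (at \<rho>)" if "\<rho> \<in> I" for \<rho>
    using Suc.prems(1,2) that by (auto simp: DERIV_deriv_iff_real_differentiable)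
  have duv: "((\<lambda>\<rho>. u \<rho> * v \<rho>) has_real_derivative deriv u \<rho> * v \<rho> + u \<rho> * deriv v \<rho>) (at \<rho>)" if "\<rho> \<in> I" for \<rho>
    using du[OF that] by (auto intro!: derivative_eq_intros)
  have 1: "symb I k (2 ^ k * C * D) (\<lambda>\<rho>. W \<rho> / \<rho> * V \<rho>) (\<lambda>\<rho>. deriv u \<rho> * v \<rho>)"
    using Suc.prems pos by (intro Suc.IH) (auto intro!: symb_Suc_D[of I k D V v] divide_nonneg_pos)
  have 2: "symb I k (2 ^ k * C * D) (\<lambda>\<rho>. W \<rho> * (V \<rho> / \<rho>)) (\<lambda>\<rho>. u \<rho> * deriv v \<rho>)"
    using Suc.prems pos by (intro Suc.IH) (auto intro!: symb_Suc_D[of I k C W u] divide_nonneg_pos)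
  have "symb I k (2 ^ k * C * D + 2 ^ k * C * D) (\<lambda>\<rho>. W \<rho> * V \<rho> / \<rho>) (\<lambda>\<rho>. deriv u \<rho> * v \<rho> + u \<rho> * deriv v \<rho>)"
    using 1 2 by (intro symb_add[OF assms(1)]) simp_all
  also have "?this \<longleftrightarrow> symb I k (2 ^ k * C * D + 2 ^ k * C * D) (\<lambda>\<rho>. W \<rho> * V \<rho> / \<rho>) (deriv (\<lambda>\<rho>. u \<rho> * v \<rho>))"
    by (intro symb_cong[OF assms(1)]) (auto intro!: DERIV_imp_deriv[symmetric] duv)
  finally have 3: "symb I k (2 ^ Suc k * C * D) (\<lambda>\<rho>. W \<rho> * V \<rho> / \<rho>) (deriv (\<lambda>\<rho>. u \<rho> * v \<rho>))"
    by (simp add: mult_ac)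
  have "\<bar>u \<rho> * v \<rho>\<bar> \<le> 2 ^ Suc k * C * D * (W \<rho> * V \<rho>)" if "\<rho> \<in> I" for \<rho>
  proof -
    have "\<bar>u \<rho>\<bar> * \<bar>v \<rho>\<bar> \<le> (C * W \<rho>) * (D * V \<rho>)"
      using Suc.prems that assms(7,8) by (intro mult_mono) auto
    also have "\<dots> \<le> 2 ^ Suc k * ((C * W \<rho>) * (D * V \<rho>))"
    proof -
      have "0 \<le> (C * W \<rho>) * (D * V \<rho>)" using Suc.prems that assms(7,8) by simp
      moreover have "(1::real) \<le> 2 ^ Suc k" by (rule one_le_power) simp
      ultimately show ?thesis using mult_right_mono by fastforce
    qed
    finally show ?thesis by (simp add: abs_mult mult_ac)
  qed
  moreover have "(\<lambda>\<rho>. u \<rho> * v \<rho>) differentiable (at \<rho>)" if "\<rho> \<in> I" for \<rho>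
    using duv[OF that] unfolding real_differentiable_def by blast
  ultimately show ?case using 3 by simp
qed

lemma symb_zero:
  assumes "I \<subseteq> {0<..}" "\<And>\<rho>. \<rho> \<in> I \<Longrightarrow> 0 \<le> W \<rho>" "0 \<le> C"
  shows "symb I k C W (\<lambda>_. 0)"
  using assms(2)
proof (induction k arbitrary: W)
  case (Suc k)
  have "symb I k C (\<lambda>\<rho>. W \<rho> / \<rho>) (\<lambda>_. 0)"
    using Suc.prems assms(1) by (intro Suc.IH) (auto intro!: divide_nonneg_pos)
  then show ?case using Suc.prems assms(3) by simp
qed (use assms in auto)

lemma symb_const:
  assumes "I \<subseteq> {0<..}"
  shows "symb I k \<bar>c\<bar> (\<lambda>_. 1) (\<lambda>_. c)"
proof (cases k)
  case (Suc l)
  have "symb I l \<bar>c\<bar> (\<lambda>\<rho>. 1 / \<rho>) (\<lambda>_. 0)"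
    using assms by (intro symb_zero) auto
  then show ?thesis by (simp add: Suc)
qed auto

lemma symb_ident:
  assumes "open I" "I \<subseteq> {0<..}"
  shows "symb I k 1 (\<lambda>\<rho>. \<rho>) (\<lambda>\<rho>. \<rho>)"
proof (cases k)
  case (Suc l)
  have "symb I l 1 (\<lambda>_. 1) (\<lambda>_. 1)"
    using symb_const[OF assms(2), of l 1] by simp
  also have "?this \<longleftrightarrow> symb I l 1 (\<lambda>\<rho>. \<rho> / \<rho>) (\<lambda>_. 1)"
    using assms by (intro symb_cong) auto
  finally show ?thesis using assms by (auto simp: Suc)
qed (use assms in auto)

lemma symb_power:
  assumes "open I" "I \<subseteq> {0<..}"
  shows "symb I k (2 ^ (k * m)) (\<lambda>\<rho>. \<rho> ^ m) (\<lambda>\<rho>. \<rho> ^ m)"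
proof (induction m)
  case 0
  then show ?case using symb_const[OF assms(2), of k 1] by simp
next
  case (Suc m)
  have "symb I k (2 ^ k * 1 * 2 ^ (k * m)) (\<lambda>\<rho>. \<rho> * \<rho> ^ m) (\<lambda>\<rho>. \<rho> * \<rho> ^ m)"
    using assms Suc by (intro symb_mult symb_ident) (auto intro: less_imp_le)
  then show ?case by (simp add: power_add)
qed

text \<open>Induction on the order through (1 / p)' = - p' (1 / p)^2: the weight p / \<rho> of p'
  times 1 / p^2 is the weight of 1 / p divided by \<rho>. The constant is fixed before
  \<open>I\<close> and \<open>p\<close>, so it is uniform over all phases.\<close>

lemma symb_inverse:
  assumes "0 \<le> C"
  shows "\<exists>D\<ge>0. \<forall>I p. open I \<longrightarrow> I \<subseteq> {0<..} \<longrightarrow> (\<forall>\<rho>\<in>I. 0 < p \<rho>) \<longrightarrow> symb I k C p p \<longrightarrow>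
           symb I k D (\<lambda>\<rho>. 1 / p \<rho>) (\<lambda>\<rho>. 1 / p \<rho>)"
proof (induction k)
  case 0
  show ?case by (intro exI[of _ 1]) auto
next
  case (Suc k)
  then obtain D where D0: "0 \<le> D" "\<forall>I p. open I \<longrightarrow> I \<subseteq> {0<..} \<longrightarrow> (\<forall>\<rho>\<in>I. 0 < p \<rho>) \<longrightarrow> symb I k C p p \<longrightarrow>
           symb I k D (\<lambda>\<rho>. 1 / p \<rho>) (\<lambda>\<rho>. 1 / p \<rho>)"
    by (elim exE conjE)
  have D: "D \<ge> 0" "\<And>I p. open I \<Longrightarrow> I \<subseteq> {0<..} \<Longrightarrow> (\<And>\<rho>. \<rho>\<in>I \<Longrightarrow> 0 < p \<rho>) \<Longrightarrow> symb I k C p p \<Longrightarrow>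
           symb I k D (\<lambda>\<rho>. 1 / p \<rho>) (\<lambda>\<rho>. 1 / p \<rho>)"
    using D0 by auto
  define D' where "D' = 2 ^ k * (2 ^ k * 1 * C) * (2 ^ k * D * D) + 1"
  have D': "D' \<ge> 1" using assms D(1) by (simp add: D'_def)
  have "symb I (Suc k) D' (\<lambda>\<rho>. 1 / p \<rho>) (\<lambda>\<rho>. 1 / p \<rho>)"
    if I: "open I" "I \<subseteq> {0<..}" and p: "\<And>\<rho>. \<rho> \<in> I \<Longrightarrow> 0 < p \<rho>" and s: "symb I (Suc k) C p p" for I p
  proof -
    have pos: "\<rho> > 0" if "\<rho> \<in> I" for \<rho> using I that by auto
    have dp: "(p has_real_derivative deriv p \<rho>) (at \<rho>)" if "\<rho> \<in> I" for \<rho>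
      using s that by (auto simp: DERIV_deriv_iff_real_differentiable)
    have dv: "((\<lambda>\<rho>. 1 / p \<rho>) has_real_derivative - 1 * deriv p \<rho> * (1 / p \<rho> * (1 / p \<rho>))) (at \<rho>)" if "\<rho> \<in> I" for \<rho>
      using dp[OF that] p[OF that] by (auto intro!: derivative_eq_intros simp: power2_eq_square)
    have v: "symb I k D (\<lambda>\<rho>. 1 / p \<rho>) (\<lambda>\<rho>. 1 / p \<rho>)"
      using I p symb_Suc_D[OF s] by (intro D(2)) auto
    have vv: "symb I k (2 ^ k * D * D) (\<lambda>\<rho>. 1 / p \<rho> * (1 / p \<rho>)) (\<lambda>\<rho>. 1 / p \<rho> * (1 / p \<rho>))"
      using I p v D(1) by (intro symb_mult) (auto intro: less_imp_le)
    have "symb I k \<bar>-1\<bar> (\<lambda>_. 1) (\<lambda>_. -1)" by (rule symb_const[OF I(2)])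
    then have m1: "symb I k (2 ^ k * 1 * C) (\<lambda>\<rho>. 1 * (p \<rho> / \<rho>)) (\<lambda>\<rho>. - 1 * deriv p \<rho>)"
      using I s p pos assms by (intro symb_mult) (auto intro!: less_imp_le)
    have "symb I k (2 ^ k * (2 ^ k * 1 * C) * (2 ^ k * D * D))
       (\<lambda>\<rho>. 1 * (p \<rho> / \<rho>) * (1 / p \<rho> * (1 / p \<rho>))) (\<lambda>\<rho>. - 1 * deriv p \<rho> * (1 / p \<rho> * (1 / p \<rho>)))"
      using p pos D(1) assms by (intro symb_mult[OF I m1 vv]) (auto intro!: less_imp_le)
    also have "?this \<longleftrightarrow> symb I k (2 ^ k * (2 ^ k * 1 * C) * (2 ^ k * D * D))
       (\<lambda>\<rho>. 1 / p \<rho> / \<rho>) (deriv (\<lambda>\<rho>. 1 / p \<rho>))"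
      using p pos by (intro symb_cong[OF I(1)] DERIV_imp_deriv[symmetric] dv) (auto simp: less_imp_neq[symmetric])
    finally have dv': "symb I k (2 ^ k * (2 ^ k * 1 * C) * (2 ^ k * D * D))
       (\<lambda>\<rho>. 1 / p \<rho> / \<rho>) (deriv (\<lambda>\<rho>. 1 / p \<rho>))" .
    have "symb I k D' (\<lambda>\<rho>. 1 / p \<rho> / \<rho>) (deriv (\<lambda>\<rho>. 1 / p \<rho>))"
      using p pos by (intro symb_mono[OF dv' _ _ I(2)]) (auto simp: D'_def intro!: divide_nonneg_pos less_imp_le)
    moreover have "\<bar>1 / p \<rho>\<bar> \<le> D' * (1 / p \<rho>)" if "\<rho> \<in> I" for \<rho>
      using p[OF that] D' by (simp add: divide_right_mono)
    moreover have "(\<lambda>\<rho>. 1 / p \<rho>) differentiable (at \<rho>)" if "\<rho> \<in> I" for \<rho>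
      using dv[OF that] unfolding real_differentiable_def by blast
    ultimately show ?thesis by simp
  qed
  then show ?case using D' by (intro exI[of _ D']) auto
qed

definition osc :: "(real \<Rightarrow> real) \<Rightarrow> (real \<Rightarrow> real) \<Rightarrow> real \<Rightarrow> complex" where
  "osc h u \<rho> = cis (- h \<rho>) * of_real (u \<rho>)"

lemma norm_osc [simp]: "norm (osc h u \<rho>) = \<bar>u \<rho>\<bar>"
  by (simp add: osc_def norm_mult)

text \<open>The integrand is split into \<open>p * cis (- h)\<close>, which has an explicit
  primitive, and \<open>u / p\<close>; the boundary term at \<open>b\<close> vanishes with
  \<open>u\<close>. The fundamental theorem is applied to the derivative of the whole product, so
  integrability of the new integrand follows from that of the old one, without continuity of the
  derivative of \<open>u / p\<close>.\<close>

lemma osc_by_parts: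
  assumes Rb: "R \<le> b" "{R..b} \<subseteq> I"
    and h: "\<And>\<rho>. \<rho> \<in> I \<Longrightarrow> (h has_real_derivative p \<rho>) (at \<rho>)"
    and p: "\<And>\<rho>. \<rho> \<in> I \<Longrightarrow> 0 < p \<rho>"
    and w: "\<And>\<rho>. \<rho> \<in> I \<Longrightarrow> (\<lambda>\<rho>. u \<rho> * (1 / p \<rho>)) differentiable (at \<rho>)"
    and b: "u b = 0"
    and int: "osc h u integrable_on {R..b}"
  shows "osc h (deriv (\<lambda>\<rho>. u \<rho> * (1 / p \<rho>))) integrable_on {R..b}"
    and "norm (integral {R..b} (osc h u)) \<le>
          norm (integral {R..b} (osc h (deriv (\<lambda>\<rho>. u \<rho> * (1 / p \<rho>))))) + \<bar>u R * (1 / p R)\<bar>"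
proof -
  let ?w = "\<lambda>\<rho>. u \<rho> * (1 / p \<rho>)"
  have cis_d: "((\<lambda>\<rho>. cis (- h \<rho>)) has_vector_derivative (- p \<rho> *\<^sub>R (\<i> * cis (- h \<rho>)))) (at \<rho> within {R..b})"
    if "\<rho> \<in> {R..b}" for \<rho>
  proof -
    have 1: "((\<lambda>\<rho>. - h \<rho>) has_vector_derivative - p \<rho>) (at \<rho> within {R..b})"
      unfolding has_real_derivative_iff_has_vector_derivative[symmetric]
      using h Rb that by (intro DERIV_minus has_field_derivative_at_within[OF h]) auto
    have 2: "(cis has_vector_derivative \<i> * cis (- h \<rho>)) (at (- h \<rho>))"
    proof -
      have "((\<lambda>t. exp (of_real t * \<i>)) has_vector_derivative (exp (of_real (- h \<rho>) * \<i>) * \<i>)) (at (- h \<rho>))"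
        by (rule exp_scaleR_has_vector_derivative_right[of \<i>, unfolded scaleR_conv_of_real])
      moreover have "cis = (\<lambda>t. exp (of_real t * \<i>))" by (simp add: fun_eq_iff cis_conv_exp mult.commute)
      moreover have "cis t = exp (of_real t * \<i>)" for t by (simp add: cis_conv_exp mult.commute)
      ultimately show ?thesis by (metis mult.commute)
    qed
    show ?thesis using vector_diff_chain_within[OF 1 has_vector_derivative_at_within[OF 2]]
      by (simp add: o_def)
  qed
  have "((\<lambda>\<rho>. cis (- h \<rho>) * of_real (?w \<rho>)) has_vector_derivative
       (osc h (deriv ?w) \<rho> - \<i> * osc h u \<rho>)) (at \<rho> within {R..b})" if \<rho>: "\<rho> \<in> {R..b}" for \<rho>
  proof -
    have "\<rho> \<in> I" using \<rho> Rb by auto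
    then have "(?w has_real_derivative deriv ?w \<rho>) (at \<rho>)"
      using w[of \<rho>] unfolding DERIV_deriv_iff_real_differentiable by blast
    then have "(?w has_real_derivative deriv ?w \<rho>) (at \<rho> within {R..b})"
      by (rule has_field_derivative_at_within)
    then have "((\<lambda>\<rho>. of_real (?w \<rho>) :: complex) has_vector_derivative of_real (deriv ?w \<rho>)) (at \<rho> within {R..b})"
      by (rule has_vector_derivative_of_real)
    from has_vector_derivative_mult[OF cis_d[OF \<rho>] this]
    have *: "((\<lambda>\<rho>. cis (- h \<rho>) * of_real (?w \<rho>)) has_vector_derivative
        cis (- h \<rho>) * of_real (deriv ?w \<rho>) + (- p \<rho> *\<^sub>R (\<i> * cis (- h \<rho>))) * of_real (?w \<rho>)) (at \<rho> within {R..b})" .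
    have "cis (- h \<rho>) * of_real (deriv ?w \<rho>) + (- p \<rho> *\<^sub>R (\<i> * cis (- h \<rho>))) * of_real (?w \<rho>) =
        osc h (deriv ?w) \<rho> - \<i> * osc h u \<rho>"
      using p[OF \<open>\<rho> \<in> I\<close>] by (simp add: osc_def scaleR_conv_of_real)
    with * show ?thesis by (simp only:)
  qed
  from fundamental_theorem_of_calculus[OF Rb(1) this]
  have ftc: "((\<lambda>\<rho>. osc h (deriv ?w) \<rho> - \<i> * osc h u \<rho>) has_integral (- osc h ?w R)) {R..b}"
    using b by (simp add: osc_def)
  have iu: "((\<lambda>\<rho>. \<i> * osc h u \<rho>) has_integral \<i> * integral {R..b} (osc h u)) {R..b}"
    using int by (intro has_integral_mult_right integrable_integral)
  have "((\<lambda>\<rho>. osc h (deriv ?w) \<rho>) has_integral (- osc h ?w R + \<i> * integral {R..b} (osc h u))) {R..b}"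
    using has_integral_add[OF ftc iu] by simp
  then show int': "osc h (deriv ?w) integrable_on {R..b}"
    and "norm (integral {R..b} (osc h u)) \<le> norm (integral {R..b} (osc h (deriv ?w))) + \<bar>u R * (1 / p R)\<bar>"
  proof -
    assume *: "((\<lambda>\<rho>. osc h (deriv ?w) \<rho>) has_integral (- osc h ?w R + \<i> * integral {R..b} (osc h u))) {R..b}"
    show "osc h (deriv ?w) integrable_on {R..b}" using * by (auto simp: integrable_on_def)
    have "\<i> * integral {R..b} (osc h u) = integral {R..b} (osc h (deriv ?w)) + osc h ?w R"
      using integral_unique[OF *] by simp
    then have "norm (integral {R..b} (osc h u)) = norm (integral {R..b} (osc h (deriv ?w)) + osc h ?w R)"
      by (metis norm_mult norm_ii mult_1)
    also have "\<dots> \<le> norm (integral {R..b} (osc h (deriv ?w))) + norm (osc h ?w R)"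
      by (rule norm_triangle_ineq)
    finally show "norm (integral {R..b} (osc h u)) \<le> norm (integral {R..b} (osc h (deriv ?w))) + \<bar>u R * (1 / p R)\<bar>"
      by simp
  qed
qed

text \<open>An amplitude that vanishes on \<open>I\<close> beyond \<open>b'\<close> vanishes near
  \<open>b\<close> together with its derivatives. The gap between \<open>b'\<close> and
  \<open>b\<close> thus removes the boundary term at \<open>b\<close> in every integration by
  parts.\<close>

definition osc_setting :: "real set \<Rightarrow> (real \<Rightarrow> real) \<Rightarrow> (real \<Rightarrow> real) \<Rightarrow> real \<Rightarrow> real \<Rightarrow> real \<Rightarrow> bool" where
  "osc_setting I h p R b' b \<longleftrightarrow> open I \<and> I \<subseteq> {0<..} \<and> 0 < R \<and> R < b \<and> b' < b \<and> {R..b} \<subseteq> I \<and>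
     (\<forall>\<rho>\<in>I. (h has_real_derivative p \<rho>) (at \<rho>)) \<and> (\<forall>\<rho>\<in>I. 0 < p \<rho>) \<and> (\<forall>\<rho>\<in>{R..b}. 1 / R \<le> p \<rho>)"

text \<open>
  After \<open>j\<close> integrations by parts the amplitude has size \<open>\<rho> ^ (n - 1 - j) / p \<rho> ^ j\<close>; since \<open>p \<ge> 1 / R\<close>,
  every boundary term at \<open>R\<close> is \<open>O(R ^ n)\<close>, and after \<open>n + 1\<close> steps the amplitude is integrable.
\<close>

lemma osc_bound_aux:
  assumes "0 \<le> C" "0 \<le> D" "k + j = Suc n"
  shows "\<exists>C'\<ge>0. \<forall>I h p R b b' u. osc_setting I h p R b' b \<longrightarrow>
     symb I (Suc n) D (\<lambda>\<rho>. 1 / p \<rho>) (\<lambda>\<rho>. 1 / p \<rho>) \<longrightarrow>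
     symb I k C (\<lambda>\<rho>. \<rho> ^ n / \<rho> ^ Suc j / p \<rho> ^ j) u \<longrightarrow>
     (\<forall>\<rho>\<in>I. b' < \<rho> \<longrightarrow> u \<rho> = 0) \<longrightarrow> osc h u integrable_on {R..b} \<longrightarrow>
     norm (integral {R..b} (osc h u)) \<le> C' * R ^ n"
  using assms(1,3)
proof (induction k arbitrary: C j)
  case 0
  then have jn: "j = Suc n" by simp
  have "norm (integral {R..b} (osc h u)) \<le> C * R ^ n"
    if os: "osc_setting I h p R b' b" and s: "symb I 0 C (\<lambda>\<rho>. \<rho> ^ n / \<rho> ^ Suc j / p \<rho> ^ j) u"
      and int: "osc h u integrable_on {R..b}" for I h p R b b' u
  proof -
    have R: "0 < R" "R < b" and sub: "{R..b} \<subseteq> I" and p: "\<forall>\<rho>\<in>{R..b}. 1 / R \<le> p \<rho>"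
      using os by (auto simp: osc_setting_def)
    \<comment> \<open>With \<open>n + 1\<close> factors \<open>1 / p \<le> R\<close> the amplitude
      is at most \<open>C * R ^ Suc n / \<rho>\<^sup>2\<close>, and the integral of the last factor
      beyond \<open>R\<close> is less than \<open>1 / R\<close>, whatever \<open>b\<close>
      is.\<close>
    have hi: "((\<lambda>\<rho>. C * R ^ Suc n * (1 / \<rho>\<^sup>2)) has_integral C * R ^ Suc n * (1 / R - 1 / b)) {R..b}"
    proof (rule has_integral_mult_right)
      have "((\<lambda>\<rho>. 1 / \<rho>\<^sup>2) has_integral (- 1 / b - (- 1 / R))) {R..b}"
      proof (rule fundamental_theorem_of_calculus)
        fix \<rho> assume "\<rho> \<in> {R..b}"
        then show "((\<lambda>\<rho>. - 1 / \<rho>) has_vector_derivative 1 / \<rho>\<^sup>2) (at \<rho> within {R..b})"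
          unfolding has_real_derivative_iff_has_vector_derivative[symmetric] using R
          by (auto intro!: derivative_eq_intros simp: power2_eq_square)
      qed (use R in auto)
      then show "((\<lambda>\<rho>. 1 / \<rho>\<^sup>2) has_integral (1 / R - 1 / b)) {R..b}" by simp
    qed
    have "norm (integral {R..b} (osc h u)) \<le> integral {R..b} (\<lambda>\<rho>. C * R ^ Suc n * (1 / \<rho>\<^sup>2))"
    proof (rule integral_norm_bound_integral[OF int has_integral_integrable[OF hi]])
      fix \<rho> assume \<rho>: "\<rho> \<in> {R..b}"
      have "0 < \<rho>" "1 / R \<le> p \<rho>" using \<rho> R p by auto
      then have "0 < p \<rho>" using R less_le_trans[of 0 "1 / R" "p \<rho>"] by simp
      with \<open>1 / R \<le> p \<rho>\<close> have pp: "1 / p \<rho> \<le> R" "0 < p \<rho>"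
        using R by (auto simp: field_simps)
      have "\<bar>u \<rho>\<bar> \<le> C * (\<rho> ^ n / \<rho> ^ Suc (Suc n) / p \<rho> ^ Suc n)"
        using symb_bound[OF s[unfolded jn], of \<rho>] sub \<rho> by blast
      also have "\<dots> = C * (1 / \<rho>\<^sup>2) * (1 / p \<rho>) ^ Suc n"
        using \<open>0 < \<rho>\<close> by (simp add: power_one_over power2_eq_square field_simps)
      also have "\<dots> \<le> C * (1 / \<rho>\<^sup>2) * R ^ Suc n"
        using pp 0 by (intro mult_left_mono power_mono) auto
      finally show "norm (osc h u \<rho>) \<le> C * R ^ Suc n * (1 / \<rho>\<^sup>2)" by (simp add: mult_ac)
    qed
    also have "\<dots> = C * R ^ Suc n * (1 / R - 1 / b)" using hi by (rule integral_unique)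
    also have "\<dots> \<le> C * R ^ Suc n * (1 / R)"
      using R 0 by (intro mult_left_mono) auto
    also have "\<dots> = C * R ^ n" using R by simp
    finally show ?thesis .
  qed
  then show ?case using 0(1) by (intro exI[of _ C] conjI allI impI)
next
  case (Suc k)
  define C1 where "C1 = 2 ^ Suc k * C * D"
  have C1: "C1 \<ge> 0" using Suc.prems assms by (simp add: C1_def)
  have "k + Suc j = Suc n" using Suc.prems by simp
  from Suc.IH[OF C1 this] obtain C2 where C2: "0 \<le> C2" "\<forall>I h p R b b' u. osc_setting I h p R b' b \<longrightarrow>
     symb I (Suc n) D (\<lambda>\<rho>. 1 / p \<rho>) (\<lambda>\<rho>. 1 / p \<rho>) \<longrightarrow>
     symb I k C1 (\<lambda>\<rho>. \<rho> ^ n / \<rho> ^ Suc (Suc j) / p \<rho> ^ Suc j) u \<longrightarrow>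
     (\<forall>\<rho>\<in>I. b' < \<rho> \<longrightarrow> u \<rho> = 0) \<longrightarrow> osc h u integrable_on {R..b} \<longrightarrow>
     norm (integral {R..b} (osc h u)) \<le> C2 * R ^ n"
    by (elim exE conjE)
  \<comment> \<open>\<open>C2\<close> accounts for the remaining integral, \<open>C1\<close> for the
    boundary term at \<open>R\<close>.\<close>
  have "norm (integral {R..b} (osc h u)) \<le> (C2 + C1) * R ^ n"
    if os: "osc_setting I h p R b' b" and v: "symb I (Suc n) D (\<lambda>\<rho>. 1 / p \<rho>) (\<lambda>\<rho>. 1 / p \<rho>)"
      and u: "symb I (Suc k) C (\<lambda>\<rho>. \<rho> ^ n / \<rho> ^ Suc j / p \<rho> ^ j) u"
      and u0: "\<forall>\<rho>\<in>I. b' < \<rho> \<longrightarrow> u \<rho> = 0" and int: "osc h u integrable_on {R..b}" for I h p R b b' u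
  proof -
    have I: "open I" "I \<subseteq> {0<..}" and R: "0 < R" "R < b" "b' < b" "{R..b} \<subseteq> I"
      and h: "\<forall>\<rho>\<in>I. (h has_real_derivative p \<rho>) (at \<rho>)" and p: "\<forall>\<rho>\<in>I. 0 < p \<rho>"
      and pR: "\<forall>\<rho>\<in>{R..b}. 1 / R \<le> p \<rho>"
      using os unfolding osc_setting_def by blast+
    let ?w = "\<lambda>\<rho>. u \<rho> * (1 / p \<rho>)"
    have RI: "R \<in> I" "b \<in> I" using R by auto
    have pos: "0 < \<rho>" if "\<rho> \<in> I" for \<rho> using I that by auto
    have w: "symb I (Suc k) C1 (\<lambda>\<rho>. \<rho> ^ n / \<rho> ^ Suc j / p \<rho> ^ j * (1 / p \<rho>)) ?w"
      unfolding C1_def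
      using I p pos u Suc.prems assms(2) symb_le[OF v, of "Suc k"]
      by (intro symb_mult) (auto intro!: divide_nonneg_pos mult_nonneg_nonneg less_imp_le)
    have "symb I k C1 (\<lambda>\<rho>. \<rho> ^ n / \<rho> ^ Suc j / p \<rho> ^ j * (1 / p \<rho>) / \<rho>) (deriv ?w)"
      using w by simp
    also have "?this \<longleftrightarrow> symb I k C1 (\<lambda>\<rho>. \<rho> ^ n / \<rho> ^ Suc (Suc j) / p \<rho> ^ Suc j) (deriv ?w)"
      by (intro symb_cong[OF I(1)]) (auto simp: mult_ac)
    finally have dw: "symb I k C1 (\<lambda>\<rho>. \<rho> ^ n / \<rho> ^ Suc (Suc j) / p \<rho> ^ Suc j) (deriv ?w)" .
    have dw0: "\<forall>\<rho>\<in>I. b' < \<rho> \<longrightarrow> deriv ?w \<rho> = 0"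
    proof (intro ballI impI)
      fix \<rho> assume "\<rho> \<in> I" "b' < \<rho>"
      then have "deriv ?w \<rho> = deriv (\<lambda>_. 0) \<rho>"
        using u0 by (intro deriv_cong_on[of "I \<inter> {b'<..}"]) (auto intro: I(1))
      then show "deriv ?w \<rho> = 0" by simp
    qed
    have wd: "?w differentiable (at \<rho>)" if "\<rho> \<in> I" for \<rho> using w that by simp
    have ub: "u b = 0" using u0 RI R by auto
    note parts = osc_by_parts[OF less_imp_le[OF R(2)] R(4) h[rule_format] p[rule_format] wd ub int]
    have 1: "norm (integral {R..b} (osc h (deriv ?w))) \<le> C2 * R ^ n"
      using C2(2) os v dw dw0 parts(1) by blast
    have pp: "1 / p R \<le> R" "0 < p R"
      using pR R p RI by (auto simp: field_simps)
    have "\<bar>?w R\<bar> \<le> C1 * (R ^ n / R ^ Suc j / p R ^ j * (1 / p R))"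
      using symb_bound[OF w RI(1)] .
    also have "\<dots> = C1 * (R ^ n / R ^ Suc j) * (1 / p R) ^ Suc j"
      by (simp add: power_one_over)
    also have "\<dots> \<le> C1 * (R ^ n / R ^ Suc j) * R ^ Suc j"
      using pp C1 R by (intro mult_left_mono power_mono) auto
    also have "\<dots> = C1 * R ^ n" using R by simp
    finally show ?thesis using parts(2) 1 by (simp add: distrib_right)
  qed
  then show ?case using add_nonneg_nonneg[OF C2(1) C1] by (intro exI[of _ "C2 + C1"] conjI allI impI)
qed

text \<open>The constant precedes \<open>I\<close>, \<open>h\<close>, \<open>p\<close>,
  \<open>R\<close>, \<open>b\<close> and the amplitude: it depends on the symbol constants alone,
  which is the uniformity needed over all rays.\<close>

proposition osc_bound:
  assumes "0 \<le> C\<psi>" "0 \<le> Cp" "1 \<le> n"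
  shows "\<exists>C\<ge>0. \<forall>I h p R b b' \<psi>. osc_setting I h p R b' b \<longrightarrow> symb I (Suc n) Cp p p \<longrightarrow>
     symb I (Suc n) C\<psi> (\<lambda>_. 1) \<psi> \<longrightarrow> (\<forall>\<rho>\<in>I. b' < \<rho> \<longrightarrow> \<psi> \<rho> = 0) \<longrightarrow>
     norm (integral {R..b} (osc h (\<lambda>\<rho>. \<psi> \<rho> * \<rho> ^ (n - 1)))) \<le> C * R ^ n"
proof -
  from symb_inverse[OF assms(2), of "Suc n"]
  obtain D where D: "0 \<le> D" "\<forall>I p. open I \<longrightarrow> I \<subseteq> {0<..} \<longrightarrow> (\<forall>\<rho>\<in>I. 0 < p \<rho>) \<longrightarrow> symb I (Suc n) Cp p p \<longrightarrow>
           symb I (Suc n) D (\<lambda>\<rho>. 1 / p \<rho>) (\<lambda>\<rho>. 1 / p \<rho>)"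
    by (elim exE conjE)
  define C0 where "C0 = 2 ^ Suc n * C\<psi> * 2 ^ (Suc n * (n - 1))"
  have C0: "0 \<le> C0" using assms by (simp add: C0_def)
  have "Suc n + 0 = Suc n" by simp
  from osc_bound_aux[OF C0 D(1) this] obtain C where C: "0 \<le> C" "\<forall>I h p R b b' u. osc_setting I h p R b' b \<longrightarrow>
     symb I (Suc n) D (\<lambda>\<rho>. 1 / p \<rho>) (\<lambda>\<rho>. 1 / p \<rho>) \<longrightarrow>
     symb I (Suc n) C0 (\<lambda>\<rho>. \<rho> ^ n / \<rho> ^ Suc 0 / p \<rho> ^ 0) u \<longrightarrow>
     (\<forall>\<rho>\<in>I. b' < \<rho> \<longrightarrow> u \<rho> = 0) \<longrightarrow> osc h u integrable_on {R..b} \<longrightarrow>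
     norm (integral {R..b} (osc h u)) \<le> C * R ^ n"
    by (elim exE conjE)
  have "norm (integral {R..b} (osc h (\<lambda>\<rho>. \<psi> \<rho> * \<rho> ^ (n - 1)))) \<le> C * R ^ n"
    if os: "osc_setting I h p R b' b" and pp: "symb I (Suc n) Cp p p"
      and \<psi>: "symb I (Suc n) C\<psi> (\<lambda>_. 1) \<psi>" and \<psi>0: "\<forall>\<rho>\<in>I. b' < \<rho> \<longrightarrow> \<psi> \<rho> = 0" for I h p R b b' \<psi>
  proof -
    have I: "open I" "I \<subseteq> {0<..}" and R: "0 < R" "R < b" "b' < b" "{R..b} \<subseteq> I"
      and h: "\<forall>\<rho>\<in>I. (h has_real_derivative p \<rho>) (at \<rho>)" and p: "\<forall>\<rho>\<in>I. 0 < p \<rho>"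
      using os unfolding osc_setting_def by blast+
    have "symb I (Suc n) C0 (\<lambda>\<rho>. 1 * \<rho> ^ (n - 1)) (\<lambda>\<rho>. \<psi> \<rho> * \<rho> ^ (n - 1))"
      unfolding C0_def using I(2) assms by (intro symb_mult[OF I \<psi> symb_power[OF I]]) (auto intro!: less_imp_le)
    \<comment> \<open>The power is rewritten as a quotient because later steps lower its exponent
      below zero.\<close>
    also have "?this \<longleftrightarrow> symb I (Suc n) C0 (\<lambda>\<rho>. \<rho> ^ n / \<rho> ^ Suc 0 / p \<rho> ^ 0) (\<lambda>\<rho>. \<psi> \<rho> * \<rho> ^ (n - 1))"
      using I(2) assms(3) by (intro symb_cong[OF I(1)]) (auto simp: power_diff)
    finally have u: "symb I (Suc n) C0 (\<lambda>\<rho>. \<rho> ^ n / \<rho> ^ Suc 0 / p \<rho> ^ 0) (\<lambda>\<rho>. \<psi> \<rho> * \<rho> ^ (n - 1))" .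
    have "continuous_on {R..b} (osc h (\<lambda>\<rho>. \<psi> \<rho> * \<rho> ^ (n - 1)))"
    proof (intro continuous_at_imp_continuous_on ballI)
      fix \<rho> assume "\<rho> \<in> {R..b}"
      then have \<rho>: "\<rho> \<in> I" using R by auto
      have "isCont h \<rho>" using h \<rho> by (blast intro: DERIV_isCont)
      moreover have "isCont \<psi> \<rho>" using \<psi> \<rho> by (auto intro: differentiable_imp_continuous_within)
      ultimately show "isCont (osc h (\<lambda>\<rho>. \<psi> \<rho> * \<rho> ^ (n - 1))) \<rho>"
        unfolding osc_def cis_conv_exp by (intro continuous_intros)
    qed
    then have int: "osc h (\<lambda>\<rho>. \<psi> \<rho> * \<rho> ^ (n - 1)) integrable_on {R..b}"
      by (rule integrable_continuous_real)
    have v: "symb I (Suc n) D (\<lambda>\<rho>. 1 / p \<rho>) (\<lambda>\<rho>. 1 / p \<rho>)" using D(2) I p pp by blast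
    have u0: "\<forall>\<rho>\<in>I. b' < \<rho> \<longrightarrow> \<psi> \<rho> * \<rho> ^ (n - 1) = 0" using \<psi>0 by simp
    show ?thesis using C(2) os v u u0 int by blast
  qed
  then show ?thesis using C(1) by (intro exI[of _ C] conjI allI impI)
qed

section \<open>Polar coordinates\<close>

text \<open>
  Averaging over a shell of logarithmic thickness one avoids the surface measure of the unit sphere.
\<close>

definition thick_sphere :: "'a::euclidean_space set" where
  "thick_sphere = {\<omega>. 1 \<le> norm \<omega> \<and> norm \<omega> \<le> exp 1}"

definition polar_weight :: "'a::euclidean_space \<Rightarrow> real \<Rightarrow> real" where
  "polar_weight \<omega> \<sigma> = indicator thick_sphere \<omega> * (indicator {0<..} \<sigma> * \<sigma> ^ (DIM('a) - 1))"

lemma polar_weight_nonneg: "0 \<le> polar_weight \<omega> \<sigma>"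
  by (auto simp: polar_weight_def indicator_def)

lemma thick_sphere_borel [measurable]: "thick_sphere \<in> sets borel"
  unfolding thick_sphere_def by measurable

lemma polar_weight_measurable [measurable]:
  "(\<lambda>p. polar_weight (fst p) (snd p)) \<in> borel_measurable (lborel \<Otimes>\<^sub>M lborel)"
  unfolding polar_weight_def by measurable

lemma polar_weight_measurable2 [measurable]:
  "polar_weight \<omega> \<in> borel_measurable lborel" "(\<lambda>\<omega>. polar_weight \<omega> \<sigma>) \<in> borel_measurable lborel"
  unfolding polar_weight_def[abs_def] by measurable

lemma nn_integral_lborel_affine:
  fixes G :: "'a::euclidean_space \<Rightarrow> ennreal"
  assumes [measurable]: "G \<in> borel_measurable lborel" and c: "0 < c"
  shows "(\<integral>\<^sup>+y. G y \<partial>lborel) = ennreal (c ^ DIM('a)) * (\<integral>\<^sup>+x. G (t + c *\<^sub>R x) \<partial>lborel)"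
proof -
  have "(\<integral>\<^sup>+y. G y \<partial>lborel) = (\<integral>\<^sup>+y. G y \<partial>density (distr lborel borel (\<lambda>x. t + c *\<^sub>R x)) (\<lambda>_. \<bar>c\<bar> ^ DIM('a)))"
    using lborel_affine[of c t] c by simp
  also have "\<dots> = (\<integral>\<^sup>+x. ennreal (\<bar>c\<bar> ^ DIM('a)) * G (t + c *\<^sub>R x) \<partial>lborel)"
    by (simp add: nn_integral_density nn_integral_distr)
  also have "\<dots> = ennreal (c ^ DIM('a)) * (\<integral>\<^sup>+x. G (t + c *\<^sub>R x) \<partial>lborel)"
    using c by (simp add: nn_integral_cmult)
  finally show ?thesis .
qed

text \<open>For fixed y, the \<sigma> > 0 with (y - x0) / \<sigma> in \<open>thick_sphere\<close>
  form this window with r = norm (y - x0). Its mass under d\<sigma> / \<sigma> is 1, which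
  normalizes the polar formula.\<close>

lemma nn_integral_inverse_window:
  assumes "0 < r"
  shows "(\<integral>\<^sup>+\<sigma>. ennreal (1 / \<sigma>) * indicator {r / exp 1..r} \<sigma> \<partial>lborel) = 1"
proof -
  have "(\<integral>\<^sup>+\<sigma>. ennreal (1 / \<sigma>) * indicator {r / exp 1..r} \<sigma> \<partial>lborel) = ln r - ln (r / exp 1)"
  proof -
    have pos: "0 < \<sigma>" if "\<sigma> \<in> {r / exp 1..r}" for \<sigma>
      using that less_le_trans[of 0 "r / exp 1" \<sigma>] assms by simp
    show ?thesis
    proof (rule nn_integral_FTC_Icc)
      show "(ln has_real_derivative 1 / \<sigma>) (at \<sigma>)" if "\<sigma> \<in> {r / exp 1..r}" for \<sigma>
        using pos[OF that] by (auto intro!: derivative_eq_intros)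
      show "0 \<le> 1 / \<sigma>" if "\<sigma> \<in> {r / exp 1..r}" for \<sigma> using pos[OF that] by simp
      show "r / exp 1 \<le> r" using assms by (simp add: divide_le_eq)
    qed simp
  qed
  also have "ln r - ln (r / exp 1) = 1" using assms by (simp add: ln_div)
  finally show ?thesis by simp
qed

text \<open>For fixed \<sigma> the substitution y = x0 + \<sigma> \<omega> produces one factor
  \<sigma> more than the weight contains; dividing by it gives the density 1 / \<sigma>, which
  integrates to 1 over the window belonging to y.\<close>

proposition nn_integral_polar:
  fixes \<Phi> :: "'a::euclidean_space \<Rightarrow> ennreal"
  assumes [measurable]: "\<Phi> \<in> borel_measurable lborel"
  shows "(\<integral>\<^sup>+\<omega>. \<integral>\<^sup>+\<sigma>. ennreal (polar_weight \<omega> \<sigma>) * \<Phi> (x0 + \<sigma> *\<^sub>R \<omega>) \<partial>lborel \<partial>lborel) = (\<integral>\<^sup>+y. \<Phi> y \<partial>lborel)"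
proof -
  have inner: "(\<integral>\<^sup>+\<omega>. ennreal (polar_weight \<omega> \<sigma>) * \<Phi> (x0 + \<sigma> *\<^sub>R \<omega>) \<partial>lborel) =
    (\<integral>\<^sup>+y. (ennreal (1 / \<sigma>) * indicator {norm (y - x0) / exp 1..norm (y - x0)} \<sigma>) * \<Phi> y * indicator {0<..} \<sigma> \<partial>lborel)" for \<sigma>
  proof (cases "0 < \<sigma>")
    case True
    have ind: "indicator thick_sphere ((1 / \<sigma>) *\<^sub>R (y - x0)) = (indicator {norm (y - x0) / exp 1..norm (y - x0)} \<sigma> :: ennreal)" for y
    proof -
      have nrm: "norm ((1 / \<sigma>) *\<^sub>R (y - x0)) = norm (y - x0) / \<sigma>" using True by simp
      show ?thesis
        unfolding thick_sphere_def indicator_def mem_Collect_eq nrm using True by (auto simp: field_simps)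
    qed
    have pw: "\<sigma> ^ DIM('a) = \<sigma> * \<sigma> ^ (DIM('a) - 1)"
      using DIM_positive[where 'a = 'a] by (simp flip: power_Suc)
    have "(\<integral>\<^sup>+y. (ennreal (1 / \<sigma>) * indicator {norm (y - x0) / exp 1..norm (y - x0)} \<sigma>) * \<Phi> y * indicator {0<..} \<sigma> \<partial>lborel)
       = (\<integral>\<^sup>+y. ennreal (1 / \<sigma>) * indicator thick_sphere ((1 / \<sigma>) *\<^sub>R (y - x0)) * \<Phi> y \<partial>lborel)"
      unfolding ind using True by simp
    also have "\<dots> = ennreal (\<sigma> ^ DIM('a)) * (\<integral>\<^sup>+\<omega>. ennreal (1 / \<sigma>) * indicator thick_sphere ((1 / \<sigma>) *\<^sub>R (x0 + \<sigma> *\<^sub>R \<omega> - x0)) * \<Phi> (x0 + \<sigma> *\<^sub>R \<omega>) \<partial>lborel)"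
      by (rule nn_integral_lborel_affine) (use True in measurable)
    also have "\<dots> = (\<integral>\<^sup>+\<omega>. ennreal (\<sigma> ^ DIM('a)) * (ennreal (1 / \<sigma>) * indicator thick_sphere \<omega> * \<Phi> (x0 + \<sigma> *\<^sub>R \<omega>)) \<partial>lborel)"
      using True by (subst nn_integral_cmult) auto
    also have "\<dots> = (\<integral>\<^sup>+\<omega>. ennreal (polar_weight \<omega> \<sigma>) * \<Phi> (x0 + \<sigma> *\<^sub>R \<omega>) \<partial>lborel)"
    proof (rule nn_integral_cong)
      fix \<omega> :: 'a
      have "ennreal (\<sigma> ^ DIM('a)) * ennreal (1 / \<sigma>) = ennreal (\<sigma> ^ (DIM('a) - 1))"
        unfolding pw using True by (simp add: ennreal_mult[symmetric])
      then show "ennreal (\<sigma> ^ DIM('a)) * (ennreal (1 / \<sigma>) * indicator thick_sphere \<omega> * \<Phi> (x0 + \<sigma> *\<^sub>R \<omega>)) =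
          ennreal (polar_weight \<omega> \<sigma>) * \<Phi> (x0 + \<sigma> *\<^sub>R \<omega>)"
        using True by (auto simp: polar_weight_def indicator_def mult.assoc[symmetric])
    qed
    finally show ?thesis by simp
  qed (simp add: polar_weight_def)
  have "(\<integral>\<^sup>+\<omega>. \<integral>\<^sup>+\<sigma>. ennreal (polar_weight \<omega> \<sigma>) * \<Phi> (x0 + \<sigma> *\<^sub>R \<omega>) \<partial>lborel \<partial>lborel) =
     (\<integral>\<^sup>+\<sigma>. \<integral>\<^sup>+\<omega>. ennreal (polar_weight \<omega> \<sigma>) * \<Phi> (x0 + \<sigma> *\<^sub>R \<omega>) \<partial>lborel \<partial>lborel)"
    unfolding polar_weight_def by (rule lborel_pair.Fubini'[symmetric]) measurable
  also have "\<dots> = (\<integral>\<^sup>+\<sigma>. \<integral>\<^sup>+y. (ennreal (1 / \<sigma>) * indicator {norm (y - x0) / exp 1..norm (y - x0)} \<sigma>) * \<Phi> y * indicator {0<..} \<sigma> \<partial>lborel \<partial>lborel)"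
    unfolding inner ..
  also have "\<dots> = (\<integral>\<^sup>+y. \<integral>\<^sup>+\<sigma>. (ennreal (1 / \<sigma>) * indicator {norm (y - x0) / exp 1..norm (y - x0)} \<sigma>) * \<Phi> y * indicator {0<..} \<sigma> \<partial>lborel \<partial>lborel)"
    by (rule lborel_pair.Fubini') (unfold indicator_def atLeastAtMost_iff, measurable)
  also have "\<dots> = (\<integral>\<^sup>+y. \<Phi> y \<partial>lborel)"
  proof (rule nn_integral_cong_AE)
    have "AE y in lborel. y \<noteq> x0" by (rule AE_lborel_singleton)
    then show "AE y in lborel. (\<integral>\<^sup>+\<sigma>. (ennreal (1 / \<sigma>) * indicator {norm (y - x0) / exp 1..norm (y - x0)} \<sigma>) * \<Phi> y * indicator {0<..} \<sigma> \<partial>lborel) = \<Phi> y"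
    proof eventually_elim
      fix y assume "y \<noteq> x0"
      then have r: "0 < norm (y - x0)" by simp
      have "(ennreal (1 / \<sigma>) * indicator {norm (y - x0) / exp 1..norm (y - x0)} \<sigma>) * \<Phi> y * indicator {0<..} \<sigma> =
          (ennreal (1 / \<sigma>) * indicator {norm (y - x0) / exp 1..norm (y - x0)} \<sigma>) * \<Phi> y" for \<sigma>
      proof (cases "0 < \<sigma>")
        case False
        have "0 < norm (y - x0) / exp 1" using r by simp
        then have "\<not> norm (y - x0) / exp 1 \<le> \<sigma>" using False by linarith
        then show ?thesis by simp
      qed simp
      then have "(\<integral>\<^sup>+\<sigma>. (ennreal (1 / \<sigma>) * indicator {norm (y - x0) / exp 1..norm (y - x0)} \<sigma>) * \<Phi> y * indicator {0<..} \<sigma> \<partial>lborel) =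
        (\<integral>\<^sup>+\<sigma>. (ennreal (1 / \<sigma>) * indicator {norm (y - x0) / exp 1..norm (y - x0)} \<sigma>) * \<Phi> y \<partial>lborel)"
        by simp
      also have "\<dots> = \<Phi> y"
        using nn_integral_inverse_window[OF r] by (simp add: nn_integral_multc)
      finally show "(\<integral>\<^sup>+\<sigma>. (ennreal (1 / \<sigma>) * indicator {norm (y - x0) / exp 1..norm (y - x0)} \<sigma>) * \<Phi> y * indicator {0<..} \<sigma> \<partial>lborel) = \<Phi> y" .
    qed
  qed
  finally show ?thesis .
qed

text \<open>As an identity of measures the polar formula also transfers Bochner integrals of complex
  functions.\<close>

lemma lborel_eq_distr_polar:
  "lborel = distr (density (lborel \<Otimes>\<^sub>M lborel) (\<lambda>p. ennreal (polar_weight (fst p) (snd p)))) lborel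
     (\<lambda>p. x0 + snd p *\<^sub>R (fst p :: 'a::euclidean_space))"
proof (rule measure_eqI)
  fix B :: "'a set" assume "B \<in> sets lborel"
  then have [measurable]: "B \<in> sets borel" by simp
  have "emeasure lborel B = (\<integral>\<^sup>+y. indicator B y \<partial>lborel)" by simp
  also have "\<dots> = (\<integral>\<^sup>+\<omega>. \<integral>\<^sup>+\<sigma>. ennreal (polar_weight \<omega> \<sigma>) * indicator B (x0 + \<sigma> *\<^sub>R \<omega>) \<partial>lborel \<partial>lborel)"
    by (rule nn_integral_polar[symmetric]) measurable
  also have "\<dots> = (\<integral>\<^sup>+p. ennreal (polar_weight (fst p) (snd p)) * indicator B (x0 + snd p *\<^sub>R fst p) \<partial>(lborel \<Otimes>\<^sub>M lborel))"
    by (subst lborel.nn_integral_fst[symmetric]) simp_all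
  also have "\<dots> = emeasure (distr (density (lborel \<Otimes>\<^sub>M lborel) (\<lambda>p. ennreal (polar_weight (fst p) (snd p)))) lborel
     (\<lambda>p. x0 + snd p *\<^sub>R fst p)) B"
    by (subst nn_integral_indicator[symmetric], simp, subst nn_integral_distr, simp_all add: nn_integral_density)
  finally show "emeasure lborel B = emeasure (distr (density (lborel \<Otimes>\<^sub>M lborel) (\<lambda>p. ennreal (polar_weight (fst p) (snd p)))) lborel
     (\<lambda>p. x0 + snd p *\<^sub>R fst p)) B" .
qed simp

text \<open>Norms are taken only after integration over a ray, so the cancellation along each ray is
  kept; over the directions, absolute values suffice.\<close>

proposition polar_comparison:
  fixes \<Phi> :: "'a::euclidean_space \<Rightarrow> complex" and g :: "'a \<Rightarrow> ennreal"
  assumes \<Phi>: "integrable lborel \<Phi>" and g [measurable]: "g \<in> borel_measurable lborel"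
    and ray: "\<And>\<omega>. \<omega> \<in> thick_sphere \<Longrightarrow>
      ennreal (norm (\<integral>\<sigma>. indicator {0<..} \<sigma> *\<^sub>R (of_real (\<sigma> ^ (DIM('a) - 1)) * \<Phi> (x0 + \<sigma> *\<^sub>R \<omega>)) \<partial>lborel))
      \<le> C * (\<integral>\<^sup>+\<sigma>. ennreal (indicator {0<..} \<sigma> * \<sigma> ^ (DIM('a) - 1)) * g (x0 + \<sigma> *\<^sub>R \<omega>) \<partial>lborel)"
  shows "ennreal (norm (\<integral>x. \<Phi> x \<partial>lborel)) \<le> C * (\<integral>\<^sup>+x. g x \<partial>lborel)"
proof -
  have [measurable]: "\<Phi> \<in> borel_measurable borel" using \<Phi> by auto
  let ?M = "density (lborel \<Otimes>\<^sub>M lborel) (\<lambda>p. ennreal (polar_weight (fst p) (snd p :: real))) :: ('a \<times> real) measure"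
  let ?T = "\<lambda>p. x0 + snd p *\<^sub>R (fst p :: 'a)"
  let ?f = "\<lambda>p. polar_weight (fst p) (snd p) *\<^sub>R \<Phi> (?T p)"
  have "integrable (distr ?M lborel ?T) \<Phi>" using \<Phi> by (simp flip: lborel_eq_distr_polar)
  then have "integrable ?M (\<lambda>p. \<Phi> (?T p))" by (subst (asm) integrable_distr_eq) simp_all
  then have int: "integrable (lborel \<Otimes>\<^sub>M lborel) ?f"
    by (subst (asm) integrable_density) (simp_all add: polar_weight_nonneg)
  have "(\<integral>x. \<Phi> x \<partial>lborel) = (\<integral>x. \<Phi> x \<partial>distr ?M lborel ?T)" by (simp flip: lborel_eq_distr_polar)
  also have "\<dots> = (\<integral>p. \<Phi> (?T p) \<partial>?M)" by (rule integral_distr) simp_all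
  also have "\<dots> = (\<integral>p. ?f p \<partial>(lborel \<Otimes>\<^sub>M lborel))"
    by (rule integral_density) (simp_all add: polar_weight_nonneg)
  also have "\<dots> = (\<integral>\<omega>. \<integral>\<sigma>. ?f (\<omega>, \<sigma>) \<partial>lborel \<partial>lborel)"
    by (rule lborel_pair.integral_fst'[OF int, symmetric])
  finally have "ennreal (norm (\<integral>x. \<Phi> x \<partial>lborel)) = ennreal (norm (\<integral>\<omega>. \<integral>\<sigma>. ?f (\<omega>, \<sigma>) \<partial>lborel \<partial>lborel))"
    by simp
  also have "\<dots> \<le> (\<integral>\<^sup>+\<omega>. ennreal (norm (\<integral>\<sigma>. ?f (\<omega>, \<sigma>) \<partial>lborel)) \<partial>lborel)"
    by (rule integral_norm_bound_ennreal[OF lborel_pair.integrable_fst'[OF int]])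
  also have "\<dots> \<le> (\<integral>\<^sup>+\<omega>. C * (\<integral>\<^sup>+\<sigma>. ennreal (polar_weight \<omega> \<sigma>) * g (x0 + \<sigma> *\<^sub>R \<omega>) \<partial>lborel) \<partial>lborel)"
  proof (rule nn_integral_mono)
    fix \<omega> :: 'a
    show "ennreal (norm (\<integral>\<sigma>. ?f (\<omega>, \<sigma>) \<partial>lborel)) \<le> C * (\<integral>\<^sup>+\<sigma>. ennreal (polar_weight \<omega> \<sigma>) * g (x0 + \<sigma> *\<^sub>R \<omega>) \<partial>lborel)"
    proof (cases "\<omega> \<in> thick_sphere")
      case True
      have "?f (\<omega>, \<sigma>) = indicator {0<..} \<sigma> *\<^sub>R (of_real (\<sigma> ^ (DIM('a) - 1)) * \<Phi> (x0 + \<sigma> *\<^sub>R \<omega>))" for \<sigma>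
        using True by (simp add: polar_weight_def scaleR_conv_of_real)
      then show ?thesis using ray[OF True] True by (simp add: polar_weight_def)
    qed (simp add: polar_weight_def)
  qed
  also have "\<dots> = C * (\<integral>\<^sup>+\<omega>. \<integral>\<^sup>+\<sigma>. ennreal (polar_weight \<omega> \<sigma>) * g (x0 + \<sigma> *\<^sub>R \<omega>) \<partial>lborel \<partial>lborel)"
    unfolding polar_weight_def by (rule nn_integral_cmult) measurable
  also have "\<dots> = C * (\<integral>\<^sup>+x. g x \<partial>lborel)" by (simp add: nn_integral_polar)
  finally show ?thesis .
qed

section \<open>Amplitudes and surface measure\<close>

lemma symb_weight_mono:
  assumes "symb I k C W u" "\<And>\<rho>. \<rho> \<in> I \<Longrightarrow> C * W \<rho> \<le> C' * W' \<rho>" "I \<subseteq> {0<..}"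
  shows "symb I k C' W' u"
  using assms(1,2)
proof (induction k arbitrary: W W' u)
  case 0
  then show ?case by (fastforce intro: order_trans)
next
  case (Suc k)
  have "\<bar>u \<rho>\<bar> \<le> C' * W' \<rho>" if "\<rho> \<in> I" for \<rho>
    using symb_bound[OF Suc.prems(1) that] Suc.prems(2)[OF that] by linarith
  moreover have "symb I k C' (\<lambda>\<rho>. W' \<rho> / \<rho>) (deriv u)"
  proof (rule Suc.IH)
    show "symb I k C (\<lambda>\<rho>. W \<rho> / \<rho>) (deriv u)" using Suc.prems(1) by simp
    show "C * (W \<rho> / \<rho>) \<le> C' * (W' \<rho> / \<rho>)" if "\<rho> \<in> I" for \<rho>
      using divide_right_mono[OF Suc.prems(2)[OF that], of \<rho>] assms(3) that by (auto simp: less_imp_le)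
  qed
  ultimately show ?case using Suc.prems(1) by auto
qed

lemma symb_sum:
  assumes "finite A" "open I" "I \<subseteq> {0<..}" "\<And>\<rho>. \<rho> \<in> I \<Longrightarrow> 0 \<le> W \<rho>" "\<And>i. i \<in> A \<Longrightarrow> symb I k (C i) W (u i)"
  shows "symb I k (\<Sum>i\<in>A. C i) W (\<lambda>\<rho>. \<Sum>i\<in>A. u i \<rho>)"
  using assms(1,5)
proof (induction A)
  case empty
  then show ?case using symb_zero[of I W 0 k] assms by simp
next
  case (insert i A)
  then have "symb I k (C i + (\<Sum>i\<in>A. C i)) W (\<lambda>\<rho>. u i \<rho> + (\<Sum>i\<in>A. u i \<rho>))"
    using assms(2) by (intro symb_add) auto
  then show ?case using insert.hyps by simp
qed

lemma C_k_continuous: "C_k k g \<Longrightarrow> continuous_on UNIV g"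
  by (cases k) (auto intro: differentiable_imp_continuous_on)

lemma abs_bounded_on_compact:
  fixes g :: "'a::topological_space \<Rightarrow> real"
  assumes "compact K" "continuous_on K g"
  obtains B where "0 \<le> B" "\<And>x. x \<in> K \<Longrightarrow> \<bar>g x\<bar> \<le> B"
proof -
  have "bounded (g ` K)" using assms by (intro compact_imp_bounded compact_continuous_image)
  then obtain B where "0 < B" "\<forall>y\<in>g ` K. norm y \<le> B" unfolding bounded_pos by blast
  then show thesis by (intro that[of B]) auto
qed

lemma partial_deriv_eq_0:
  assumes "closed K" "\<And>x. x \<notin> K \<Longrightarrow> g x = 0" "x \<notin> K"
  shows "partial_deriv i g x = 0"
proof -
  have "((\<lambda>_. 0) has_derivative (\<lambda>_. 0)) (at x)" by simp
  then have "(g has_derivative (\<lambda>_. 0)) (at x)"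
    using assms by (rule_tac has_derivative_transform_within_open[of _ _ x UNIV "- K"]) (auto simp: open_Compl)
  then have "frechet_derivative g (at x) = (\<lambda>_. 0)" by (rule frechet_derivative_at[symmetric])
  then show ?thesis by (simp add: partial_deriv_def)
qed

lemma line_partial_derivs:
  fixes g :: "real^'n \<Rightarrow> real"
  assumes "g differentiable_on UNIV"
  shows "((\<lambda>\<rho>. g (x + \<rho> *\<^sub>R w)) has_real_derivative (\<Sum>i\<in>UNIV. w $ i * partial_deriv i g (x + \<rho> *\<^sub>R w))) (at \<rho>)"
proof -
  let ?G = "frechet_derivative g (at (x + \<rho> *\<^sub>R w))"
  have G: "(g has_derivative ?G) (at (x + \<rho> *\<^sub>R w))"
    using assms by (simp add: differentiable_on_def frechet_derivative_works)
  have "((\<lambda>\<rho>. x + \<rho> *\<^sub>R w) has_derivative (\<lambda>h. h *\<^sub>R w)) (at \<rho>)"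
    by (auto intro!: derivative_eq_intros)
  from diff_chain_at[OF this G] have 1: "((\<lambda>\<rho>. g (x + \<rho> *\<^sub>R w)) has_derivative (\<lambda>h. ?G (h *\<^sub>R w))) (at \<rho>)"
    by (simp add: o_def)
  have lin: "linear ?G" using G by (rule has_derivative_linear)
  have "?G w = ?G (\<Sum>i\<in>UNIV. w $ i *\<^sub>R axis i 1)"
    using basis_expansion[of w] by (simp add: scalar_mult_eq_scaleR)
  also have "\<dots> = (\<Sum>i\<in>UNIV. w $ i * partial_deriv i g (x + \<rho> *\<^sub>R w))"
    by (simp add: linear_sum[OF lin] linear_scale[OF lin] partial_deriv_def)
  finally have "?G (h *\<^sub>R w) = (\<Sum>i\<in>UNIV. w $ i * partial_deriv i g (x + \<rho> *\<^sub>R w)) * h" for h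
    by (simp add: linear_scale[OF lin] mult.commute)
  with 1 show ?thesis by (simp add: has_field_derivative_def)
qed

text \<open>The derivatives of the restriction are simply bounded, uniformly in \<open>x\<close>
  because \<open>g\<close> vanishes off a compact set. Since \<rho> < \<open>L\<close>, a bound C1
  is at most L C1 / \<rho>, which gives the weaker symbol estimate.\<close>

lemma C_k_line:
  fixes g :: "real^'n \<Rightarrow> real"
  assumes "compact K" "0 \<le> E" "1 \<le> L" "C_k k g" "\<And>x. x \<notin> K \<Longrightarrow> g x = 0"
  shows "\<exists>C\<ge>0. \<forall>I x w. open I \<longrightarrow> I \<subseteq> {0<..<L} \<longrightarrow> norm w \<le> E \<longrightarrow> symb I k C (\<lambda>_. 1) (\<lambda>\<rho>. g (x + \<rho> *\<^sub>R w))"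
  using assms(4,5)
proof (induction k arbitrary: g)
  case 0
  have "continuous_on K g" using C_k_continuous[OF 0(1)] continuous_on_subset by blast
  then obtain B where B: "0 \<le> B" "\<And>x. x \<in> K \<Longrightarrow> \<bar>g x\<bar> \<le> B"
    using abs_bounded_on_compact[OF assms(1)] by blast
  have "\<bar>g x\<bar> \<le> B" for x using 0(2)[of x] B by (cases "x \<in> K") auto
  then show ?case using B(1) by (intro exI[of _ B]) auto
next
  case (Suc k)
  have "continuous_on K g" using C_k_continuous[OF Suc.prems(1)] continuous_on_subset by blast
  then obtain B where B: "0 \<le> B" "\<And>x. x \<in> K \<Longrightarrow> \<bar>g x\<bar> \<le> B"
    using abs_bounded_on_compact[OF assms(1)] by blast
  have gB: "\<bar>g x\<bar> \<le> B" for x using Suc.prems(2)[of x] B by (cases "x \<in> K") auto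
  have "\<forall>i. \<exists>C. 0 \<le> C \<and> (\<forall>I x w. open I \<longrightarrow> I \<subseteq> {0<..<L} \<longrightarrow> norm w \<le> E \<longrightarrow>
      symb I k C (\<lambda>_. 1) (\<lambda>\<rho>. partial_deriv i g (x + \<rho> *\<^sub>R w)))"
  proof
    fix i
    show "\<exists>C. 0 \<le> C \<and> (\<forall>I x w. open I \<longrightarrow> I \<subseteq> {0<..<L} \<longrightarrow> norm w \<le> E \<longrightarrow>
      symb I k C (\<lambda>_. 1) (\<lambda>\<rho>. partial_deriv i g (x + \<rho> *\<^sub>R w)))"
      using Suc.prems partial_deriv_eq_0[OF compact_imp_closed[OF assms(1)] Suc.prems(2)]
      by (intro Suc.IH) auto
  qed
  then obtain C where C: "\<forall>i. 0 \<le> C i \<and> (\<forall>I x w. open I \<longrightarrow> I \<subseteq> {0<..<L} \<longrightarrow> norm w \<le> E \<longrightarrow>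
      symb I k (C i) (\<lambda>_. 1) (\<lambda>\<rho>. partial_deriv i g (x + \<rho> *\<^sub>R w)))"
    by (rule choice[THEN exE])
  define C1 where "C1 = (\<Sum>i\<in>UNIV. 2 ^ k * E * C i)"
  have C1: "0 \<le> C1" unfolding C1_def using C assms(2) by (intro sum_nonneg) auto
  have "symb I (Suc k) (B + L * C1) (\<lambda>_. 1) (\<lambda>\<rho>. g (x + \<rho> *\<^sub>R w))"
    if I: "open I" "I \<subseteq> {0<..<L}" and w: "norm w \<le> E" for I x w
  proof -
    have I0: "I \<subseteq> {0<..}" using I by auto
    note d = line_partial_derivs[of g x w]
    have gd: "g differentiable_on UNIV" using Suc.prems(1) by simp
    have du: "deriv (\<lambda>\<rho>. g (x + \<rho> *\<^sub>R w)) = (\<lambda>\<rho>. \<Sum>i\<in>UNIV. w $ i * partial_deriv i g (x + \<rho> *\<^sub>R w))"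
      by (rule ext) (rule DERIV_imp_deriv[OF d[OF gd]])
    have "symb I k C1 (\<lambda>_. 1) (\<lambda>\<rho>. \<Sum>i\<in>UNIV. w $ i * partial_deriv i g (x + \<rho> *\<^sub>R w))"
      unfolding C1_def
    proof (rule symb_sum[OF _ I(1) I0])
      fix i
      have Ci: "symb I k (C i) (\<lambda>_. 1) (\<lambda>\<rho>. partial_deriv i g (x + \<rho> *\<^sub>R w))" "0 \<le> C i"
        using C I w by blast+
      have "symb I k (2 ^ k * \<bar>w $ i\<bar> * C i) (\<lambda>\<rho>. 1 * 1) (\<lambda>\<rho>. w $ i * partial_deriv i g (x + \<rho> *\<^sub>R w))"
        by (rule symb_mult[OF I(1) I0 symb_const[OF I0] Ci(1)]) (use Ci in auto)
      moreover have "2 ^ k * \<bar>w $ i\<bar> * C i \<le> 2 ^ k * E * C i"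
        using component_le_norm_cart[of w i] w Ci(2) by (intro mult_right_mono mult_left_mono) auto
      ultimately show "symb I k (2 ^ k * E * C i) (\<lambda>_. 1) (\<lambda>\<rho>. w $ i * partial_deriv i g (x + \<rho> *\<^sub>R w))"
        by (rule_tac symb_mono[where C = "2 ^ k * \<bar>w $ i\<bar> * C i"]) (use I0 in auto)
    qed auto
    then have "symb I k (B + L * C1) (\<lambda>\<rho>. 1 / \<rho>) (deriv (\<lambda>\<rho>. g (x + \<rho> *\<^sub>R w)))"
      unfolding du
    proof (rule symb_weight_mono[OF _ _ I0])
      fix \<rho> assume "\<rho> \<in> I"
      then have \<rho>: "0 < \<rho>" "\<rho> < L" using I by auto
      have "C1 * \<rho> \<le> C1 * L" using C1 \<rho> by (intro mult_left_mono) auto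
      then show "C1 * 1 \<le> (B + L * C1) * (1 / \<rho>)" using \<rho> B(1) by (simp add: field_simps)
    qed
    moreover have "\<bar>g (x + \<rho> *\<^sub>R w)\<bar> \<le> (B + L * C1) * 1" for \<rho>
    proof -
      have "0 \<le> L * C1" using C1 assms(3) by simp
      then show ?thesis using gB[of "x + \<rho> *\<^sub>R w"] by simp
    qed
    moreover have "(\<lambda>\<rho>. g (x + \<rho> *\<^sub>R w)) differentiable (at \<rho>)" for \<rho>
      using d[OF gd] unfolding real_differentiable_def by blast
    ultimately show ?thesis by simp
  qed
  moreover have "0 \<le> B + L * C1" using B(1) C1 assms(3) by simp
  ultimately show ?case by (intro exI[of _ "B + L * C1"] conjI allI impI)
qed

section \<open>Differentiability of f, its gradient, and the area element\<close>

context convex_analytic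
begin

lemma continuous_f: "continuous_on U f"
  using open_U cvx by (rule convex_on_continuous)

text \<open>The coefficients of order at least 2 share one bound, so for
  \<open>s \<le> 1 / 2\<close> a geometric series controls the remainder, uniformly in base point
  and direction. This yields both total differentiability and local boundedness of the
  gradient.\<close>

lemma local_linearization:
  assumes "a \<in> U"
  shows "\<exists>r>0. \<exists>C\<ge>0. \<forall>x\<in>ball a r. x \<in> U \<longrightarrow> (\<forall>w. norm w \<le> r \<longrightarrow> \<bar>dd f 1 x w\<bar> \<le> C \<and>
      (\<forall>s. 0 \<le> s \<longrightarrow> s \<le> 1 / 2 \<longrightarrow> \<bar>f (x + s *\<^sub>R w) - f x - dd f 1 x (s *\<^sub>R w)\<bar> \<le> C * s\<^sup>2))"
proof -
  obtain r C N b where r: "0 < r" and C: "0 \<le> C" and b0: "\<forall>x\<in>ball a r. \<forall>w. norm w \<le> r \<longrightarrow> expands_along f (b x w) C N x w"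
    using local_expansion[OF ana assms] by (elim exE conjE)
  note b = b0[unfolded expands_along_def]
  have "\<bar>dd f 1 x w\<bar> \<le> 2 * C \<and>
      (\<forall>s. 0 \<le> s \<longrightarrow> s \<le> 1 / 2 \<longrightarrow> \<bar>f (x + s *\<^sub>R w) - f x - dd f 1 x (s *\<^sub>R w)\<bar> \<le> 2 * C * s\<^sup>2)"
    if x: "x \<in> ball a r" "x \<in> U" and w: "norm w \<le> r" for x w
  proof -
    let ?b = "b x w"
    have ser: "(\<lambda>k. ?b k * s ^ k) sums f (x + s *\<^sub>R w)" if "\<bar>s\<bar> \<le> 1" for s
      using b[THEN bspec, OF x(1), THEN spec, THEN mp, OF w, THEN conjunct1, THEN spec, THEN mp, OF that] .
    have bC: "\<bar>?b k\<bar> \<le> C" for k using b x w by blast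
    have b1: "dd f 1 x w = ?b 1"
      using dd_eq_coeff[of 1 ?b f x w 1] ser by (simp add: diffs_one_def diffs_def)
    have b0: "?b 0 = f x"
      using dd_eq_coeff[of 1 ?b f x w 0] ser by (simp add: diffs_one_def)
    have "\<bar>f (x + s *\<^sub>R w) - f x - dd f 1 x (s *\<^sub>R w)\<bar> \<le> 2 * C * s\<^sup>2" if s: "0 \<le> s" "s \<le> 1 / 2" for s
    proof -
      have "(\<lambda>k. ?b (k + 2) * s ^ (k + 2)) sums (f (x + s *\<^sub>R w) - (\<Sum>k<2. ?b k * s ^ k))"
        using ser[of s] s by (subst sums_iff_shift) simp
      also have "(\<Sum>k<2. ?b k * s ^ k) = f x + dd f 1 x (s *\<^sub>R w)"
      proof -
        have "(\<Sum>k<2. ?b k * s ^ k) = ?b 0 + s * ?b 1" by (simp add: numeral_2_eq_2)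
        then show ?thesis by (simp only: b0 b1[symmetric] dd_scale[OF x(2)] power_one_right)
      qed
      finally have sm: "(\<lambda>k. ?b (k + 2) * s ^ (k + 2)) sums (f (x + s *\<^sub>R w) - (f x + dd f 1 x (s *\<^sub>R w)))" .
      have gs: "(\<lambda>k. C * s\<^sup>2 * (1 / 2) ^ k) sums (C * s\<^sup>2 * 2)"
        using sums_mult[OF geometric_sums[of "1 / 2 :: real"], of "C * s\<^sup>2"] by simp
      have "norm (?b (k + 2) * s ^ (k + 2)) \<le> C * s\<^sup>2 * (1 / 2) ^ k" for k
      proof -
        have "\<bar>?b (k + 2)\<bar> * (s ^ k * s\<^sup>2) \<le> C * ((1 / 2) ^ k * s\<^sup>2)"
          using bC C s by (intro mult_mono mult_right_mono power_mono) auto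
        then show ?thesis using s by (simp add: abs_mult power_add mult_ac power2_eq_square)
      qed
      from norm_suminf_le[OF this sums_summable[OF gs]] show ?thesis
        unfolding sums_unique[OF sm, symmetric] sums_unique[OF gs, symmetric] by (simp add: algebra_simps)
    qed
    moreover have "\<bar>dd f 1 x w\<bar> \<le> 2 * C" using b1 bC[of 1] C by simp
    ultimately show ?thesis by blast
  qed
  then show ?thesis using r C by (intro exI[of _ r] conjI exI[of _ "2 * C"]) auto
qed

lemma linear_dd: "y \<in> U \<Longrightarrow> linear (dd f 1 y)"
  using dd_add dd_scale[of y 1] by (intro linearI) auto

text \<open>Directional derivatives alone would not suffice: linearity comes from
  \<open>dd_add\<close>, and the remainder estimate is uniform over directions.\<close>

lemma has_derivative_dd:
  assumes "y \<in> U"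
  shows "(f has_derivative dd f 1 y) (at y)"
  unfolding has_derivative_at_alt
proof (intro conjI allI impI)
  show "bounded_linear (dd f 1 y)"
    using linear_dd[OF assms] by (simp add: linear_conv_bounded_linear)
  fix e :: real assume e: "0 < e"
  obtain r C where r: "0 < r" and C: "0 \<le> C" and loc: "\<forall>x\<in>ball y r. x \<in> U \<longrightarrow> (\<forall>w. norm w \<le> r \<longrightarrow> \<bar>dd f 1 x w\<bar> \<le> C \<and>
      (\<forall>s. 0 \<le> s \<longrightarrow> s \<le> 1 / 2 \<longrightarrow> \<bar>f (x + s *\<^sub>R w) - f x - dd f 1 x (s *\<^sub>R w)\<bar> \<le> C * s\<^sup>2))"
    using local_linearization[OF assms] by (elim exE conjE)
  \<comment> \<open>Chosen so that the remainder C (norm (z - y) / r)^2 is at most e times norm (z -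
    y).\<close>
  define d where "d = min (r / 2) (e * r\<^sup>2 / (C + 1))"
  have d: "0 < d" "d \<le> r / 2" using r e C unfolding d_def by (simp, linarith)
  have "d \<le> e * r\<^sup>2 / (C + 1)" by (simp add: d_def)
  then have d3: "d * (C + 1) \<le> e * r\<^sup>2" using C by (simp add: pos_le_divide_eq)
  show "\<exists>d>0. \<forall>z. norm (z - y) < d \<longrightarrow> norm (f z - f y - dd f 1 y (z - y)) \<le> e * norm (z - y)"
  proof (intro exI[of _ d] conjI allI impI d(1))
    fix z assume z: "norm (z - y) < d"
    show "norm (f z - f y - dd f 1 y (z - y)) \<le> e * norm (z - y)"
    proof (cases "z = y")
      case True
      then show ?thesis using linear_0[OF linear_dd[OF assms]] by simp
    next
      case False
      define s where "s = norm (z - y) / r"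
      define w where "w = (1 / s) *\<^sub>R (z - y)"
      have s: "0 < s" "s \<le> 1 / 2" using False r z d by (auto simp: s_def field_simps)
      have w: "norm w \<le> r" "s *\<^sub>R w = z - y" using s False r by (auto simp: w_def s_def)
      have "\<bar>f (y + s *\<^sub>R w) - f y - dd f 1 y (s *\<^sub>R w)\<bar> \<le> C * s\<^sup>2"
        using loc assms r w(1) s by (simp add: less_imp_le)
      then have "\<bar>f z - f y - dd f 1 y (z - y)\<bar> \<le> C * s\<^sup>2" by (simp add: w(2))
      also have "\<dots> \<le> e * norm (z - y)"
      proof -
        have "norm (z - y) * C \<le> d * (C + 1)" using z C d(1) by (intro mult_mono) auto
        then have "norm (z - y) * C \<le> e * r\<^sup>2" using d3 by linarith
        then have "norm (z - y) * (norm (z - y) * C) \<le> norm (z - y) * (e * r\<^sup>2)" by (intro mult_left_mono) auto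
        then show ?thesis using r by (simp add: s_def power_divide power2_eq_square divide_le_eq mult_ac)
      qed
      finally show ?thesis by simp
    qed
  qed
qed

lemma gradient_inner:
  assumes "y \<in> U"
  shows "w \<bullet> gradient f y = dd f 1 y w"
proof -
  define d where "d = (\<Sum>b\<in>Basis. dd f 1 y b *\<^sub>R b)"
  note lin = linear_dd[OF assms]
  have eq: "h \<bullet> d = dd f 1 y h" for h
  proof -
    have "dd f 1 y h = dd f 1 y (\<Sum>b\<in>Basis. (h \<bullet> b) *\<^sub>R b)" by (simp add: euclidean_representation)
    also have "\<dots> = (\<Sum>b\<in>Basis. (h \<bullet> b) * dd f 1 y b)"
      by (simp only: linear_sum[OF lin] linear_scale[OF lin] real_scaleR_def)
    finally show ?thesis by (simp add: d_def inner_sum_right mult.commute)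
  qed
  have "gradient f y = d"
    unfolding gradient_def
  proof (rule the_equality)
    show "GDERIV f y :> d" unfolding gderiv_def eq using has_derivative_dd[OF assms] by (simp add: eta_contract_eq)
    fix d' assume "GDERIV f y :> d'"
    then have "(f has_derivative (\<lambda>h. h \<bullet> d')) (at y)" by (simp add: gderiv_def)
    from has_derivative_unique[OF this has_derivative_dd[OF assms]] have "h \<bullet> d' = h \<bullet> d" for h
      using eq by metis
    then show "d' = d" by (metis vector_eq_ldot)
  qed
  then show ?thesis using eq by simp
qed

text \<open>Used for the finiteness of the surface measure over compact sets.\<close>

lemma gradient_bounded:
  assumes K: "compact K" "K \<subseteq> U"
  shows "\<exists>B. \<forall>y\<in>K. norm (gradient f y) \<le> B"
proof -
  have "\<forall>a\<in>K. \<exists>r B. 0 < r \<and> (\<forall>x\<in>ball a r \<inter> U. norm (gradient f x) \<le> B)"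
  proof
    fix a assume "a \<in> K"
    then have "a \<in> U" using K by blast
    from local_linearization[OF this] obtain r C where r: "0 < r" and C: "0 \<le> C"
      and loc: "\<forall>x\<in>ball a r. x \<in> U \<longrightarrow> (\<forall>w. norm w \<le> r \<longrightarrow> \<bar>dd f 1 x w\<bar> \<le> C \<and>
      (\<forall>s. 0 \<le> s \<longrightarrow> s \<le> 1 / 2 \<longrightarrow> \<bar>f (x + s *\<^sub>R w) - f x - dd f 1 x (s *\<^sub>R w)\<bar> \<le> C * s\<^sup>2))"
      by (elim exE conjE)
    have "norm (gradient f x) \<le> C / r" if x: "x \<in> ball a r \<inter> U" for x
    proof -
      let ?g = "gradient f x"
      \<comment> \<open>The direction of the gradient, scaled to the admissible length
        \<open>r\<close>, recovers its norm.\<close>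
      have "\<bar>dd f 1 x (r *\<^sub>R sgn ?g)\<bar> \<le> C" using loc x r by (simp add: norm_sgn)
      moreover have "dd f 1 x (r *\<^sub>R sgn ?g) = r * norm ?g"
      proof -
        have "(r *\<^sub>R sgn ?g) \<bullet> ?g = r * norm ?g"
          by (cases "?g = 0") (simp_all add: sgn_div_norm dot_square_norm power2_eq_square)
        moreover have "x \<in> U" using x by simp
        ultimately show ?thesis by (simp only: gradient_inner)
      qed
      ultimately show ?thesis using r by (simp add: field_simps)
    qed
    then show "\<exists>r B. 0 < r \<and> (\<forall>x\<in>ball a r \<inter> U. norm (gradient f x) \<le> B)" using r by blast
  qed
  then obtain r B where rB: "\<And>a. a \<in> K \<Longrightarrow> 0 < r a" "\<And>a x. a \<in> K \<Longrightarrow> x \<in> ball a (r a) \<inter> U \<Longrightarrow> norm (gradient f x) \<le> B a"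
    by metis
  have "K \<subseteq> (\<Union>a\<in>K. ball a (r a))" using rB(1) by auto
  then obtain A where A: "A \<subseteq> K" "finite A" "K \<subseteq> (\<Union>a\<in>A. ball a (r a))"
    using compactE_image[OF K(1), of K "\<lambda>a. ball a (r a)"] by auto
  have "norm (gradient f y) \<le> (\<Sum>a\<in>A. \<bar>B a\<bar>)" if y: "y \<in> K" for y
  proof -
    obtain a where a: "a \<in> A" "y \<in> ball a (r a)" using A(3) y by blast
    have "norm (gradient f y) \<le> \<bar>B a\<bar>" using rB(2)[of a y] a A(1) y K(2) by fastforce
    also have "\<dots> \<le> (\<Sum>a\<in>A. \<bar>B a\<bar>)" using a A(2) by (intro member_le_sum) auto
    finally show ?thesis .
  qed
  then show ?thesis by blast
qed

lemma measurable_f: "f \<in> borel_measurable (restrict_space lborel U)"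
  using borel_measurable_continuous_on_restrict[OF continuous_f]
  by (simp add: measurable_def sets_restrict_space space_restrict_space)

text \<open>Each component is a limit of difference quotients. Extending \<open>f\<close> by 0 to
  \<open>F\<close> makes the quotients Borel on the whole space; since \<open>U\<close> is open,
  they agree with those of \<open>f\<close> from some index on.\<close>

lemma measurable_gradient: "gradient f \<in> borel_measurable (restrict_space lborel U)"
  unfolding borel_measurable_euclidean_space[of "gradient f"]
proof
  fix i :: "real^'n"
  define F where "F x = indicator U x *\<^sub>R f x" for x
  have [measurable]: "F \<in> borel_measurable borel"
    unfolding F_def[abs_def] using open_U continuous_f by (intro borel_measurable_continuous_on_indicator) auto
  show "(\<lambda>x. gradient f x \<bullet> i) \<in> borel_measurable (restrict_space lborel U)"
  proof (rule borel_measurable_LIMSEQ_real)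
    show "(\<lambda>x. (F (x + (1 / real (Suc n)) *\<^sub>R i) - F x) * real (Suc n)) \<in> borel_measurable (restrict_space lborel U)" for n
      by (rule measurable_restrict_space1) measurable
    fix x assume "x \<in> space (restrict_space lborel U)"
    then have x: "x \<in> U" by (simp add: space_restrict_space)
    have "((\<lambda>h. (f (x + (0 + h) *\<^sub>R i) - f (x + 0 *\<^sub>R i)) / h) \<longlongrightarrow> dd f 1 x i) (at 0)"
      using line_has_derivative0[OF x, of i] by (simp only: DERIV_def)
    then have lim: "((\<lambda>h. (f (x + h *\<^sub>R i) - f x) / h) \<longlongrightarrow> dd f 1 x i) (at 0)" by simp
    have "filterlim (\<lambda>n. 1 / real (Suc n)) (at 0) sequentially"
      unfolding filterlim_at using LIMSEQ_inverse_real_of_nat by (simp add: inverse_eq_divide)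
    from filterlim_compose[OF lim this]
    have "(\<lambda>n. (f (x + (1 / real (Suc n)) *\<^sub>R i) - f x) * real (Suc n)) \<longlonglongrightarrow> dd f 1 x i" by simp
    moreover have "eventually (\<lambda>n. (f (x + (1 / real (Suc n)) *\<^sub>R i) - f x) * real (Suc n) =
        (F (x + (1 / real (Suc n)) *\<^sub>R i) - F x) * real (Suc n)) sequentially"
    proof -
      have "(\<lambda>n. x + (1 / real (Suc n)) *\<^sub>R i) \<longlonglongrightarrow> x + 0 *\<^sub>R i"
        using LIMSEQ_inverse_real_of_nat by (intro tendsto_intros) (simp add: inverse_eq_divide)
      then have "eventually (\<lambda>n. x + (1 / real (Suc n)) *\<^sub>R i \<in> U) sequentially"
        using open_U x by (intro topological_tendstoD) auto
      then show ?thesis by eventually_elim (use x in \<open>simp add: F_def\<close>)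
    qed
    ultimately have "(\<lambda>n. (F (x + (1 / real (Suc n)) *\<^sub>R i) - F x) * real (Suc n)) \<longlonglongrightarrow> dd f 1 x i"
      by (rule Lim_transform_eventually)
    then show "(\<lambda>n. (F (x + (1 / real (Suc n)) *\<^sub>R i) - F x) * real (Suc n)) \<longlonglongrightarrow> gradient f x \<bullet> i"
      unfolding inner_commute[of "gradient f x"] gradient_inner[OF x] .
  qed
qed

text \<open>The area element is at least 1. Finiteness has to be shown as well, because
  \<open>measure\<close> is 0 on sets of infinite measure.\<close>

proposition lebesgue_le_surface_measure:
  assumes K: "compact K" "K \<subseteq> U" and X: "X \<in> sets borel" "X \<subseteq> K" and S: "S \<in> sets borel"
    and XS: "\<And>x. x \<in> U \<Longrightarrow> (x, f x) \<in> S \<longleftrightarrow> x \<in> X"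
  shows "emeasure lborel X \<le> ennreal (measure (graph_surface_measure U f) S)"
proof -
  let ?M = "restrict_space lborel U"
  let ?d = "\<lambda>x. ennreal (sqrt (1 + (norm (gradient f x))\<^sup>2))"
  obtain B where B: "\<And>y. y \<in> K \<Longrightarrow> norm (gradient f y) \<le> B" using gradient_bounded[OF K] by blast
  have U: "U \<in> sets lborel" using open_U by auto
  have XU: "X \<subseteq> U" using X K by auto
  have [measurable]: "f \<in> borel_measurable ?M" "gradient f \<in> borel_measurable ?M"
    by (rule measurable_f measurable_gradient)+
  have [measurable]: "(\<lambda>x. x) \<in> measurable ?M borel" by (rule measurable_restrict_space1) simp
  have T [measurable]: "(\<lambda>x. (x, f x)) \<in> measurable ?M borel" by measurable
  have XM [measurable]: "X \<in> sets ?M" using X(1) XU U by (auto simp: sets_restrict_space_iff)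
  have "emeasure (graph_surface_measure U f) S = emeasure (density ?M ?d) ((\<lambda>x. (x, f x)) -` S \<inter> space (density ?M ?d))"
    unfolding graph_surface_measure_def using S T by (intro emeasure_distr) auto
  also have "(\<lambda>x. (x, f x)) -` S \<inter> space (density ?M ?d) = X"
    using XS XU by (auto simp: space_restrict_space)
  also have "emeasure (density ?M ?d) X = (\<integral>\<^sup>+x. ?d x * indicator X x \<partial>?M)"
    by (rule emeasure_density) measurable
  finally have eq: "emeasure (graph_surface_measure U f) S = (\<integral>\<^sup>+x. ?d x * indicator X x \<partial>?M)" .
  have emX: "(\<integral>\<^sup>+x. indicator X x \<partial>?M) = emeasure lborel X"
    using XU U by (simp add: emeasure_restrict_space)
  have "emeasure lborel X \<le> emeasure (graph_surface_measure U f) S"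
    unfolding eq emX[symmetric]
  proof (rule nn_integral_mono)
    fix x
    have "1 \<le> sqrt (1 + (norm (gradient f x))\<^sup>2)" by simp
    then have "1 \<le> ?d x" by (metis ennreal_1 ennreal_leI)
    then show "indicator X x \<le> ?d x * indicator X x" by (simp add: indicator_def)
  qed
  also have "emeasure (graph_surface_measure U f) S \<noteq> \<infinity>"
  proof -
    have "emeasure (graph_surface_measure U f) S \<le> (\<integral>\<^sup>+x. ennreal (sqrt (1 + B\<^sup>2)) * indicator X x \<partial>?M)"
      unfolding eq
    proof (rule nn_integral_mono)
      fix x
      show "?d x * indicator X x \<le> ennreal (sqrt (1 + B\<^sup>2)) * indicator X x"
        using B[of x] X(2) by (auto simp: indicator_def intro!: ennreal_leI power_mono)
    qed
    also have "\<dots> = ennreal (sqrt (1 + B\<^sup>2)) * emeasure lborel X"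
      by (subst nn_integral_cmult) (simp_all add: emX del: nn_integral_indicator)
    also have "\<dots> < \<infinity>"
    proof -
      have "emeasure lborel X \<le> emeasure lborel K"
        using X K by (intro emeasure_mono) (auto intro: borel_compact)
      also have "\<dots> < \<infinity>" using emeasure_compact_finite[OF K(1)] by simp
      finally show ?thesis by (simp add: ennreal_mult_less_top)
    qed
    finally show ?thesis by simp
  qed
  then have "emeasure (graph_surface_measure U f) S = ennreal (measure (graph_surface_measure U f) S)"
    by (intro emeasure_eq_ennreal_measure) simp
  finally show ?thesis .
qed

end

section \<open>The estimate along rays\<close>

text \<open>Lets the successive derivatives be given in closed form as \<open>q i\<close> instead of
  by iterating \<open>deriv\<close>.\<close>

lemma symb_derivatives:
  assumes "open I" "\<And>i \<rho>. i \<le> k \<Longrightarrow> \<rho> \<in> I \<Longrightarrow> \<bar>q i \<rho>\<bar> \<le> C * W \<rho> / \<rho> ^ i"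
    "\<And>i \<rho>. i < k \<Longrightarrow> \<rho> \<in> I \<Longrightarrow> (q i has_real_derivative q (Suc i) \<rho>) (at \<rho>)"
  shows "symb I k C W (q 0)"
  using assms(2,3)
proof (induction k arbitrary: q W)
  case 0
  then show ?case by fastforce
next
  case (Suc k)
  have "symb I k C (\<lambda>\<rho>. W \<rho> / \<rho>) (q (Suc 0))"
  proof (rule Suc.IH[of "\<lambda>i. q (Suc i)"])
    show "\<bar>q (Suc i) \<rho>\<bar> \<le> C * (W \<rho> / \<rho>) / \<rho> ^ i" if "i \<le> k" "\<rho> \<in> I" for i \<rho>
      using Suc.prems(1)[of "Suc i" \<rho>] that by simp
    show "(q (Suc i) has_real_derivative q (Suc (Suc i)) \<rho>) (at \<rho>)" if "i < k" "\<rho> \<in> I" for i \<rho>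
      using Suc.prems(2)[of "Suc i" \<rho>] that by simp
  qed
  also have "?this \<longleftrightarrow> symb I k C (\<lambda>\<rho>. W \<rho> / \<rho>) (deriv (q 0))"
    by (intro symb_cong[OF assms(1)] DERIV_imp_deriv[symmetric] Suc.prems(2)) auto
  finally have "symb I k C (\<lambda>\<rho>. W \<rho> / \<rho>) (deriv (q 0))" .
  moreover have "q 0 differentiable (at \<rho>)" if "\<rho> \<in> I" for \<rho>
    using Suc.prems(2)[of 0 \<rho>] that unfolding real_differentiable_def by blast
  moreover have "\<bar>q 0 \<rho>\<bar> \<le> C * W \<rho>" if "\<rho> \<in> I" for \<rho>
    using Suc.prems(1)[of 0 \<rho>] that by simp
  ultimately show ?case by simp
qed

lemma lborel_integral_half_line:
  fixes G :: "real \<Rightarrow> complex"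
  assumes "continuous_on {0..b} G" "\<And>\<sigma>. b < \<sigma> \<Longrightarrow> G \<sigma> = 0"
  shows "(\<integral>\<sigma>. indicator {0<..} \<sigma> *\<^sub>R G \<sigma> \<partial>lborel) = integral {0..b} G"
proof -
  have si: "set_integrable lborel {0..b} G" using assms(1) by (rule borel_integrable_atLeastAtMost')
  then have [measurable]: "(\<lambda>\<sigma>. indicator {0..b} \<sigma> *\<^sub>R G \<sigma>) \<in> borel_measurable borel"
    unfolding set_integrable_def by (auto dest: borel_measurable_integrable)
  have eq: "indicator {0<..} \<sigma> *\<^sub>R G \<sigma> = indicator {0<..} \<sigma> *\<^sub>R (indicator {0..b} \<sigma> *\<^sub>R G \<sigma>)" for \<sigma>
    using assms(2)[of \<sigma>] by (cases "b < \<sigma>") (auto simp: indicator_def)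
  have "(\<integral>\<sigma>. indicator {0<..} \<sigma> *\<^sub>R G \<sigma> \<partial>lborel) = (\<integral>\<sigma>. indicator {0..b} \<sigma> *\<^sub>R G \<sigma> \<partial>lborel)"
    unfolding eq
  proof (rule integral_cong_AE)
    have "AE \<sigma> in lborel. \<sigma> \<noteq> (0 :: real)" by (rule AE_lborel_singleton)
    then show "AE \<sigma> in lborel. indicator {0<..} \<sigma> *\<^sub>R (indicator {0..b} \<sigma> *\<^sub>R G \<sigma>) = indicator {0..b} \<sigma> *\<^sub>R G \<sigma>"
      by eventually_elim (auto simp: indicator_def)
  qed measurable
  also have "\<dots> = integral {0..b} G"
    using set_borel_integral_eq_integral(2)[OF si] by (simp add: set_lebesgue_integral_def)
  finally show ?thesis .
qed

definition phase :: "('a::real_inner \<Rightarrow> real) \<Rightarrow> 'a \<times> real \<Rightarrow> 'a \<Rightarrow> real" where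
  "phase f v x = fst v \<bullet> x + snd v * f x"

definition wave :: "('a::real_inner \<Rightarrow> real) \<Rightarrow> ('a \<Rightarrow> real) \<Rightarrow> real \<Rightarrow> 'a \<times> real \<Rightarrow> 'a \<Rightarrow> complex" where
  "wave f \<phi> t v x = exp (- \<i> * of_real (t * phase f v x)) * of_real (\<phi> x)"

text \<open>Normalizing the phase by its minimum \<open>s\<close> costs only a factor of modulus
  1.\<close>

lemma wave_eq_osc:
  "of_real (\<sigma> ^ m) * wave f \<phi> t v (x0 + \<sigma> *\<^sub>R \<omega>) =
     exp (- \<i> * of_real (t * s)) * osc (\<lambda>\<sigma>. t * (phase f v (x0 + \<sigma> *\<^sub>R \<omega>) - s)) (\<lambda>\<sigma>. \<phi> (x0 + \<sigma> *\<^sub>R \<omega>) * \<sigma> ^ m) \<sigma>"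
proof -
  have "exp (- \<i> * of_real (t * P)) = exp (- \<i> * of_real (t * s)) * cis (- (t * (P - s)))" for P
    unfolding cis_conv_exp exp_add[symmetric] by (rule arg_cong[where f = exp]) (simp add: algebra_simps)
  from this[of "phase f v (x0 + \<sigma> *\<^sub>R \<omega>)"] show ?thesis
    unfolding wave_def osc_def by (simp only: of_real_mult mult_ac)
qed

lemma norm_wave [simp]: "norm (wave f \<phi> t v x) = \<bar>\<phi> x\<bar>"
  by (simp add: wave_def norm_mult)

text \<open>Past \<open>R\<close> the ray is outside the cap of height 1 / t or outside the ball.
  When the cap contains the ray up to \<open>R\<close>, the bound is a multiple of its share of the
  volume, R^n / n. \<open>C\<close> is fixed before \<open>v\<close>, \<open>t\<close>,
  \<open>x0\<close>, \<open>\<omega>\<close> and \<open>R\<close>.\<close>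

definition ray_estimate :: "(real^'n \<Rightarrow> real) \<Rightarrow> (real^'n \<Rightarrow> real) \<Rightarrow> real \<Rightarrow> real \<Rightarrow> bool" where
  "ray_estimate f \<phi> r0 C \<longleftrightarrow> (\<forall>v t x0 \<omega> R. 0 \<le> snd v \<longrightarrow> 0 < t \<longrightarrow> x0 \<in> cball 0 r0 \<longrightarrow>
     (\<forall>x\<in>cball 0 r0. phase f v x0 \<le> phase f v x) \<longrightarrow> \<omega> \<in> thick_sphere \<longrightarrow> 0 \<le> R \<longrightarrow>
     (\<forall>\<sigma>>R. x0 + \<sigma> *\<^sub>R \<omega> \<in> cball 0 r0 \<longrightarrow> phase f v x0 + 1 / t < phase f v (x0 + \<sigma> *\<^sub>R \<omega>)) \<longrightarrow>
     norm (\<integral>\<sigma>. indicator {0<..} \<sigma> *\<^sub>R (of_real (\<sigma> ^ (CARD('n) - 1)) * wave f \<phi> t v (x0 + \<sigma> *\<^sub>R \<omega>)) \<partial>lborel)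
       \<le> C * R ^ CARD('n))"

context convex_analytic
begin

lemma phase_has_derivative:
  assumes "x0 + \<sigma> *\<^sub>R \<omega> \<in> U"
  shows "((\<lambda>\<sigma>. phase f v (x0 + \<sigma> *\<^sub>R \<omega>)) has_real_derivative
     (fst v \<bullet> \<omega> + snd v * dd f 1 (x0 + \<sigma> *\<^sub>R \<omega>) \<omega>)) (at \<sigma>)"
proof -
  have "((\<lambda>\<sigma>. fst v \<bullet> x0 + \<sigma> * (fst v \<bullet> \<omega>)) has_real_derivative fst v \<bullet> \<omega>) (at \<sigma>)"
    by (auto intro!: derivative_eq_intros)
  moreover have "(\<lambda>\<sigma>. fst v \<bullet> (x0 + \<sigma> *\<^sub>R \<omega>)) = (\<lambda>\<sigma>. fst v \<bullet> x0 + \<sigma> * (fst v \<bullet> \<omega>))"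
    by (simp add: inner_add_right)
  ultimately have "((\<lambda>\<sigma>. fst v \<bullet> (x0 + \<sigma> *\<^sub>R \<omega>)) has_real_derivative fst v \<bullet> \<omega>) (at \<sigma>)" by simp
  then show ?thesis
    unfolding phase_def by (intro DERIV_add DERIV_cmult line_has_derivative1 assms)
qed

lemma phase_tangent:
  assumes "x0 \<in> U" "x0 + \<sigma> *\<^sub>R \<omega> \<in> U" "0 \<le> snd v"
  shows "phase f v (x0 + \<sigma> *\<^sub>R \<omega>) - phase f v x0 \<le> \<sigma> * (fst v \<bullet> \<omega> + snd v * dd f 1 (x0 + \<sigma> *\<^sub>R \<omega>) \<omega>)"
proof -
  have "x0 + \<sigma> *\<^sub>R \<omega> + (- \<sigma>) *\<^sub>R \<omega> = x0" by simp
  then have "dd f 1 (x0 + \<sigma> *\<^sub>R \<omega>) ((- \<sigma>) *\<^sub>R \<omega>) \<le> f x0 - f (x0 + \<sigma> *\<^sub>R \<omega>)"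
    using dd_tangent[of "x0 + \<sigma> *\<^sub>R \<omega>" "(- \<sigma>) *\<^sub>R \<omega>"] assms by simp
  then have "f (x0 + \<sigma> *\<^sub>R \<omega>) - f x0 \<le> \<sigma> * dd f 1 (x0 + \<sigma> *\<^sub>R \<omega>) \<omega>"
    unfolding dd_scale[OF assms(2)] by simp
  from mult_left_mono[OF this assms(3)] show ?thesis
    by (simp add: phase_def inner_add_right algebra_simps)
qed

lemma phase_convex:
  assumes "0 \<le> snd v"
  shows "convex_on U (phase f v)"
  unfolding phase_def[abs_def]
proof (rule convex_on_add)
  show "convex_on U (\<lambda>x. fst v \<bullet> x)"
    using convex_U by (intro convex_onI) (auto simp: inner_add_right)
  show "convex_on U (\<lambda>x. snd v * f x)"
    using assms cvx by (rule convex_on_cmul)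
qed

lemma phase_continuous: "continuous_on U (phase f v)"
  unfolding phase_def[abs_def] by (intro continuous_intros continuous_f)


text \<open>\<open>f\<close> is controlled only on \<open>U\<close>; the open ball and the
  complement of the smaller closed ball, where the amplitude vanishes, are open and cover the
  space.\<close>

lemma wave_continuous:
  assumes "cball 0 r0 \<subseteq> U" "r1 < r0" "continuous_on UNIV \<phi>" "\<And>x. \<phi> x \<noteq> 0 \<Longrightarrow> norm x \<le> r1"
  shows "continuous_on UNIV (wave f \<phi> t v)"
proof -
  have "continuous_on (ball 0 r0) (wave f \<phi> t v)"
    unfolding wave_def[abs_def] using assms(1)
    by (intro continuous_intros continuous_on_subset[OF phase_continuous] continuous_on_subset[OF assms(3)]) auto
  moreover have "continuous_on (- cball 0 r1) (wave f \<phi> t v)"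
  proof -
    have "wave f \<phi> t v x = 0" if "x \<in> - cball 0 r1" for x
      using assms(4)[of x] that by (auto simp: wave_def)
    then have "continuous_on (- cball 0 r1) (wave f \<phi> t v) \<longleftrightarrow> continuous_on (- cball 0 r1) (\<lambda>_ :: real^'n. 0 :: complex)"
      by (intro continuous_on_cong) auto
    then show ?thesis by simp
  qed
  ultimately have "continuous_on (ball 0 r0 \<union> - cball 0 r1) (wave f \<phi> t v)"
    by (intro continuous_on_open_Un) auto
  moreover have "ball 0 r0 \<union> - cball 0 r1 = (UNIV :: (real^'n) set)" using assms(2) by auto
  ultimately show ?thesis by simp
qed

text \<open>Up to \<open>R\<close> a bound for the amplitude suffices, since \<sigma>^(n - 1)
  integrates to at most R^n. Beyond \<open>R\<close>, \<open>osc_bound\<close> applies to the phase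
  \<open>h\<close>, normalized to vanish at \<open>x0\<close>.\<close>

proposition ray_bound:
  assumes r0: "0 < r0" "cball 0 r0 \<subseteq> U" "r1 < r0"
    and \<phi>: "C_k (Suc CARD('n)) \<phi>" "\<And>x. \<phi> x \<noteq> 0 \<Longrightarrow> norm x \<le> r1"
  shows "\<exists>C\<ge>0. ray_estimate f \<phi> r0 C"
proof -
  define n where "n = CARD('n)"
  have n: "1 \<le> n" by (simp add: n_def Suc_le_eq)
  have \<phi>c: "continuous_on UNIV \<phi>" using C_k_continuous[OF \<phi>(1)] .
  obtain B\<phi> where B\<phi>0: "0 \<le> B\<phi>" and B\<phi>': "\<And>x. x \<in> cball 0 r1 \<Longrightarrow> \<bar>\<phi> x\<bar> \<le> B\<phi>"
    using abs_bounded_on_compact[OF compact_cball continuous_on_subset[OF \<phi>c]] by blast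
  have B\<phi>: "\<bar>\<phi> x\<bar> \<le> B\<phi>" for x using B\<phi>'[of x] B\<phi>0 \<phi>(2)[of x] by (cases "\<phi> x = 0") auto
  \<comment> \<open>Since norm \<omega> >= 1 and \<open>x0\<close> is in the ball, the ray can be in
    the ball only for \<sigma> < 2 r0 + 1.\<close>
  have L: "1 \<le> 2 * r0 + 1" "0 \<le> exp (1 :: real)" using r0 by auto
  have out: "\<phi> x = 0" if "x \<notin> cball 0 r1" for x using \<phi>(2)[of x] that by auto
  have "\<exists>C\<ge>0. \<forall>I x w. open I \<longrightarrow> I \<subseteq> {0<..<2 * r0 + 1} \<longrightarrow> norm w \<le> exp 1 \<longrightarrow>
      symb I (Suc n) C (\<lambda>_. 1) (\<lambda>\<rho>. \<phi> (x + \<rho> *\<^sub>R w))"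
    unfolding n_def by (rule C_k_line[OF compact_cball[of 0 r1] L(2,1) \<phi>(1)]) (rule out)
  then obtain C\<psi> where C\<psi>: "0 \<le> C\<psi>" "\<forall>I x w. open I \<longrightarrow> I \<subseteq> {0<..<2 * r0 + 1} \<longrightarrow> norm w \<le> exp 1 \<longrightarrow>
      symb I (Suc n) C\<psi> (\<lambda>_. 1) (\<lambda>\<rho>. \<phi> (x + \<rho> *\<^sub>R w))"
    by (elim exE conjE)
  \<comment> \<open>\<open>p\<close> is a first derivative of the phase and needs symbol estimates
    up to order n + 1, hence n + 2.\<close>
  obtain D where D: "0 \<le> D" "\<forall>x w. x \<in> cball 0 r0 \<longrightarrow> x + w \<in> cball 0 r0 \<longrightarrow>
           (\<forall>j\<in>{2..n + 2}. \<bar>dd f j (x + w) w\<bar> \<le> D * (dd f 1 (x + w) w - dd f 1 x w))"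
    using derivative_bound[where J = "n + 2", OF compact_cball convex_cball r0(2)] by (elim exE conjE)
  \<comment> \<open>1 for \<open>p\<close> itself, \<open>D\<close> for its derivatives.\<close>
  define Cp where "Cp = 1 + D"
  have Cp: "0 \<le> Cp" using D(1) by (simp add: Cp_def)
  obtain Co where Co: "0 \<le> Co" "\<forall>I h p R b b' \<psi>. osc_setting I h p R b' b \<longrightarrow> symb I (Suc n) Cp p p \<longrightarrow>
     symb I (Suc n) C\<psi> (\<lambda>_. 1) \<psi> \<longrightarrow> (\<forall>\<rho>\<in>I. b' < \<rho> \<longrightarrow> \<psi> \<rho> = 0) \<longrightarrow>
     norm (integral {R..b} (osc h (\<lambda>\<rho>. \<psi> \<rho> * \<rho> ^ (n - 1)))) \<le> Co * R ^ n"
    using osc_bound[OF C\<psi>(1) Cp n] by (elim exE conjE)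
  have main: "norm (\<integral>\<sigma>. indicator {0<..} \<sigma> *\<^sub>R (of_real (\<sigma> ^ (n - 1)) * wave f \<phi> t v (x0 + \<sigma> *\<^sub>R \<omega>)) \<partial>lborel)
       \<le> (B\<phi> + Co) * R ^ n"
    if v: "0 \<le> snd v" and t: "0 < t" and x0: "x0 \<in> cball 0 r0"
      and min: "\<forall>x\<in>cball 0 r0. phase f v x0 \<le> phase f v x"
      and \<omega>: "\<omega> \<in> thick_sphere" and R: "0 \<le> R"
      and cap: "\<forall>\<sigma>>R. x0 + \<sigma> *\<^sub>R \<omega> \<in> cball 0 r0 \<longrightarrow> phase f v x0 + 1 / t < phase f v (x0 + \<sigma> *\<^sub>R \<omega>)"
    for v t x0 \<omega> R
  proof -
    define G where "G \<sigma> = of_real (\<sigma> ^ (n - 1)) * wave f \<phi> t v (x0 + \<sigma> *\<^sub>R \<omega>)" for \<sigma>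
    have "continuous_on UNIV (\<lambda>\<sigma>. wave f \<phi> t v (x0 + \<sigma> *\<^sub>R \<omega>))"
      by (rule continuous_on_compose2[OF wave_continuous[OF r0(2,3) \<phi>c \<phi>(2)]]) (auto intro!: continuous_intros)
    then have Gc: "continuous_on UNIV G" unfolding G_def by (intro continuous_intros)
    have Gi: "G integrable_on {a..b}" for a b
      using Gc by (intro integrable_continuous_real continuous_on_subset[OF Gc]) auto
    have Rn: "R * R ^ (n - 1) = R ^ n" using n by (cases n) auto
    have near: "norm (integral {0..R} G) \<le> B\<phi> * R ^ n"
    proof -
      have "norm (integral {0..R} G) \<le> integral {0..R} (\<lambda>_. B\<phi> * R ^ (n - 1))"
      proof (rule integral_norm_bound_integral[OF Gi])
        fix \<sigma> assume \<sigma>: "\<sigma> \<in> {0..R}"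
        have "\<sigma> ^ (n - 1) * \<bar>\<phi> (x0 + \<sigma> *\<^sub>R \<omega>)\<bar> \<le> R ^ (n - 1) * B\<phi>"
          using \<sigma> B\<phi> B\<phi>0 by (intro mult_mono power_mono) auto
        then show "norm (G \<sigma>) \<le> B\<phi> * R ^ (n - 1)" using \<sigma> by (simp add: G_def norm_mult norm_power mult.commute)
      qed (rule integrable_const_ivl)
      also have "\<dots> = B\<phi> * (R * R ^ (n - 1))" using R by simp
      finally show ?thesis by (simp only: Rn)
    qed
    show ?thesis
    proof (cases "\<forall>\<sigma>>R. \<phi> (x0 + \<sigma> *\<^sub>R \<omega>) = 0")
      case True
      then have "(\<integral>\<sigma>. indicator {0<..} \<sigma> *\<^sub>R G \<sigma> \<partial>lborel) = integral {0..R} G"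
        by (intro lborel_integral_half_line continuous_on_subset[OF Gc]) (auto simp: G_def wave_def)
      moreover have "B\<phi> * R ^ n \<le> (B\<phi> + Co) * R ^ n" using Co(1) R by (intro mult_right_mono) auto
      ultimately show ?thesis using near by (simp add: G_def)
    next
      case False
      then obtain \<sigma>' where \<sigma>': "R < \<sigma>'" "norm (x0 + \<sigma>' *\<^sub>R \<omega>) \<le> r1" using \<phi>(2) by blast
      have r1: "0 \<le> r1" using \<sigma>'(2) norm_ge_zero order_trans by blast
      have nw: "1 \<le> norm \<omega>" "norm \<omega> \<le> exp 1" using \<omega> by (auto simp: thick_sphere_def)
      have x0n: "norm x0 \<le> r0" using x0 by simp
      have \<sigma>bound: "\<sigma> \<le> norm (x0 + \<sigma> *\<^sub>R \<omega>) + r0" if "0 \<le> \<sigma>" for \<sigma>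
      proof -
        have "\<sigma> * 1 \<le> \<sigma> * norm \<omega>" using nw that by (intro mult_left_mono) auto
        also have "\<dots> = norm ((x0 + \<sigma> *\<^sub>R \<omega>) - x0)" using that by simp
        also have "\<dots> \<le> norm (x0 + \<sigma> *\<^sub>R \<omega>) + norm x0" by (rule norm_triangle_ineq4)
        finally show ?thesis using x0n by simp
      qed
      \<comment> \<open>Its maximum \<open>b'\<close> is the last parameter at which the amplitude
        can be nonzero; \<open>b\<close> lies slightly beyond, with the ray still in the open
        ball.\<close>
      define Y where "Y = {\<sigma>. 0 \<le> \<sigma> \<and> norm (x0 + \<sigma> *\<^sub>R \<omega>) \<le> r1}"
      have "closed Y" unfolding Y_def
        by (intro closed_Collect_conj closed_Collect_le continuous_intros)
      moreover have "bounded Y"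
        unfolding bounded_iff Y_def using \<sigma>bound by (intro exI[of _ "r1 + r0"]) (fastforce)
      ultimately have "compact Y" by (simp add: compact_eq_bounded_closed)
      moreover have \<sigma>'Y: "\<sigma>' \<in> Y" using \<sigma>' R by (simp add: Y_def)
      ultimately obtain b' where b': "b' \<in> Y" "\<And>y. y \<in> Y \<Longrightarrow> y \<le> b'"
        using compact_attains_sup[of Y] by blast
      have b'R: "R < b'" using b'(2)[OF \<sigma>'Y] \<sigma>'(1) by simp
      have b'n: "norm (x0 + b' *\<^sub>R \<omega>) \<le> r1" using b'(1) by (simp add: Y_def)
      define A where "A = {\<sigma>. norm (x0 + \<sigma> *\<^sub>R \<omega>) < r0}"
      have A: "open A" unfolding A_def by (intro open_Collect_less continuous_intros)
      have "b' \<in> A" using b'n r0(3) by (simp add: A_def)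
      then obtain \<epsilon> where \<epsilon>: "0 < \<epsilon>" "ball b' \<epsilon> \<subseteq> A" using A by (meson open_contains_ball)
      define b where "b = b' + \<epsilon> / 2"
      have bb': "b' < b" using \<epsilon> by (simp add: b_def)
      \<comment> \<open>\<open>x0\<close> may lie on the boundary sphere, whence
        \<open>0 < \<sigma>\<close>. Points before \<open>b'\<close> are interior, being convex
        combinations that give positive weight to the interior point at \<open>b'\<close>.\<close>
      have sub: "\<sigma> \<in> A" if \<sigma>: "0 < \<sigma>" "\<sigma> \<le> b" for \<sigma>
      proof (cases "b' \<le> \<sigma>")
        case True
        then have "\<sigma> \<in> ball b' \<epsilon>" using \<sigma> \<epsilon>(1) by (simp add: b_def dist_real_def)
        then show ?thesis using \<epsilon>(2) by blast
      next
        case False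
        define \<theta> where "\<theta> = \<sigma> / b'"
        have \<theta>: "0 < \<theta>" "\<theta> \<le> 1" "\<theta> * b' = \<sigma>" using False \<sigma> by (auto simp: \<theta>_def)
        have "x0 + \<sigma> *\<^sub>R \<omega> = (1 - \<theta>) *\<^sub>R x0 + \<theta> *\<^sub>R (x0 + b' *\<^sub>R \<omega>)"
          using \<theta>(3) by (simp add: algebra_simps)
        then have "norm (x0 + \<sigma> *\<^sub>R \<omega>) \<le> norm ((1 - \<theta>) *\<^sub>R x0) + norm (\<theta> *\<^sub>R (x0 + b' *\<^sub>R \<omega>))"
          by (simp only: norm_triangle_ineq)
        also have "\<dots> = (1 - \<theta>) * norm x0 + \<theta> * norm (x0 + b' *\<^sub>R \<omega>)" using \<theta> by simp
        also have "\<dots> \<le> (1 - \<theta>) * r0 + \<theta> * r1" using \<theta> x0n b'n by (intro add_mono mult_left_mono) auto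
        also have "\<dots> < (1 - \<theta>) * r0 + \<theta> * r0" using \<theta> r0(3) by simp
        finally show ?thesis by (simp add: A_def algebra_simps)
      qed
      have AU: "x0 + \<sigma> *\<^sub>R \<omega> \<in> U" and Acb: "x0 + \<sigma> *\<^sub>R \<omega> \<in> cball 0 r0" if "\<sigma> \<in> A" for \<sigma>
        using that r0(2) by (auto simp: A_def subset_iff)
      have x0U: "x0 \<in> U" using x0 r0(2) by blast
      define s where "s = phase f v x0"
      define h where "h \<sigma> = t * (phase f v (x0 + \<sigma> *\<^sub>R \<omega>) - s)" for \<sigma>
      define p where "p \<sigma> = t * (fst v \<bullet> \<omega> + snd v * dd f 1 (x0 + \<sigma> *\<^sub>R \<omega>) \<omega>)" for \<sigma>
      have hd: "(h has_real_derivative p \<sigma>) (at \<sigma>)" if "x0 + \<sigma> *\<^sub>R \<omega> \<in> U" for \<sigma>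
      proof -
        have "((\<lambda>\<sigma>. t * (phase f v (x0 + \<sigma> *\<^sub>R \<omega>) - s)) has_real_derivative
            t * ((fst v \<bullet> \<omega> + snd v * dd f 1 (x0 + \<sigma> *\<^sub>R \<omega>) \<omega>) - 0)) (at \<sigma>)"
          by (intro DERIV_cmult DERIV_diff DERIV_const phase_has_derivative that)
        then show ?thesis unfolding h_def[abs_def] p_def by simp
      qed
      have h0: "h 0 = 0" by (simp add: h_def s_def)
      have hpos: "0 \<le> h \<sigma>" if "\<sigma> \<in> A" for \<sigma>
        using min[rule_format, OF Acb[OF that]] t by (simp add: h_def s_def)
      have hcap: "1 < h \<sigma>" if "R < \<sigma>" "\<sigma> \<in> A" for \<sigma>
      proof -
        have "1 / t < phase f v (x0 + \<sigma> *\<^sub>R \<omega>) - s" using cap that Acb[OF that(2)] by (force simp: s_def)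
        then have "t * (1 / t) < h \<sigma>" unfolding h_def using t by (intro mult_strict_left_mono)
        then show ?thesis using t by simp
      qed
      have RU: "x0 + R *\<^sub>R \<omega> \<in> U"
      proof (cases "R = 0")
        case False
        then show ?thesis using sub[of R] AU R b'R bb' by simp
      qed (use x0U in simp)
      \<comment> \<open>The cap condition speaks only of parameters strictly beyond
        \<open>R\<close>; continuity carries the weak inequality to \<open>R\<close> itself.\<close>
      have hR: "1 \<le> h R"
      proof (rule tendsto_lowerbound)
        show "(h \<longlongrightarrow> h R) (at_right R)"
          using DERIV_isCont[OF hd[OF RU]] by (simp add: isCont_def filterlim_at_split)
        show "eventually (\<lambda>\<sigma>. 1 \<le> h \<sigma>) (at_right R)"
        proof -
          have "eventually (\<lambda>\<sigma>. \<sigma> \<in> {R<..<b}) (at_right R)"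
            using b'R bb' by (intro eventually_at_right_real) simp
          then show ?thesis
            by eventually_elim (use hcap sub R in \<open>auto intro!: less_imp_le\<close>)
        qed
      qed simp
      \<comment> \<open>\<open>R = 0\<close> is excluded here because \<open>h\<close> vanishes at
        0.\<close>
      have Rpos: "0 < R" using hR h0 R by (cases "R = 0") auto
      have Ab: "\<sigma> \<in> A" if "\<sigma> \<in> {R..b}" for \<sigma> using sub[of \<sigma>] that Rpos by simp
      \<comment> \<open>The point at \<open>R\<close> is a convex combination in which the point at
        \<open>\<sigma>\<close> has weight \<open>R / \<sigma>\<close>, and \<open>h\<close>
        vanishes at 0.\<close>
      have hlin: "\<sigma> / R \<le> h \<sigma>" if \<sigma>: "\<sigma> \<in> {R..b}" for \<sigma>
      proof -
        have \<sigma>0: "0 < \<sigma>" "R / \<sigma> \<le> 1" "0 \<le> R / \<sigma>" using \<sigma> Rpos by auto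
        have "phase f v ((1 - R / \<sigma>) *\<^sub>R x0 + (R / \<sigma>) *\<^sub>R (x0 + \<sigma> *\<^sub>R \<omega>)) \<le>
            (1 - R / \<sigma>) * phase f v x0 + R / \<sigma> * phase f v (x0 + \<sigma> *\<^sub>R \<omega>)"
          by (rule convex_onD[OF phase_convex[OF v] \<sigma>0(3,2) x0U AU[OF Ab[OF \<sigma>]]])
        moreover have "(1 - R / \<sigma>) *\<^sub>R x0 + (R / \<sigma>) *\<^sub>R (x0 + \<sigma> *\<^sub>R \<omega>) = x0 + R *\<^sub>R \<omega>"
          using \<sigma>0 by (simp add: algebra_simps)
        ultimately have "phase f v (x0 + R *\<^sub>R \<omega>) \<le> (1 - R / \<sigma>) * phase f v x0 + R / \<sigma> * phase f v (x0 + \<sigma> *\<^sub>R \<omega>)"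
          by (simp only:)
        then have "phase f v (x0 + R *\<^sub>R \<omega>) - s \<le> R / \<sigma> * (phase f v (x0 + \<sigma> *\<^sub>R \<omega>) - s)"
          by (simp add: s_def algebra_simps)
        then have "h R \<le> t * (R / \<sigma> * (phase f v (x0 + \<sigma> *\<^sub>R \<omega>) - s))"
          unfolding h_def using t by (intro mult_left_mono) auto
        then have "1 \<le> R / \<sigma> * h \<sigma>" using hR by (simp add: h_def mult_ac)
        then show ?thesis using Rpos \<sigma>0 by (simp add: field_simps)
      qed
      have hp: "h \<sigma> \<le> \<sigma> * p \<sigma>" if "\<sigma> \<in> A" for \<sigma>
        using mult_left_mono[OF phase_tangent[OF x0U AU[OF that] v], of t] t
        by (simp add: h_def p_def s_def mult_ac)
      have pR: "1 / R \<le> p \<sigma>" if \<sigma>: "\<sigma> \<in> {R..b}" for \<sigma>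
      proof -
        have "\<sigma> / R \<le> \<sigma> * p \<sigma>" using hlin[OF \<sigma>] hp[OF Ab[OF \<sigma>]] by linarith
        then have "\<sigma> * (1 / R) \<le> \<sigma> * p \<sigma>" by simp
        then show ?thesis using \<sigma> Rpos by (subst (asm) mult_le_cancel_left_pos) auto
      qed
      \<comment> \<open>A negative slope at 0 would make \<open>h\<close> negative just after 0,
        where the ray is still in the ball over which \<open>x0\<close> is a minimum.\<close>
      have p0: "0 \<le> p 0"
      proof (rule ccontr)
        assume "\<not> 0 \<le> p 0"
        moreover have "x0 + 0 *\<^sub>R \<omega> \<in> U" using x0U by simp
        ultimately obtain d where d: "0 < d" "\<forall>k>0. k < d \<longrightarrow> h (0 + k) < h 0"
          using DERIV_neg_dec_right[OF hd, of 0] by force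
        define k where "k = min (d / 2) b"
        have k: "0 < k" "k < d" "k \<le> b" using d(1) Rpos b'R bb' by (auto simp: k_def)
        have "h k < 0" using d(2) k h0 by simp
        then show False using hpos[OF sub[OF k(1,3)]] by linarith
      qed
      \<comment> \<open>the amplitude vanishes on \<open>(b', b)\<close>, so no boundary term arises at \<open>b\<close>\<close>
      define I where "I = {0<..} \<inter> (A \<inter> p -` {0<..})"
      have pder: "((\<lambda>\<sigma>. dd f j (x0 + \<sigma> *\<^sub>R \<omega>) \<omega>) has_real_derivative dd f (Suc j) (x0 + \<sigma> *\<^sub>R \<omega>) \<omega>) (at \<sigma>)"
        if "\<sigma> \<in> A" for j \<sigma>
        by (rule line_has_derivative[OF AU[OF that]])
      have "continuous_on A p"
        unfolding p_def
        by (intro continuous_intros continuous_at_imp_continuous_on ballI DERIV_isCont[OF pder])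
      then have "open (A \<inter> p -` {0<..})" using A by (intro continuous_open_preimage) auto
      then have I: "open I" "I \<subseteq> {0<..}" unfolding I_def by auto
      have IA: "\<sigma> \<in> A" "0 < \<sigma>" "0 < p \<sigma>" if "\<sigma> \<in> I" for \<sigma> using that by (auto simp: I_def)
      have RbI: "{R..b} \<subseteq> I"
      proof
        fix \<sigma> assume \<sigma>: "\<sigma> \<in> {R..b}"
        have "0 < 1 / R" using Rpos by simp
        then have "0 < p \<sigma>" using pR[OF \<sigma>] by linarith
        then show "\<sigma> \<in> I" using Ab[OF \<sigma>] \<sigma> Rpos by (simp add: I_def)
      qed
      have setting: "osc_setting I h p R b' b"
        unfolding osc_setting_def using I Rpos b'R bb' RbI hd AU IA pR by auto
      \<comment> \<open>The affine part of the phase enters only \<open>p\<close>; all derivatives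
        of \<open>p\<close> come from \<open>f\<close> alone.\<close>
      define q where "q i \<sigma> = (if i = 0 then p \<sigma> else t * (snd v * dd f (Suc i) (x0 + \<sigma> *\<^sub>R \<omega>) \<omega>))" for i \<sigma>
      have "symb I (Suc n) Cp p (q 0)"
      proof (rule symb_derivatives[OF I(1)])
        fix i \<rho> assume i: "i \<le> Suc n" and \<rho>: "\<rho> \<in> I"
        note \<rho>A = IA[OF \<rho>]
        show "\<bar>q i \<rho>\<bar> \<le> Cp * p \<rho> / \<rho> ^ i"
        proof (cases "i = 0")
          case True
          have "1 * p \<rho> \<le> Cp * p \<rho>" using \<rho>A D(1) by (intro mult_right_mono) (auto simp: Cp_def)
          then show ?thesis using True \<rho>A by (simp add: q_def)
        next
          case False
          define \<Delta> where "\<Delta> = dd f 1 (x0 + \<rho> *\<^sub>R \<omega>) \<omega> - dd f 1 x0 \<omega>"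
          define X where "X = dd f (Suc i) (x0 + \<rho> *\<^sub>R \<omega>) \<omega>"
          \<comment> \<open>Homogeneity in the direction gives \<open>\<rho> ^ Suc i\<close> on the
            left and \<open>\<rho>\<close> on the right; cancelling one \<open>\<rho>\<close> leaves
            the power demanded by \<open>symb\<close>.\<close>
          have "\<bar>dd f (Suc i) (x0 + \<rho> *\<^sub>R \<omega>) (\<rho> *\<^sub>R \<omega>)\<bar> \<le>
             D * (dd f 1 (x0 + \<rho> *\<^sub>R \<omega>) (\<rho> *\<^sub>R \<omega>) - dd f 1 x0 (\<rho> *\<^sub>R \<omega>))"
            using D(2) x0 Acb[OF \<rho>A(1)] i False by simp
          then have "\<bar>\<rho> ^ Suc i * X\<bar> \<le> D * (\<rho> ^ 1 * dd f 1 (x0 + \<rho> *\<^sub>R \<omega>) \<omega> - \<rho> ^ 1 * dd f 1 x0 \<omega>)"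
            unfolding dd_scale[OF AU[OF \<rho>A(1)]] dd_scale[OF x0U] X_def .
          then have "\<rho> * (\<rho> ^ i * \<bar>X\<bar>) \<le> \<rho> * (D * \<Delta>)"
            using \<rho>A by (simp add: abs_mult \<Delta>_def algebra_simps)
          then have X: "\<rho> ^ i * \<bar>X\<bar> \<le> D * \<Delta>" using \<rho>A by (subst (asm) mult_le_cancel_left_pos) auto
          have "p \<rho> = p 0 + t * snd v * \<Delta>" by (simp add: p_def \<Delta>_def algebra_simps)
          then have p\<Delta>: "t * snd v * \<Delta> \<le> p \<rho>" using p0 by simp
          have "\<rho> ^ i * \<bar>q i \<rho>\<bar> = t * snd v * (\<rho> ^ i * \<bar>X\<bar>)"
            using False t v by (simp add: q_def X_def abs_mult)
          also have "\<dots> \<le> t * snd v * (D * \<Delta>)" using X t v by (intro mult_left_mono) auto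
          also have "\<dots> = D * (t * snd v * \<Delta>)" by simp
          also have "\<dots> \<le> D * p \<rho>" using p\<Delta> D(1) by (intro mult_left_mono)
          also have "\<dots> \<le> Cp * p \<rho>" using \<rho>A by (intro mult_right_mono) (auto simp: Cp_def)
          finally show ?thesis using \<rho>A by (simp add: pos_le_divide_eq mult.commute)
        qed
      next
        fix i \<rho> assume "\<rho> \<in> I"
        then have \<rho>: "\<rho> \<in> A" by (rule IA)
        show "(q i has_real_derivative q (Suc i) \<rho>) (at \<rho>)"
        proof (cases "i = 0")
          case True
          have "((\<lambda>\<sigma>. t * (fst v \<bullet> \<omega> + snd v * dd f 1 (x0 + \<sigma> *\<^sub>R \<omega>) \<omega>)) has_real_derivative
              t * (0 + snd v * dd f (Suc 1) (x0 + \<rho> *\<^sub>R \<omega>) \<omega>)) (at \<rho>)"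
            by (intro DERIV_cmult DERIV_add DERIV_const pder[OF \<rho>])
          then show ?thesis using True by (simp add: q_def[abs_def] p_def[abs_def])
        next
          case False
          have "((\<lambda>\<sigma>. t * (snd v * dd f (Suc i) (x0 + \<sigma> *\<^sub>R \<omega>) \<omega>)) has_real_derivative
              t * (snd v * dd f (Suc (Suc i)) (x0 + \<rho> *\<^sub>R \<omega>) \<omega>)) (at \<rho>)"
            by (intro DERIV_cmult pder[OF \<rho>])
          then show ?thesis using False by (simp add: q_def[abs_def])
        qed
      qed
      moreover have "q 0 = p" by (simp add: q_def fun_eq_iff)
      ultimately have symp: "symb I (Suc n) Cp p p" by (simp only:)
      have "I \<subseteq> {0<..<2 * r0 + 1}"
      proof
        fix \<sigma> assume "\<sigma> \<in> I"
        then have "0 < \<sigma>" "norm (x0 + \<sigma> *\<^sub>R \<omega>) < r0" using IA[of \<sigma>] by (auto simp: A_def)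
        then show "\<sigma> \<in> {0<..<2 * r0 + 1}" using \<sigma>bound[of \<sigma>] by simp
      qed
      then have sym\<psi>: "symb I (Suc n) C\<psi> (\<lambda>_. 1) (\<lambda>\<rho>. \<phi> (x0 + \<rho> *\<^sub>R \<omega>))"
        using C\<psi>(2) I(1) nw(2) by blast
      have \<psi>0: "\<phi> (x0 + \<sigma> *\<^sub>R \<omega>) = 0" if "b' < \<sigma>" for \<sigma>
        using \<phi>(2)[of "x0 + \<sigma> *\<^sub>R \<omega>"] b'(2)[of \<sigma>] b'R Rpos that by (force simp: Y_def)
      have far: "norm (integral {R..b} (osc h (\<lambda>\<rho>. \<phi> (x0 + \<rho> *\<^sub>R \<omega>) * \<rho> ^ (n - 1)))) \<le> Co * R ^ n"
        using Co(2) setting symp sym\<psi> \<psi>0 by blast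
      have "G = (\<lambda>\<sigma>. exp (- \<i> * of_real (t * s)) * osc h (\<lambda>\<rho>. \<phi> (x0 + \<rho> *\<^sub>R \<omega>) * \<rho> ^ (n - 1)) \<sigma>)"
        unfolding G_def wave_eq_osc[where s = s] h_def ..
      then have "integral {R..b} G = exp (- \<i> * of_real (t * s)) * integral {R..b} (osc h (\<lambda>\<rho>. \<phi> (x0 + \<rho> *\<^sub>R \<omega>) * \<rho> ^ (n - 1)))"
        by simp
      then have far': "norm (integral {R..b} G) \<le> Co * R ^ n"
        using far by (simp add: norm_mult)
      have "(\<integral>\<sigma>. indicator {0<..} \<sigma> *\<^sub>R G \<sigma> \<partial>lborel) = integral {0..b} G"
        using \<psi>0 bb' by (intro lborel_integral_half_line continuous_on_subset[OF Gc]) (auto simp: G_def wave_def)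
      also have "\<dots> = integral {0..R} G + integral {R..b} G"
        using Rpos b'R bb' Gi by (intro Henstock_Kurzweil_Integration.integral_combine[symmetric]) auto
      also have "norm \<dots> \<le> B\<phi> * R ^ n + Co * R ^ n"
        using near far' by (intro norm_triangle_le) simp
      finally show ?thesis by (simp add: G_def distrib_right)
    qed
  qed
  then show ?thesis using B\<phi>0 Co(1) unfolding n_def ray_estimate_def by (intro exI[of _ "B\<phi> + Co"] conjI allI impI) auto
qed

end


section \<open>Caps of the graph and the final estimate\<close>

lemma inner_graph_point: "(x, f x) \<bullet> v = phase f v x"
  by (simp add: phase_def inner_prod_def inner_commute[of x] mult.commute)

lemma mu_hat_eq_wave: "mu_hat f \<phi> (t *\<^sub>R v) = (\<integral>x. wave f \<phi> t v x \<partial>lborel)"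
  by (simp add: mu_hat_def wave_def phase_def distrib_left mult.assoc)

text \<open>As \<open>f\<close> and \<open>\<phi>\<close> are real, conjugation reverses the
  frequency; this reduces the theorem to positive t.\<close>

lemma mu_hat_minus: "mu_hat f \<phi> (- l) = cnj (mu_hat f \<phi> l)"
  unfolding mu_hat_def by (subst Bochner_Integration.integral_cnj[symmetric])
    (intro Bochner_Integration.integral_cong refl, simp add: exp_cnj algebra_simps)

theorem theorem1p1:
  fixes f \<phi> :: "real^'n \<Rightarrow> real" and U :: "(real^'n) set" and r0 :: real
  assumes "r0 > 0"
    and "open U" and "cball 0 r0 \<subseteq> U"
    and "convex_on U f" and "f real_analytic_on U"
    and "\<exists>x\<in>U. f x \<noteq> 0"
    and "f 0 = 0" and "GDERIV f 0 :> 0"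
    and "C_k (CARD('n) + 1) \<phi>"
    and "closure {x. \<phi> x \<noteq> 0} \<subseteq> ball 0 r0"
  shows "\<exists>C. \<forall>(v :: (real^'n) \<times> real) (t :: real).
           norm v = 1 \<longrightarrow> snd v \<ge> 0 \<longrightarrow> t \<noteq> 0 \<longrightarrow>
           cmod (mu_hat f \<phi> (t *\<^sub>R v))
             \<le> C * measure (graph_surface_measure U f)
                   {p \<in> graph_over_cball U f r0.
                      s_min U f r0 v \<le> p \<bullet> v \<and> p \<bullet> v \<le> s_min U f r0 v + 1 / \<bar>t\<bar>}"
proof -
  interpret convex_analytic f U
    using assms by unfold_locales
  define n where "n = CARD('n)"
  have n: "1 \<le> n" by (simp add: n_def Suc_le_eq)
  \<comment> \<open>The compact support leaves a margin inside the open ball, so that on every ray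
    the amplitude vanishes before the ray leaves the ball.\<close>
  obtain r1 where r1: "r1 < r0" "\<And>x. \<phi> x \<noteq> 0 \<Longrightarrow> norm x \<le> r1"
  proof (cases "closure {x. \<phi> x \<noteq> 0} = {}")
    case True
    then have "\<phi> x = 0" for x using closure_subset[of "{x. \<phi> x \<noteq> 0}"] by blast
    then show thesis using assms(1) by (intro that[of 0]) auto
  next
    case False
    have "bounded (closure {x. \<phi> x \<noteq> 0})" using bounded_subset[OF bounded_ball assms(10)] .
    then have "compact (closure {x. \<phi> x \<noteq> 0})" by (simp add: compact_eq_bounded_closed)
    from continuous_attains_sup[OF this False continuous_on_norm_id]
    obtain y where y: "y \<in> closure {x. \<phi> x \<noteq> 0}" "\<And>x. x \<in> closure {x. \<phi> x \<noteq> 0} \<Longrightarrow> norm x \<le> norm y"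
      by blast
    show thesis
    proof (rule that[of "norm y"])
      show "norm y < r0" using y(1) assms(10) by (auto simp: subset_iff)
      show "norm x \<le> norm y" if "\<phi> x \<noteq> 0" for x
        using y(2) closure_subset[of "{x. \<phi> x \<noteq> 0}"] that by blast
    qed
  qed
  have \<phi>k: "C_k (Suc CARD('n)) \<phi>" using assms(9) by simp
  have \<phi>c: "continuous_on UNIV \<phi>" using C_k_continuous[OF \<phi>k] .
  have "\<exists>C\<ge>0. ray_estimate f \<phi> r0 C"
    by (rule ray_bound[OF assms(1,3) r1(1) \<phi>k]) (rule r1(2))
  then obtain C0 where C0: "0 \<le> C0" and ray: "ray_estimate f \<phi> r0 C0" by blast
  \<comment> \<open>The factor \<open>n\<close> compensates for the integral of \<sigma>^(n - 1)
    over [0, R], which is R^n / n.\<close>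
  define C where "C = C0 * n"
  have C: "0 \<le> C" using C0 by (simp add: C_def)
  have pos: "cmod (mu_hat f \<phi> (t *\<^sub>R v)) \<le> C * measure (graph_surface_measure U f)
        {p \<in> graph_over_cball U f r0. s_min U f r0 v \<le> p \<bullet> v \<and> p \<bullet> v \<le> s_min U f r0 v + 1 / t}"
    if v: "0 \<le> snd v" and t: "0 < t" for v t
  proof -
    let ?g = "phase f v"
    let ?S = "{p \<in> graph_over_cball U f r0. s_min U f r0 v \<le> p \<bullet> v \<and> p \<bullet> v \<le> s_min U f r0 v + 1 / t}"
    have gc: "continuous_on (cball 0 r0) ?g"
      using phase_continuous continuous_on_subset assms(3) by blast
    obtain x0 where x0: "x0 \<in> cball 0 r0" "\<And>x. x \<in> cball 0 r0 \<Longrightarrow> ?g x0 \<le> ?g x"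
      using continuous_attains_inf[OF compact_cball _ gc] assms(1) by force
    have graph: "graph_over_cball U f r0 = (\<lambda>x. (x, f x)) ` cball 0 r0"
      using assms(3) by (auto simp: graph_over_cball_def graph_hypersurface_def)
    have smin: "s_min U f r0 v = ?g x0"
      unfolding s_min_def graph
    proof (rule Least_equality)
      show "\<exists>p\<in>(\<lambda>x. (x, f x)) ` cball 0 r0. ?g x0 = p \<bullet> v"
        using x0(1) by (auto simp: inner_graph_point intro!: bexI[of _ x0])
      show "?g x0 \<le> y" if "\<exists>p\<in>(\<lambda>x. (x, f x)) ` cball 0 r0. y = p \<bullet> v" for y
        using that x0(2) by (auto simp: inner_graph_point)
    qed
    define X where "X = {x \<in> cball 0 r0. ?g x \<le> ?g x0 + 1 / t}"
    have "closed X"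
      using continuous_closed_preimage[OF gc closed_cball closed_atMost[of "?g x0 + 1 / t"]]
      by (simp add: X_def vimage_def Int_def conj_commute)
    then have Xb [measurable]: "X \<in> sets borel" by simp
    have gconv: "convex_on (cball 0 r0) ?g"
      using phase_convex[OF v] assms(3) convex_on_subset convex_cball by blast
    \<comment> \<open>Convexity makes \<open>X\<close> star-shaped about \<open>x0\<close>, so every
      ray from \<open>x0\<close> meets it in an interval starting at 0.\<close>
    have Xconv: "convex X"
      unfolding convex_alt
    proof (intro ballI allI impI)
      fix x y and u :: real assume xy: "x \<in> X" "y \<in> X" and u: "0 \<le> u \<and> u \<le> 1"
      have "?g ((1 - u) *\<^sub>R x + u *\<^sub>R y) \<le> (1 - u) * ?g x + u * ?g y"
        using xy u by (intro convex_onD[OF gconv]) (auto simp: X_def)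
      also have "\<dots> \<le> (1 - u) * (?g x0 + 1 / t) + u * (?g x0 + 1 / t)"
        using xy u by (intro add_mono mult_left_mono) (auto simp: X_def)
      also have "\<dots> = ?g x0 + 1 / t" by (simp flip: distrib_right)
      finally have "?g ((1 - u) *\<^sub>R x + u *\<^sub>R y) \<le> ?g x0 + 1 / t" .
      moreover have "(1 - u) *\<^sub>R x + u *\<^sub>R y \<in> cball 0 r0"
        using xy u by (intro convexD[OF convex_cball]) (auto simp: X_def simp del: mem_cball)
      ultimately show "(1 - u) *\<^sub>R x + u *\<^sub>R y \<in> X" by (simp add: X_def)
    qed
    have x0X: "x0 \<in> X" using x0(1) t by (simp add: X_def)
    have "closed ?S"
    proof -
      have "compact ((\<lambda>x. (x, f x)) ` cball 0 r0)"
        by (intro compact_continuous_image continuous_intros continuous_on_subset[OF continuous_f assms(3)]) simp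
      then have "closed (graph_over_cball U f r0)" unfolding graph by (rule compact_imp_closed)
      moreover have "?S = graph_over_cball U f r0 \<inter> ({p. s_min U f r0 v \<le> p \<bullet> v} \<inter> {p. p \<bullet> v \<le> s_min U f r0 v + 1 / t})"
        by auto
      ultimately show ?thesis by (auto intro!: closed_Int closed_Collect_le continuous_intros)
    qed
    then have Sb: "?S \<in> sets borel" by simp
    have XS: "(x, f x) \<in> ?S \<longleftrightarrow> x \<in> X" for x
      using x0(2) by (auto simp: graph X_def smin inner_graph_point)
    have XK: "X \<subseteq> cball 0 r0" by (auto simp: X_def)
    have le: "emeasure lborel X \<le> ennreal (measure (graph_surface_measure U f) ?S)"
      by (rule lebesgue_le_surface_measure[OF compact_cball assms(3) Xb XK Sb XS])
    have wc: "continuous_on UNIV (wave f \<phi> t v)"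
      by (rule wave_continuous[OF assms(3) r1(1) \<phi>c r1(2)])
    have wint: "integrable lborel (wave f \<phi> t v)"
    proof -
      have "integrable lborel (\<lambda>x. indicator (cball 0 r0) x *\<^sub>R wave f \<phi> t v x)"
        using continuous_on_subset[OF wc] by (intro borel_integrable_compact) auto
      moreover have "indicator (cball 0 r0) x *\<^sub>R wave f \<phi> t v x = wave f \<phi> t v x" for x
        using r1(1) r1(2)[of x] by (cases "\<phi> x = 0") (auto simp: indicator_def wave_def)
      ultimately show ?thesis by simp
    qed
    have "ennreal (norm (\<integral>x. wave f \<phi> t v x \<partial>lborel)) \<le> ennreal C * (\<integral>\<^sup>+x. indicator X x \<partial>lborel)"
    proof (rule polar_comparison[where ?x0.0 = x0, OF wint])
      fix \<omega> :: "real^'n" assume \<omega>: "\<omega> \<in> thick_sphere"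
      then have nw: "1 \<le> norm \<omega>" by (simp add: thick_sphere_def)
      \<comment> \<open>Its maximum \<open>R\<close> plays two roles: past \<open>R\<close> the ray
        is out of the cap, as the ray estimate requires, and up to \<open>R\<close> it is inside,
        which bounds the volume of the cap from below.\<close>
      define Y where "Y = {\<sigma>. 0 \<le> \<sigma> \<and> x0 + \<sigma> *\<^sub>R \<omega> \<in> X}"
      have "closed Y"
      proof -
        have "closed ((\<lambda>\<sigma>. x0 + \<sigma> *\<^sub>R \<omega>) -` X)"
          using \<open>closed X\<close> by (intro closed_vimage continuous_intros)
        moreover have "Y = {0..} \<inter> ((\<lambda>\<sigma>. x0 + \<sigma> *\<^sub>R \<omega>) -` X)" by (auto simp: Y_def)
        ultimately show ?thesis by (simp add: closed_Int)
      qed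
      moreover have "bounded Y"
        unfolding bounded_iff
      proof (intro exI[of _ "2 * r0"] ballI)
        fix \<sigma> assume "\<sigma> \<in> Y"
        then have \<sigma>: "0 \<le> \<sigma>" "norm (x0 + \<sigma> *\<^sub>R \<omega>) \<le> r0" using XK by (auto simp: Y_def)
        have "\<sigma> * 1 \<le> \<sigma> * norm \<omega>" using nw \<sigma> by (intro mult_left_mono) auto
        also have "\<dots> = norm ((x0 + \<sigma> *\<^sub>R \<omega>) - x0)" using \<sigma> by simp
        also have "\<dots> \<le> norm (x0 + \<sigma> *\<^sub>R \<omega>) + norm x0" by (rule norm_triangle_ineq4)
        finally show "norm \<sigma> \<le> 2 * r0" using \<sigma> x0(1) by simp
      qed
      ultimately have "compact Y" by (simp add: compact_eq_bounded_closed)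
      moreover have "0 \<in> Y" using x0X by (simp add: Y_def)
      ultimately obtain R where R: "R \<in> Y" "\<And>y. y \<in> Y \<Longrightarrow> y \<le> R"
        using compact_attains_sup[of Y] by blast
      have R0: "0 \<le> R" and RX: "x0 + R *\<^sub>R \<omega> \<in> X" using R(1) by (auto simp: Y_def)
      have inX: "x0 + \<sigma> *\<^sub>R \<omega> \<in> X" if \<sigma>: "0 \<le> \<sigma>" "\<sigma> \<le> R" for \<sigma>
      proof (cases "R = 0")
        case False
        have "(1 - \<sigma> / R) *\<^sub>R x0 + (\<sigma> / R) *\<^sub>R (x0 + R *\<^sub>R \<omega>) \<in> X"
          using \<sigma> R0 False by (intro convexD[OF Xconv x0X RX]) auto
        moreover have "(1 - \<sigma> / R) *\<^sub>R x0 + (\<sigma> / R) *\<^sub>R (x0 + R *\<^sub>R \<omega>) = x0 + \<sigma> *\<^sub>R \<omega>"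
          using False by (simp add: algebra_simps)
        ultimately show ?thesis by simp
      qed (use \<sigma> x0X in simp)
      have cap: "\<forall>\<sigma>>R. x0 + \<sigma> *\<^sub>R \<omega> \<in> cball 0 r0 \<longrightarrow> ?g x0 + 1 / t < ?g (x0 + \<sigma> *\<^sub>R \<omega>)"
      proof (intro allI impI)
        fix \<sigma> assume \<sigma>: "R < \<sigma>" "x0 + \<sigma> *\<^sub>R \<omega> \<in> cball 0 r0"
        then have "\<sigma> \<notin> Y" using R(2)[of \<sigma>] by auto
        then show "?g x0 + 1 / t < ?g (x0 + \<sigma> *\<^sub>R \<omega>)" using \<sigma> R0 by (auto simp: Y_def X_def)
      qed
      have ft: "(\<integral>\<^sup>+\<sigma>. ennreal (\<sigma> ^ (n - 1)) * indicator {0..R} \<sigma> \<partial>lborel) = ennreal (R ^ n / n - 0 ^ n / n)"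
      proof (rule nn_integral_FTC_Icc)
        show "((\<lambda>\<sigma>. \<sigma> ^ n / n) has_real_derivative \<sigma> ^ (n - 1)) (at \<sigma>)" for \<sigma> :: real
          using n by (auto intro!: derivative_eq_intros)
      qed (use R0 in auto)
      have "ennreal (R ^ n / n) \<le> (\<integral>\<^sup>+\<sigma>. ennreal (indicator {0<..} \<sigma> * \<sigma> ^ (n - 1)) * indicator X (x0 + \<sigma> *\<^sub>R \<omega>) \<partial>lborel)"
      proof -
        have "ennreal (R ^ n / n) = (\<integral>\<^sup>+\<sigma>. ennreal (\<sigma> ^ (n - 1)) * indicator {0..R} \<sigma> \<partial>lborel)"
          unfolding ft using n by (simp add: zero_power)
        also have "\<dots> \<le> (\<integral>\<^sup>+\<sigma>. ennreal (indicator {0<..} \<sigma> * \<sigma> ^ (n - 1)) * indicator X (x0 + \<sigma> *\<^sub>R \<omega>) \<partial>lborel)"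
        proof (rule nn_integral_mono_AE)
          have "AE \<sigma> in lborel. \<sigma> \<noteq> (0 :: real)" by (rule AE_lborel_singleton)
          then show "AE \<sigma> in lborel. ennreal (\<sigma> ^ (n - 1)) * indicator {0..R} \<sigma> \<le>
              ennreal (indicator {0<..} \<sigma> * \<sigma> ^ (n - 1)) * indicator X (x0 + \<sigma> *\<^sub>R \<omega>)"
            by eventually_elim (use inX in \<open>auto simp: indicator_def\<close>)
        qed
        finally show ?thesis .
      qed
      then have lower: "ennreal C * ennreal (R ^ n / n) \<le>
          ennreal C * (\<integral>\<^sup>+\<sigma>. ennreal (indicator {0<..} \<sigma> * \<sigma> ^ (n - 1)) * indicator X (x0 + \<sigma> *\<^sub>R \<omega>) \<partial>lborel)"
        by (rule mult_left_mono) simp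
      have "norm (\<integral>\<sigma>. indicator {0<..} \<sigma> *\<^sub>R (of_real (\<sigma> ^ (n - 1)) * wave f \<phi> t v (x0 + \<sigma> *\<^sub>R \<omega>)) \<partial>lborel) \<le> C0 * R ^ n"
        using ray[unfolded ray_estimate_def] v t x0 \<omega> R0 cap unfolding n_def by blast
      also have "C0 * R ^ n = C * (R ^ n / n)" using n by (simp add: C_def)
      finally have "ennreal (norm (\<integral>\<sigma>. indicator {0<..} \<sigma> *\<^sub>R (of_real (\<sigma> ^ (n - 1)) * wave f \<phi> t v (x0 + \<sigma> *\<^sub>R \<omega>)) \<partial>lborel))
          \<le> ennreal C * ennreal (R ^ n / n)"
        using C R0 by (simp add: ennreal_mult[symmetric] ennreal_leI)
      from order_trans[OF this lower]
      show "ennreal (norm (\<integral>\<sigma>. indicator {0<..} \<sigma> *\<^sub>R (of_real (\<sigma> ^ (DIM(real^'n) - 1)) * wave f \<phi> t v (x0 + \<sigma> *\<^sub>R \<omega>)) \<partial>lborel))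
        \<le> ennreal C * (\<integral>\<^sup>+\<sigma>. ennreal (indicator {0<..} \<sigma> * \<sigma> ^ (DIM(real^'n) - 1)) * indicator X (x0 + \<sigma> *\<^sub>R \<omega>) \<partial>lborel)"
        by (simp add: n_def)
    qed measurable
    also have "\<dots> = ennreal C * emeasure lborel X" by simp
    also have "\<dots> \<le> ennreal C * ennreal (measure (graph_surface_measure U f) ?S)"
      using le by (rule mult_left_mono) simp
    also have "\<dots> = ennreal (C * measure (graph_surface_measure U f) ?S)"
      using C by (simp add: ennreal_mult)
    finally show ?thesis using C by (simp add: mu_hat_eq_wave)
  qed
  show ?thesis
  proof (intro exI[of _ C] allI impI)
    fix v :: "(real^'n) \<times> real" and t :: real
    assume v: "norm v = 1" "0 \<le> snd v" and t: "t \<noteq> 0"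
    have "cmod (mu_hat f \<phi> (t *\<^sub>R v)) = cmod (mu_hat f \<phi> (\<bar>t\<bar> *\<^sub>R v))"
    proof (cases "0 \<le> t")
      case False
      then show ?thesis using mu_hat_minus[of f \<phi> "t *\<^sub>R v"] by simp
    qed simp
    then show "cmod (mu_hat f \<phi> (t *\<^sub>R v)) \<le> C * measure (graph_surface_measure U f)
        {p \<in> graph_over_cball U f r0. s_min U f r0 v \<le> p \<bullet> v \<and> p \<bullet> v \<le> s_min U f r0 v + 1 / \<bar>t\<bar>}"
      using pos[OF v(2), of "\<bar>t\<bar>"] t by simp
  qed
qed

end
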